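(* Let $M$ be a connected manifold and $\Gamma$ a countable group acting properly discontinuously and effectively on $M$. Let $L$ be an elliptic diffusion operator on $M$, symmetric with respect to a smooth volume element $\varphi^2dv$, such that $L$ and $\varphi$ are $\Gamma$-invariant. If $M$ is $L$-recurrent mod $\Gamma$, then any bounded $L$-harmonic function on $M$ is invariant under the $FC$-hypercenter of $\Gamma$. In particular, if $\Gamma$ is $FC$-hypercentral, then any bounded $L$-harmonic function on $M$ is constant.
   Context: An elliptic diffusion operator $L$ on $M$ is written in local coordinates as $Lf=\frac12\sum a^{ij}\partial_i\partial_jf+\sum b^k\partial_kf$ with smooth coefficients and $(a^{ij})$ symmetric and positive definite. The inverse of $(a^{ij})$ defines the Riemannian metric associated to $L$; $dv$ is its volume element, and $\varphi$ is a positive smooth function. Symmetric with respect to $\varphi^2dv$ means $\int (Lf)g\,\varphi^2dv=\int f(Lg)\,\varphi^2dv$ for all $f,g\in C^\infty_c(M)$. $M$ is $L$-recurrent mod $\Gamma$ if the stochastic process on $\Gamma\backslash M$ induced by the diffusion process on $M$ with generator $L$ (which has infinite life time) is recurrent; equivalently, for any $\Gamma$-invariant neighborhood $U$ of any orbit $\Gamma x$, $x\in M$, the $L$-diffusion from any starting point hits $U$ almost surely. A smooth function $h$ is $L$-harmonic if $Lh=0$. For a group $\Gamma$, the $FC$-center $FC(\Gamma)$ is the normal subgroup of all elements whose conjugacy class is finite. The upper $FC$-central series is defined by $\Gamma_0=\{e\}$, $\Gamma_{\beta+1}/\Gamma_\beta=FC(\Gamma/\Gamma_\beta)$, and $\Gamma_\alpha=\bigcup_{\beta<\alpha}\Gamma_\beta$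 for limit ordinals $\alpha$. It stabilizes at a normal subgroup, the $FC$-hypercenter of $\Gamma$. $\Gamma$ is $FC$-hypercentral if it equals its $FC$-hypercenter. *)

theory Defs
  imports "HOL-Probability.Probability" "HOL-Algebra.Group_Action"
begin

section \<open>Smooth functions on open subsets of normed spaces\<close>

primrec C_k_on :: "nat \<Rightarrow> 'a set \<Rightarrow> ('a::real_normed_vector \<Rightarrow> 'b::real_normed_vector) \<Rightarrow> bool" where
  "C_k_on 0 S f \<longleftrightarrow> continuous_on S f"
| "C_k_on (Suc k) S f \<longleftrightarrow>
     (\<forall>x\<in>S. f differentiable (at x)) \<and> (\<forall>v. C_k_on k S (\<lambda>x. frechet_derivative f (at x) v))"

text \<open>The set \<open>S\<close> is always open where this is used, and the domain is finite-dimensional, so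
  that directional derivatives control the full derivative.\<close>

definition smooth_on :: "'a set \<Rightarrow> ('a::real_normed_vector \<Rightarrow> 'b::real_normed_vector) \<Rightarrow> bool" where
  "smooth_on S f \<longleftrightarrow> (\<forall>k. C_k_on k S f)"

definition partial :: "'n \<Rightarrow> (real^'n \<Rightarrow> real) \<Rightarrow> real^'n \<Rightarrow> real" where
  "partial i F y = frechet_derivative F (at y) (axis i 1)"


section \<open>Smooth manifolds\<close>

text \<open>A manifold is a whole (Hausdorff, second countable) type with a smooth atlas. A chart is a
  pair of its domain and its coordinate map; the coordinate map is irrelevant outside the domain,
  and \<open>inv_into U c\<close> is the inverse of the chart \<open>(U, c)\<close>.\<close>

type_synonym ('m, 'n) chart = "'m set \<times> ('m \<Rightarrow> real^'n)"

definition smooth_atlas :: "('m::topological_space, 'n::finite) chart set \<Rightarrow> bool" where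
  "smooth_atlas A \<longleftrightarrow>
     (\<Union>(U, c)\<in>A. U) = UNIV \<and>
     (\<forall>(U, c)\<in>A. open U \<and> open (c ` U) \<and> homeomorphism U (c ` U) c (inv_into U c)) \<and>
     (\<forall>(U, c)\<in>A. \<forall>(V, d)\<in>A. smooth_on (c ` (U \<inter> V)) (d \<circ> inv_into U c))"

definition smooth_fun :: "('m::topological_space, 'n::finite) chart set \<Rightarrow> ('m \<Rightarrow> real) \<Rightarrow> bool" where
  "smooth_fun A f \<longleftrightarrow> (\<forall>(U, c)\<in>A. smooth_on (c ` U) (f \<circ> inv_into U c))"

definition compactly_supported :: "('m::topological_space \<Rightarrow> real) \<Rightarrow> bool" where
  "compactly_supported f \<longleftrightarrow> compact (closure {x. f x \<noteq> 0})"

definition smooth_map :: "('m::topological_space, 'n::finite) chart set \<Rightarrow> ('m \<Rightarrow> 'm) \<Rightarrow> bool" where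
  "smooth_map A F \<longleftrightarrow> continuous_on UNIV F \<and>
     (\<forall>(U, c)\<in>A. \<forall>(V, d)\<in>A. smooth_on (c ` (U \<inter> F -` V)) (d \<circ> F \<circ> inv_into U c))"


section \<open>Elliptic diffusion operators\<close>

text \<open>Only the values of an operator \<open>L\<close> on smooth functions are ever used. Since a smooth function
  on \<open>M\<close> can have any prescribed 2-jet at a point, \<open>a\<close> and \<open>b\<close> are determined on \<open>c ` U\<close> by \<open>L\<close>.\<close>

definition local_coefficients ::
  "('m::topological_space, 'n::finite) chart set \<Rightarrow> (('m \<Rightarrow> real) \<Rightarrow> 'm \<Rightarrow> real) \<Rightarrow> ('m, 'n) chart
    \<Rightarrow> (real^'n \<Rightarrow> real^'n^'n) \<Rightarrow> (real^'n \<Rightarrow> real^'n) \<Rightarrow> bool" where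
  "local_coefficients A L ch a b \<longleftrightarrow> (case ch of (U, c) \<Rightarrow>
     smooth_on (c ` U) a \<and> smooth_on (c ` U) b \<and>
     (\<forall>y\<in>c ` U. transpose (a y) = a y \<and> (\<forall>w. w \<noteq> 0 \<longrightarrow> w \<bullet> (a y *v w) > 0)) \<and>
     (\<forall>f. smooth_fun A f \<longrightarrow> (\<forall>x\<in>U. L f x =
        (1/2) * (\<Sum>i\<in>UNIV. \<Sum>j\<in>UNIV. a (c x) $ i $ j * partial i (partial j (f \<circ> inv_into U c)) (c x))
        + (\<Sum>k\<in>UNIV. b (c x) $ k * partial k (f \<circ> inv_into U c) (c x)))))"

definition elliptic_diffusion_operator ::
  "('m::topological_space, 'n::finite) chart set \<Rightarrow> (('m \<Rightarrow> real) \<Rightarrow> 'm \<Rightarrow> real) \<Rightarrow> bool" where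
  "elliptic_diffusion_operator A L \<longleftrightarrow> (\<forall>ch\<in>A. \<exists>a b. local_coefficients A L ch a b)"

text \<open>The Riemannian volume of the metric \<open>(g\<^sub>i\<^sub>j) = (a\<^sup>i\<^sup>j)\<^sup>-\<^sup>1\<close>: in every chart it has density
  \<open>sqrt (det g)\<close> with respect to Lebesgue measure. As countably many charts cover the manifold,
  this determines the measure.\<close>

definition riemannian_volume ::
  "('m::topological_space, 'n::finite) chart set \<Rightarrow> (('m \<Rightarrow> real) \<Rightarrow> 'm \<Rightarrow> real) \<Rightarrow> 'm measure \<Rightarrow> bool" where
  "riemannian_volume A L v \<longleftrightarrow> sets v = sets borel \<and>
     (\<forall>(U, c)\<in>A. \<forall>a b. local_coefficients A L (U, c) a b \<longrightarrow>
        (\<forall>B\<in>sets borel. B \<subseteq> U \<longrightarrow>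
           emeasure v B = (\<integral>\<^sup>+y\<in>c ` B. ennreal (sqrt (det (matrix_inv (a y)))) \<partial>lborel)))"

definition symmetric_wrt ::
  "('m::topological_space, 'n::finite) chart set \<Rightarrow> (('m \<Rightarrow> real) \<Rightarrow> 'm \<Rightarrow> real) \<Rightarrow> ('m \<Rightarrow> real)
    \<Rightarrow> 'm measure \<Rightarrow> bool" where
  "symmetric_wrt A L \<phi> v \<longleftrightarrow>
     (\<forall>f g. smooth_fun A f \<and> compactly_supported f \<and> smooth_fun A g \<and> compactly_supported g \<longrightarrow>
        (\<integral>x. L f x * g x * (\<phi> x)\<^sup>2 \<partial>v) = (\<integral>x. f x * L g x * (\<phi> x)\<^sup>2 \<partial>v))"

definition L_harmonic ::
  "('m::topological_space, 'n::finite) chart set \<Rightarrow> (('m \<Rightarrow> real) \<Rightarrow> 'm \<Rightarrow> real) \<Rightarrow> ('m \<Rightarrow> real) \<Rightarrow> bool" where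
  "L_harmonic A L h \<longleftrightarrow> smooth_fun A h \<and> (\<forall>x. L h x = 0)"


section \<open>Group actions\<close>

definition properly_discontinuous ::
  "('g, 'x) monoid_scheme \<Rightarrow> ('g \<Rightarrow> 'm::topological_space \<Rightarrow> 'm) \<Rightarrow> bool" where
  "properly_discontinuous G act \<longleftrightarrow>
     (\<forall>K. compact K \<longrightarrow> finite {g \<in> carrier G. act g ` K \<inter> K \<noteq> {}})"


section \<open>Diffusion processes with infinite life time\<close>

text \<open>Paths are functions on the reals of which only the restriction to \<open>[0, \<infinity>)\<close> matters:
  \<open>path_algebra T\<close> is generated by the coordinates \<open>\<omega> \<mapsto> \<omega> t\<close> with \<open>t \<in> T\<close>.\<close>

definition paths :: "(real \<Rightarrow> 'm::topological_space) set" where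
  "paths = {\<omega>. continuous_on {0..} \<omega>}"

definition path_algebra :: "real set \<Rightarrow> (real \<Rightarrow> 'm::topological_space) measure" where
  "path_algebra T = vimage_algebra paths (\<lambda>\<omega>. restrict \<omega> T) (\<Pi>\<^sub>M t\<in>T. borel)"

definition martingale :: "'w measure \<Rightarrow> (real \<Rightarrow> 'w measure) \<Rightarrow> (real \<Rightarrow> 'w \<Rightarrow> real) \<Rightarrow> bool" where
  "martingale P F X \<longleftrightarrow>
     (\<forall>t\<ge>0. X t \<in> borel_measurable (F t) \<and> integrable P (X t)) \<and>
     (\<forall>s\<ge>0. \<forall>t\<ge>s. AE \<omega> in P. real_cond_exp P (F s) (X t) \<omega> = X s \<omega>)"

text \<open>A family of laws \<open>P x\<close> of continuous processes started at \<open>x\<close> and living for all time, which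
  is Markov, and has generator \<open>L\<close> in the sense of the martingale problem. Since the martingale
  problem for \<open>L\<close> is well-posed up to explosion, there is at most one such family.\<close>

definition L_diffusion ::
  "('m::topological_space, 'n::finite) chart set \<Rightarrow> (('m \<Rightarrow> real) \<Rightarrow> 'm \<Rightarrow> real)
    \<Rightarrow> ('m \<Rightarrow> (real \<Rightarrow> 'm) measure) \<Rightarrow> bool" where
  "L_diffusion A L P \<longleftrightarrow>
     P \<in> borel \<rightarrow>\<^sub>M prob_algebra (path_algebra {0..}) \<and>
     (\<forall>x. AE \<omega> in P x. \<omega> 0 = x) \<and>
     (\<forall>x. \<forall>s\<ge>0. \<forall>B\<in>sets (path_algebra {0..}). AE \<omega> in P x.
        real_cond_exp (P x) (path_algebra {0..s}) (indicator {\<omega> \<in> paths. (\<lambda>t. \<omega> (s + t)) \<in> B}) \<omega>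
          = measure (P (\<omega> s)) B) \<and>
     (\<forall>x f. smooth_fun A f \<and> compactly_supported f \<longrightarrow>
        martingale (P x) (\<lambda>t. path_algebra {0..t})
          (\<lambda>t \<omega>. f (\<omega> t) - f (\<omega> 0) - integral {0..t} (\<lambda>s. L f (\<omega> s))))"

definition L_recurrent_mod ::
  "('m::topological_space, 'n::finite) chart set \<Rightarrow> (('m \<Rightarrow> real) \<Rightarrow> 'm \<Rightarrow> real)
    \<Rightarrow> ('g, 'x) monoid_scheme \<Rightarrow> ('g \<Rightarrow> 'm \<Rightarrow> 'm) \<Rightarrow> bool" where
  "L_recurrent_mod A L G act \<longleftrightarrow> (\<exists>P. L_diffusion A L P \<and>
     (\<forall>x U. orbit G act x \<subseteq> interior U \<and> (\<forall>g\<in>carrier G. act g ` U = U) \<longrightarrow>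
        (\<forall>y. AE \<omega> in P y. \<exists>t\<ge>0. \<omega> t \<in> U)))"


section \<open>The FC-hypercenter\<close>

definition FC_center :: "('g, 'x) monoid_scheme \<Rightarrow> 'g set" where
  "FC_center G = {x \<in> carrier G. finite {h \<otimes>\<^bsub>G\<^esub> x \<otimes>\<^bsub>G\<^esub> inv\<^bsub>G\<^esub> h | h. h \<in> carrier G}}"

text \<open>The preimage in \<open>G\<close> of the FC-center of \<open>G Mod N\<close>.\<close>

definition FC_step :: "('g, 'x) monoid_scheme \<Rightarrow> 'g set \<Rightarrow> 'g set" where
  "FC_step G N = {x \<in> carrier G. N #>\<^bsub>G\<^esub> x \<in> FC_center (G Mod N)}"

text \<open>Ordinals are represented by the elements of a well-order \<open>r\<close>; the element \<open>\<alpha>\<close> is the successor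
  of \<open>\<beta>\<close> iff \<open>underS r \<alpha> = under r \<beta>\<close>, that is \<open>{\<gamma>. \<gamma> < \<alpha>} = {\<gamma>. \<gamma> \<le> \<beta>}\<close>.\<close>

definition upper_FC_series :: "('g, 'x) monoid_scheme \<Rightarrow> 'i rel \<Rightarrow> ('i \<Rightarrow> 'g set) \<Rightarrow> bool" where
  "upper_FC_series G r S \<longleftrightarrow> Well_order r \<and>
     (\<forall>\<alpha>\<in>Field r.
        (underS r \<alpha> = {} \<longrightarrow> S \<alpha> = {\<one>\<^bsub>G\<^esub>}) \<and>
        (\<forall>\<beta>\<in>Field r. underS r \<alpha> = under r \<beta> \<longrightarrow> S \<alpha> = FC_step G (S \<beta>)) \<and>
        (underS r \<alpha> \<noteq> {} \<and> (\<forall>\<beta>\<in>Field r. underS r \<alpha> \<noteq> under r \<beta>) \<longrightarrow>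
           S \<alpha> = (\<Union>\<beta>\<in>underS r \<alpha>. S \<beta>)))"

text \<open>The terms up to stabilization are pairwise distinct subsets of \<open>G\<close>. Hence well-orders on the
  type \<open>'g set\<close> are long enough to reach the term at which the series stabilizes, which is the
  union of all terms.\<close>

definition FC_hypercenter :: "('g, 'x) monoid_scheme \<Rightarrow> 'g set" where
  "FC_hypercenter G =
     \<Union> {S \<alpha> | (r :: 'g set rel) S \<alpha>. upper_FC_series G r S \<and> \<alpha> \<in> Field r}"

definition FC_hypercentral :: "('g, 'x) monoid_scheme \<Rightarrow> bool" where
  "FC_hypercentral G \<longleftrightarrow> FC_hypercenter G = carrier G"

end

theory Submission
  imports Defs
begin

text \<open>The argument is of Choquet--Deny type. Let \<open>N\<close> be a normal subgroup under which all bounded \<open>L\<close>-harmonic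
  functions are invariant, let \<open>z\<close> have finitely many conjugates modulo \<open>N\<close>, and let \<open>K\<close> be the supremum
  of \<open>h (c x) - h x\<close> over all points \<open>x\<close>, all conjugates \<open>c\<close> of \<open>z\<close> and all harmonic \<open>h\<close> with
  \<open>\<bar>h\<bar> \<le> B\<close>. This family of harmonic functions is \<open>\<Gamma>\<close>-invariant. Stopping the diffusion when it hits the
  \<open>\<Gamma>\<close>-orbit of a small neighborhood of a fixed point \<open>x\<close> therefore shows that \<open>K\<close> is approached near \<open>x\<close>,
  and at \<open>x\<close> itself because bounded harmonic functions are equicontinuous; by finiteness modulo \<open>N\<close> one
  conjugate \<open>c\<close> suffices. Then \<open>K - (h (c y) - h y)\<close> is a nonnegative harmonic function that is small at
  \<open>x\<close>, hence small at \<open>x\<close>, \<open>c x\<close>, \<open>c\<^sup>2 x\<close>, \<dots>. Summing along this orbit contradicts the boundedness of \<open>h\<close>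
  unless \<open>K \<le> 0\<close>.\<close>

section \<open>Calculus of smooth functions\<close>

text \<open>Finiteness modulo \<open>N\<close> matters because the conjugate \<open>c\<close> has to
  be fixed before the approximation. The orbit of \<open>x\<close> under powers of \<open>c\<close>,
  and the thresholds that carry smallness to its points, depend on \<open>c\<close>; a
  \<open>c\<close> varying with the error would leave no uniform threshold. The supremum need not be
  attained and no limit function is extracted: finitely many thresholds chosen in advance take its
  place. Consequently every estimate must be uniform over all harmonic functions with a common
  bound. Equicontinuity and a qualitative Harnack principle are enough for this, and both come from
  maximum principles tested along lines. On the probabilistic side, the martingale problem speaks of
  compactly supported functions and deterministic times, whereas a harmonic function need not have
  compact support and a hitting time is random; this forces the cutoffs and the stopping on finite
  time grids.\<close>

lemma C_k_on_local:
  assumes "\<And>x. x \<in> S \<Longrightarrow> \<exists>T. open T \<and> x \<in> T \<and> C_k_on k T f"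
  shows "C_k_on k S f"
  using assms
proof (induction k arbitrary: f)
  case 0
  have "isCont f x" if "x \<in> S" for x
    using 0[OF that] by (auto simp: continuous_on_eq_continuous_at)
  then show ?case by (simp add: continuous_at_imp_continuous_on)
next
  case (Suc k)
  have "C_k_on k S (\<lambda>x. frechet_derivative f (at x) v)" for v
    using Suc.prems by (intro Suc.IH) fastforce
  then show ?case using Suc.prems by fastforce
qed

lemma C_k_on_SucE:
  assumes "C_k_on (Suc k) S f" "x \<in> S"
  shows "(f has_derivative frechet_derivative f (at x)) (at x)"
  using assms frechet_derivative_works by auto

lemma frechet_derivative_cong:
  assumes "open S" "x \<in> S" "\<And>y. y \<in> S \<Longrightarrow> f y = g y"
  shows "frechet_derivative f (at x) = frechet_derivative g (at x)"
proof -
  have "(f has_derivative D) (at x) \<longleftrightarrow> (g has_derivative D) (at x)" for D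
    using has_derivative_transform_within_open[OF _ assms(1,2)] assms(3) by metis
  then show ?thesis by (simp add: frechet_derivative_def)
qed

lemma C_k_on_cong:
  assumes "open S" "\<And>x. x \<in> S \<Longrightarrow> f x = g x" "C_k_on k S f"
  shows "C_k_on k S g"
  using assms(2,3)
proof (induction k arbitrary: f g)
  case 0
  then show ?case using continuous_on_cong by force
next
  case (Suc k)
  have *: "frechet_derivative f (at x) = frechet_derivative g (at x)" if "x \<in> S" for x
    using assms(1) that Suc.prems(1) by (rule frechet_derivative_cong)
  have "g differentiable (at x)" if "x \<in> S" for x
    using has_derivative_transform_within_open[OF C_k_on_SucE[OF Suc.prems(2) that] assms(1) that
        Suc.prems(1)] unfolding differentiable_def by blast
  moreover have "C_k_on k S (\<lambda>x. frechet_derivative g (at x) v)" for v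
    by (rule Suc.IH[of "\<lambda>x. frechet_derivative f (at x) v"]) (use Suc.prems(2) * in simp_all)
  ultimately show ?case by simp
qed

lemma C_k_on_SucD: "C_k_on (Suc k) S f \<Longrightarrow> C_k_on k S f"
proof (induction k arbitrary: f)
  case 0
  then show ?case
    by (auto intro!: continuous_at_imp_continuous_on differentiable_imp_continuous_within)
next
  case (Suc k)
  have "C_k_on k S (\<lambda>x. frechet_derivative f (at x) v)" for v
    using Suc.prems by (intro Suc.IH) simp
  with Suc.prems show ?case by simp
qed

text \<open>Allows derivatives to be given explicitly: by uniqueness \<open>D x\<close> agrees with
  \<open>frechet_derivative f (at x)\<close> on \<open>S\<close>, and on an open set
  \<open>C_k_on\<close> depends only on the values there.\<close>

lemma C_k_on_SucI:
  assumes "open S" "\<And>x. x \<in> S \<Longrightarrow> (f has_derivative D x) (at x)"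
    "\<And>v. C_k_on k S (\<lambda>x. D x v)"
  shows "C_k_on (Suc k) S f"
proof -
  have "D x = frechet_derivative f (at x)" if "x \<in> S" for x
    by (rule frechet_derivative_at[OF assms(2)[OF that]])
  then have "C_k_on k S (\<lambda>x. frechet_derivative f (at x) v)" for v
    by (intro C_k_on_cong[OF assms(1) _ assms(3)]) simp
  then show ?thesis using assms(2) by (auto simp: differentiable_def)
qed

lemma C_k_on_const: "open S \<Longrightarrow> C_k_on k S (\<lambda>x. c)"
proof (induction k arbitrary: c)
  case (Suc k)
  then show ?case by (intro C_k_on_SucI[where D="\<lambda>x v. 0"]) auto
qed simp

lemma C_k_on_bounded_linear:
  assumes "bounded_linear T" "open S" shows "C_k_on k S T"
proof (cases k)
  case 0
  then show ?thesis using assms by (simp add: linear_continuous_on)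
next
  case (Suc l)
  show ?thesis unfolding Suc
    by (rule C_k_on_SucI[where D="\<lambda>x. T"])
      (use assms in \<open>auto intro: C_k_on_const bounded_linear_imp_has_derivative\<close>)
qed

lemma C_k_on_linear_compose:
  assumes "bounded_linear T" "open S"
  shows "C_k_on k S f \<Longrightarrow> C_k_on k S (\<lambda>x. T (f x))"
proof (induction k arbitrary: f)
  case 0
  then show ?case using assms by (auto intro: bounded_linear.continuous_on)
next
  case (Suc k)
  show ?case
    by (rule C_k_on_SucI[where D="\<lambda>x v. T (frechet_derivative f (at x) v)"])
      (use assms Suc in \<open>auto intro!: bounded_linear.has_derivative[OF assms(1)] C_k_on_SucE[OF Suc.prems]\<close>)
qed

lemma C_k_on_add:
  assumes "open S"
  shows "C_k_on k S f \<Longrightarrow> C_k_on k S g \<Longrightarrow> C_k_on k S (\<lambda>x. f x + g x)"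
proof (induction k arbitrary: f g)
  case 0
  then show ?case by (auto intro: continuous_on_add)
next
  case (Suc k)
  show ?case
    by (rule C_k_on_SucI[where D="\<lambda>x v. frechet_derivative f (at x) v + frechet_derivative g (at x) v"])
      (use assms Suc in \<open>auto intro!: has_derivative_add C_k_on_SucE[OF Suc.prems(1)] C_k_on_SucE[OF Suc.prems(2)]\<close>)
qed

lemma C_k_on_bilinear:
  assumes "bounded_bilinear B" "open S"
  shows "C_k_on k S f \<Longrightarrow> C_k_on k S g \<Longrightarrow> C_k_on k S (\<lambda>x. B (f x) (g x))"
proof (induction k arbitrary: f g)
  case 0
  then show ?case using assms by (auto intro: bounded_bilinear.continuous_on)
next
  case (Suc k)
  note S = C_k_on_SucD[OF Suc.prems(1)] C_k_on_SucD[OF Suc.prems(2)]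
  show ?case
    by (rule C_k_on_SucI[where D="\<lambda>x v. B (f x) (frechet_derivative g (at x) v)
         + B (frechet_derivative f (at x) v) (g x)"])
      (use assms Suc S in \<open>auto intro!: C_k_on_add bounded_bilinear.FDERIV[OF assms(1)]
        C_k_on_SucE[OF Suc.prems(1)] C_k_on_SucE[OF Suc.prems(2)]\<close>)
qed

lemma C_k_on_sum:
  "open S \<Longrightarrow> (\<And>i. i \<in> I \<Longrightarrow> C_k_on k S (f i)) \<Longrightarrow> C_k_on k S (\<lambda>x. \<Sum>i\<in>I. f i x)"
  by (induction I rule: infinite_finite_induct) (auto intro: C_k_on_add C_k_on_const)

lemma C_k_on_prod:
  fixes f :: "_ \<Rightarrow> _ \<Rightarrow> real"
  shows "open S \<Longrightarrow> (\<And>i. i \<in> I \<Longrightarrow> C_k_on k S (f i)) \<Longrightarrow> C_k_on k S (\<lambda>x. \<Prod>i\<in>I. f i x)"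
  by (induction I rule: infinite_finite_induct)
    (auto intro: C_k_on_bilinear[OF bounded_bilinear_mult] C_k_on_const)

text \<open>In the chain rule the direction fed to the derivative of \<open>F\<close> varies with
  the point, whereas \<open>C_k_on\<close> controls derivatives in fixed directions. Expanding that
  direction in \<open>Basis\<close> gives fixed directions with scalar coefficients of class
  \<open>C_k_on k\<close>, hence the sort \<open>euclidean_space\<close>.\<close>

lemma C_k_on_compose:
  fixes F :: "'b::euclidean_space \<Rightarrow> 'c::real_normed_vector" and f :: "'a::real_normed_vector \<Rightarrow> 'b"
  assumes "open S"
  shows "C_k_on k T F \<Longrightarrow> C_k_on k S f \<Longrightarrow> f ` S \<subseteq> T \<Longrightarrow> C_k_on k S (\<lambda>x. F (f x))"
proof (induction k arbitrary: F)
  case 0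
  then show ?case using continuous_on_compose2 by auto
next
  case (Suc k)
  note G = C_k_on_SucD[OF Suc.prems(2)]
  let ?D = "\<lambda>x v. \<Sum>b\<in>Basis. (frechet_derivative f (at x) v \<bullet> b) *\<^sub>R frechet_derivative F (at (f x)) b"
  show ?case
  proof (rule C_k_on_SucI[where D="?D"])
    fix x assume x: "x \<in> S"
    have dF: "(F has_derivative frechet_derivative F (at (f x))) (at (f x))"
      using Suc.prems x by (intro C_k_on_SucE[OF Suc.prems(1)]) auto
    have exp: "frechet_derivative F (at (f x)) w = (\<Sum>b\<in>Basis. (w \<bullet> b) *\<^sub>R frechet_derivative F (at (f x)) b)" for w
    proof -
      have "frechet_derivative F (at (f x)) (\<Sum>b\<in>Basis. (w \<bullet> b) *\<^sub>R b)
        = (\<Sum>b\<in>Basis. (w \<bullet> b) *\<^sub>R frechet_derivative F (at (f x)) b)"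
        using has_derivative_linear[OF dF] by (simp add: linear_sum linear_scale)
      then show ?thesis by (simp add: euclidean_representation)
    qed
    have "((\<lambda>x. F (f x)) has_derivative (\<lambda>v. frechet_derivative F (at (f x)) (frechet_derivative f (at x) v))) (at x)"
      using has_derivative_compose[OF C_k_on_SucE[OF Suc.prems(2) x] dF] .
    then show "((\<lambda>x. F (f x)) has_derivative ?D x) (at x)"
      by (rule has_derivative_eq_rhs) (rule ext, rule exp)
  next
    fix v
    have "C_k_on k S (\<lambda>x. frechet_derivative F (at (f x)) b)" for b
      using Suc.prems G by (intro Suc.IH) auto
    moreover have "C_k_on k S (\<lambda>x. frechet_derivative f (at x) v)" using Suc.prems by simp
    ultimately show "C_k_on k S (\<lambda>x. ?D x v)"
      using assms by (intro C_k_on_sum C_k_on_bilinear[OF bounded_bilinear_scaleR]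
        C_k_on_linear_compose[OF bounded_linear_inner_left]) auto
  qed (rule assms)
qed

lemma smooth_on_local:
  "(\<And>x. x \<in> S \<Longrightarrow> \<exists>T. open T \<and> x \<in> T \<and> smooth_on T f) \<Longrightarrow> smooth_on S f"
  unfolding smooth_on_def by (rule allI, rule C_k_on_local) blast

lemma smooth_on_cong: "open S \<Longrightarrow> (\<And>x. x \<in> S \<Longrightarrow> f x = g x) \<Longrightarrow> smooth_on S f \<Longrightarrow> smooth_on S g"
  unfolding smooth_on_def by (rule allI, rule C_k_on_cong[of S f g]) blast+

lemma smooth_on_const: "open S \<Longrightarrow> smooth_on S (\<lambda>x. c)"
  by (simp add: smooth_on_def C_k_on_const)

lemma smooth_on_compose:
  fixes F :: "'b::euclidean_space \<Rightarrow> 'c::real_normed_vector"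
  shows "open S \<Longrightarrow> smooth_on T F \<Longrightarrow> smooth_on S f \<Longrightarrow> f ` S \<subseteq> T \<Longrightarrow> smooth_on S (\<lambda>x. F (f x))"
  unfolding smooth_on_def by (rule allI, rule C_k_on_compose[where T=T]) blast+

lemma smooth_on_bilinear:
  "bounded_bilinear B \<Longrightarrow> open S \<Longrightarrow> smooth_on S f \<Longrightarrow> smooth_on S g \<Longrightarrow> smooth_on S (\<lambda>x. B (f x) (g x))"
  by (simp add: smooth_on_def C_k_on_bilinear)

lemma smooth_on_linear_compose:
  "bounded_linear T \<Longrightarrow> open S \<Longrightarrow> smooth_on S f \<Longrightarrow> smooth_on S (\<lambda>x. T (f x))"
  by (simp add: smooth_on_def C_k_on_linear_compose)

lemma smooth_on_add: "open S \<Longrightarrow> smooth_on S f \<Longrightarrow> smooth_on S g \<Longrightarrow> smooth_on S (\<lambda>x. f x + g x)"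
  by (simp add: smooth_on_def C_k_on_add)

lemma smooth_on_diff:
  assumes "open S" "smooth_on S f" "smooth_on S g" shows "smooth_on S (\<lambda>x. f x - g x)"
  using smooth_on_add[OF assms(1,2) smooth_on_linear_compose[OF bounded_linear_minus[OF bounded_linear_ident] assms(1,3)]]
  by simp

lemma smooth_on_prod:
  fixes f :: "_ \<Rightarrow> _ \<Rightarrow> real"
  shows "open S \<Longrightarrow> (\<And>i. i \<in> I \<Longrightarrow> smooth_on S (f i)) \<Longrightarrow> smooth_on S (\<lambda>x. \<Prod>i\<in>I. f i x)"
  by (simp add: smooth_on_def C_k_on_prod)

lemma smooth_on_frechet: "smooth_on S f \<Longrightarrow> smooth_on S (\<lambda>x. frechet_derivative f (at x) v)"
  unfolding smooth_on_def by (metis C_k_on.simps(2))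

lemma smooth_on_has_derivative:
  "smooth_on S f \<Longrightarrow> x \<in> S \<Longrightarrow> (f has_derivative frechet_derivative f (at x)) (at x)"
  unfolding smooth_on_def by (meson C_k_on_SucE)

lemma smooth_on_continuous: "smooth_on S f \<Longrightarrow> continuous_on S f"
  unfolding smooth_on_def by (metis C_k_on.simps(1))

lemma smooth_on_partial: "smooth_on S f \<Longrightarrow> smooth_on S (partial i f)"
  unfolding partial_def by (rule smooth_on_frechet)

text \<open>The class of functions \<open>p(1/x) e\<^sup>-\<^sup>1\<^sup>/\<^sup>x\<close>, extended by 0 to \<open>x \<le> 0\<close>, is closed under differentiation.\<close>

definition flat :: "real poly \<Rightarrow> real \<Rightarrow> real" where
  "flat p x = (if x > 0 then poly p (1 / x) * exp (- (1 / x)) else 0)"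

lemma flat_tendsto_0: "((\<lambda>x. poly p (1 / x) * exp (- (1 / x))) \<longlongrightarrow> 0) (at_right (0::real))"
proof -
  have "((\<lambda>x. \<Sum>i\<le>degree p. coeff p i * (x ^ i / exp x)) \<longlongrightarrow> (\<Sum>i\<le>degree p. coeff p i * 0)) at_top"
    by (intro tendsto_intros tendsto_power_div_exp_0)
  then have "((\<lambda>x. poly p x * exp (- x)) \<longlongrightarrow> 0) at_top"
    by (simp add: poly_altdef sum_distrib_right exp_minus divide_inverse mult.assoc)
  then have "((\<lambda>x. poly p (inverse x) * exp (- inverse x)) \<longlongrightarrow> 0) (at_right 0)"
    by (rule filterlim_compose[OF _ filterlim_inverse_at_top_right])
  then show ?thesis by (simp add: inverse_eq_divide)
qed

text \<open>The polynomial \<open>[:0, 0, 1:]\<close> is the square of the variable: the inner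
  derivative of \<open>1 / x\<close> contributes \<open>1 / x^2\<close>, the exponential gives
  \<open>p\<close>, and the polynomial factor gives \<open>- pderiv p\<close>.\<close>

lemma flat_has_derivative:
  "(flat p has_real_derivative flat ([:0, 0, 1:] * (p - pderiv p)) x) (at x)"
proof -
  consider "x > 0" | "x < 0" | "x = 0" by linarith
  then show ?thesis
  proof cases
    case 1
    have "((\<lambda>x. poly p (1 / x) * exp (- (1 / x))) has_real_derivative flat ([:0, 0, 1:] * (p - pderiv p)) x) (at x)"
      using 1 by (auto intro!: derivative_eq_intros poly_DERIV[THEN DERIV_chain2] simp: flat_def field_simps power2_eq_square)
    then show ?thesis
      by (rule has_field_derivative_transform_within_open[where S="{0<..}"]) (use 1 in \<open>auto simp: flat_def\<close>)
  next
    case 2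
    have "((\<lambda>x. 0) has_real_derivative flat ([:0, 0, 1:] * (p - pderiv p)) x) (at x)"
      using 2 by (simp add: flat_def)
    then show ?thesis
      by (rule has_field_derivative_transform_within_open[where S="{..<0}"]) (use 2 in \<open>auto simp: flat_def\<close>)
  next
    case 3
    \<comment> \<open>\<open>pCons 0 p\<close> is the variable times \<open>p\<close>, so the factor
      \<open>1 / h\<close> of the difference quotient is absorbed by the polynomial.\<close>
    have "((\<lambda>h. flat p h / h) \<longlongrightarrow> 0) (at_right 0)"
      using flat_tendsto_0[of "pCons 0 p"]
      by (rule Lim_transform_eventually) (auto simp: flat_def eventually_at_filter)
    moreover have "((\<lambda>h. flat p h / h) \<longlongrightarrow> 0) (at_left 0)"
      by (rule Lim_transform_eventually[OF tendsto_const]) (auto simp: flat_def eventually_at_filter)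
    ultimately have "((\<lambda>h. flat p h / h) \<longlongrightarrow> 0) (at 0)"
      by (simp add: filterlim_split_at)
    then show ?thesis using 3 by (simp add: has_field_derivative_iff flat_def)
  qed
qed

lemma smooth_on_flat: "smooth_on UNIV (flat p)"
proof -
  have "C_k_on k UNIV (flat p)" for k
  proof (induction k arbitrary: p)
    case 0
    show ?case by (auto intro!: continuous_at_imp_continuous_on DERIV_isCont flat_has_derivative)
  next
    case (Suc k)
    show ?case
      by (rule C_k_on_SucI[where D="\<lambda>x v. flat ([:0, 0, 1:] * (p - pderiv p)) x * v"])
        (use flat_has_derivative[of p] in \<open>auto simp: has_field_derivative_def
          intro!: C_k_on_linear_compose[OF bounded_linear_mult_left] Suc\<close>)
  qed
  then show ?thesis by (simp add: smooth_on_def)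
qed

section \<open>Second-order operators and the maximum principle\<close>

text \<open>A positive \<open>F2\<close> would make \<open>F1\<close> positive just to the right of
  0, and the mean value theorem would lift \<open>F\<close> above \<open>F 0\<close>. All maximum
  principles below reduce to this test along lines.\<close>

lemma second_derivative_test:
  fixes F :: "real \<Rightarrow> real"
  assumes "\<delta> > 0"
    and F: "\<And>s. \<bar>s\<bar> < \<delta> \<Longrightarrow> (F has_real_derivative F1 s) (at s)"
    and F1: "(F1 has_real_derivative F2) (at 0)"
    and max: "\<And>s. \<bar>s\<bar> < \<delta> \<Longrightarrow> F s \<le> F 0"
  shows "F1 0 = 0" "F2 \<le> 0"
proof -
  show 0: "F1 0 = 0"
    using DERIV_local_max[OF F[of 0] \<open>\<delta> > 0\<close>] max \<open>\<delta> > 0\<close> by simp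
  show "F2 \<le> 0"
  proof (rule ccontr)
    assume "\<not> F2 \<le> 0"
    then obtain d where d: "d > 0" "\<And>h. 0 < h \<Longrightarrow> h < d \<Longrightarrow> F1 0 < F1 (0 + h)"
      using DERIV_pos_inc_right[OF F1] by auto
    define e where "e = min d \<delta> / 2"
    have e: "0 < e" "e < d" "e < \<delta>" using d(1) \<open>\<delta> > 0\<close> by (auto simp: e_def)
    obtain z where z: "0 < z" "z < e" "F e - F 0 = (e - 0) * F1 z"
      using MVT2[of 0 e F F1] e F by (metis abs_of_nonneg le_less_trans)
    then have "F1 z > 0" using d(2)[of z] e 0 by simp
    then have "F e > F 0" using z e by (metis diff_gt_0_iff_gt diff_zero mult_pos_pos)
    then show False using max[of e] e by simp
  qed
qed

text \<open>Completion of squares, one index at a time. \<open>I\<close> contains the support of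
  \<open>a\<close> and also indexes the vectors, so their number never exceeds the dimension. A zero
  diagonal entry forces a zero row; otherwise a rank-one term is split off and the Schur complement
  is supported on the smaller set.\<close>

lemma psd_decomposition_aux:
  fixes a :: "'n::finite \<Rightarrow> 'n \<Rightarrow> real"
  assumes "finite I" "\<And>i j. a i j = a j i" "\<And>w. 0 \<le> (\<Sum>i\<in>UNIV. \<Sum>j\<in>UNIV. w i * w j * a i j)"
    "\<And>i j. i \<notin> I \<Longrightarrow> a i j = 0"
  shows "\<exists>V. \<forall>i j. a i j = (\<Sum>k\<in>I. V k i * V k j)"
  using assms
proof (induction I arbitrary: a rule: finite_induct)
  case empty
  then show ?case by auto
next
  case (insert m I)
  define Q where "Q a w = (\<Sum>i\<in>UNIV. \<Sum>j\<in>UNIV. w i * w j * a i j)" for a :: "'n \<Rightarrow> 'n \<Rightarrow> real" and w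
  define d :: "'n \<Rightarrow> real" where "d i = of_bool (i = m)" for i
  have shift: "Q a (\<lambda>i. w i + t * d i) = Q a w + 2 * t * (\<Sum>j\<in>UNIV. a m j * w j) + t\<^sup>2 * a m m" for w t
  proof -
    have "Q a (\<lambda>i. w i + t * d i) = Q a w + t * (\<Sum>i\<in>UNIV. \<Sum>j\<in>UNIV. d i * (w j * a i j))
        + t * (\<Sum>i\<in>UNIV. \<Sum>j\<in>UNIV. d j * (w i * a i j)) + t\<^sup>2 * (\<Sum>i\<in>UNIV. \<Sum>j\<in>UNIV. d i * (d j * a i j))"
      unfolding Q_def sum_distrib_left sum.distrib[symmetric]
      by (intro sum.cong refl) (simp add: algebra_simps power2_eq_square)
    also have "(\<Sum>i\<in>UNIV. \<Sum>j\<in>UNIV. d i * (w j * a i j)) = (\<Sum>j\<in>UNIV. a m j * w j)"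
      by (subst sum.swap) (simp add: d_def of_bool_def if_distrib[where f="\<lambda>x. x * _"] mult.commute[of "w _"] cong: if_cong)
    also have "(\<Sum>i\<in>UNIV. \<Sum>j\<in>UNIV. d j * (w i * a i j)) = (\<Sum>j\<in>UNIV. a m j * w j)"
      using insert.prems(1)[of m] by (simp add: d_def of_bool_def if_distrib[where f="\<lambda>x. x * _"] mult.commute[of "w _"] cong: if_cong)
    also have "(\<Sum>i\<in>UNIV. \<Sum>j\<in>UNIV. d i * (d j * a i j)) = a m m"
      by (subst sum.swap) (simp add: d_def of_bool_def if_distrib[where f="\<lambda>x. x * _"] cong: if_cong)
    finally show ?thesis by simp
  qed
  have Q0: "Q a w \<ge> 0" for w using insert.prems(2) by (simp add: Q_def)
  have amm: "a m m \<ge> 0" using shift[of "\<lambda>_. 0" 1] Q0[of d] by (simp add: Q_def)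
  show ?case
  proof (cases "a m m = 0")
    case True
    have "a m j = 0" for j
    proof (rule ccontr)
      assume nz: "a m j \<noteq> 0"
      define w :: "'n \<Rightarrow> real" where "w i = of_bool (i = j)" for i
      have *: "(\<Sum>i\<in>UNIV. a m i * w i) = a m j"
        by (simp add: w_def of_bool_def if_distrib cong: if_cong)
      \<comment> \<open>With \<open>a m m = 0\<close> the form is affine in \<open>t\<close>; this
        value makes it equal to -1.\<close>
      define t where "t = - (Q a w + 1) / (2 * a m j)"
      have "Q a (\<lambda>i. w i + t * d i) = -1"
        unfolding shift * True t_def using nz by (simp add: field_simps)
      then show False using Q0[of "\<lambda>i. w i + t * d i"] by simp
    qed
    note am = this
    have "\<exists>V. \<forall>i j. a i j = (\<Sum>k\<in>I. V k i * V k j)"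
    proof (intro insert.IH)
      show "a i j = 0" if "i \<notin> I" for i j
        using that insert.prems(3)[of i j] am by (cases "i = m") auto
    qed (use insert.prems in auto)
    then obtain V where V: "\<And>i j. a i j = (\<Sum>k\<in>I. V k i * V k j)" by blast
    show ?thesis
      by (rule exI[of _ "V(m := (\<lambda>_. 0))"])
        (use insert.hyps V in \<open>auto intro!: sum.cong\<close>)
  next
    case False
    \<comment> \<open>\<open>b\<close> is the Schur complement of the pivot \<open>a m m\<close>.
      Its form at \<open>w\<close> is the minimum of the form of \<open>a\<close> over all shifts of
      \<open>w\<close> in coordinate \<open>m\<close>, attained at the shift
      \<open>- l / a m m\<close>.\<close>
    define c where "c j = a m j / sqrt (a m m)" for j
    define b where "b i j = a i j - c i * c j" for i j
    have cc: "c i * c j = a m i * a m j / a m m" for i j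
      using amm by (simp add: c_def)
    have "\<exists>V. \<forall>i j. b i j = (\<Sum>k\<in>I. V k i * V k j)"
    proof (rule insert.IH)
      show "b i j = b j i" for i j using insert.prems(1) by (simp add: b_def)
      show "0 \<le> (\<Sum>i\<in>UNIV. \<Sum>j\<in>UNIV. w i * w j * b i j)" for w
      proof -
        define l where "l = (\<Sum>j\<in>UNIV. a m j * w j)"
        have "(\<Sum>i\<in>UNIV. \<Sum>j\<in>UNIV. w i * w j * b i j) = Q a w - l * l / a m m"
          unfolding Q_def b_def cc l_def sum_product sum_divide_distrib
            sum_subtractf[symmetric] by (intro sum.cong refl) (simp add: algebra_simps)
        also have "\<dots> = Q a (\<lambda>i. w i + (- l / a m m) * d i)"
          unfolding shift l_def[symmetric] using False by (simp add: field_simps power2_eq_square)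
        finally show ?thesis using Q0 by simp
      qed
      show "b i j = 0" if "i \<notin> I" for i j
      proof (cases "i = m")
        case True
        then show ?thesis using False by (simp add: b_def cc)
      next
        case False
        then have "a i j = 0" for j using insert.prems(3) that by auto
        then show ?thesis using insert.prems(1)[of m i] by (simp add: b_def cc)
      qed
    qed
    then obtain V where V: "\<And>i j. b i j = (\<Sum>k\<in>I. V k i * V k j)" by blast
    have "a i j = (\<Sum>k\<in>insert m I. (V(m := c)) k i * (V(m := c)) k j)" for i j
    proof -
      have "(\<Sum>k\<in>I. (V(m := c)) k i * (V(m := c)) k j) = b i j"
        unfolding V using insert.hyps by (intro sum.cong) auto
      then show ?thesis using insert.hyps by (simp add: b_def)
    qed
    then show ?thesis by blast
  qed
qed

lemma psd_decomposition:
  fixes a :: "real^'n^'n"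
  assumes "transpose a = a" "\<And>w. 0 \<le> w \<bullet> (a *v w)"
  obtains V :: "'n \<Rightarrow> real^'n" where "\<And>i j. a $ i $ j = (\<Sum>k\<in>UNIV. V k $ i * V k $ j)"
proof -
  have "\<exists>V :: 'n \<Rightarrow> 'n \<Rightarrow> real. \<forall>i j. a $ i $ j = (\<Sum>k\<in>UNIV. V k i * V k j)"
  proof (rule psd_decomposition_aux[where I=UNIV and a="\<lambda>i j. a $ i $ j"])
    show "a $ i $ j = a $ j $ i" for i j using assms(1) by (metis transpose_def vec_lambda_beta)
    show "0 \<le> (\<Sum>i\<in>UNIV. \<Sum>j\<in>UNIV. w i * w j * a $ i $ j)" for w
      using assms(2)[of "\<chi> i. w i"]
      by (simp add: inner_vec_def matrix_vector_mult_def sum_distrib_left mult_ac)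
  qed auto
  then obtain V :: "'n \<Rightarrow> 'n \<Rightarrow> real" where "\<And>i j. a $ i $ j = (\<Sum>k\<in>UNIV. V k i * V k j)" by blast
  then show ?thesis by (intro that[of "\<lambda>k. \<chi> i. V k i"]) simp
qed

section \<open>Derivatives along lines and second-order operators in coordinates\<close>

definition dir1 :: "(real^'n \<Rightarrow> real) \<Rightarrow> real^'n \<Rightarrow> real^'n \<Rightarrow> real" where
  "dir1 f x p = (\<Sum>k\<in>UNIV. p $ k * partial k f x)"

definition dir2 :: "(real^'n \<Rightarrow> real) \<Rightarrow> real^'n \<Rightarrow> real^'n \<Rightarrow> real" where
  "dir2 f x p = (\<Sum>i\<in>UNIV. \<Sum>j\<in>UNIV. p $ i * p $ j * partial i (partial j f) x)"

definition diff_op :: "(real^'n \<Rightarrow> real^'n^'n) \<Rightarrow> (real^'n \<Rightarrow> real^'n) \<Rightarrow> (real^'n \<Rightarrow> real) \<Rightarrow> real^'n \<Rightarrow> real" where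
  "diff_op a b f x = (1/2) * (\<Sum>i\<in>UNIV. \<Sum>j\<in>UNIV. a x $ i $ j * partial i (partial j f) x)
     + (\<Sum>k\<in>UNIV. b x $ k * partial k f x)"

lemma frechet_derivative_partials:
  assumes "f differentiable (at x)"
  shows "frechet_derivative f (at x) p = dir1 f x p"
proof -
  have l: "linear (frechet_derivative f (at x))"
    using assms by (rule linear_frechet_derivative)
  have "frechet_derivative f (at x) (\<Sum>k\<in>UNIV. p $ k *\<^sub>R axis k 1) = dir1 f x p"
    unfolding dir1_def partial_def using l by (simp add: linear_sum linear_scale)
  moreover have "(\<Sum>k\<in>UNIV. p $ k *\<^sub>R axis k 1) = p"
    using basis_expansion[of p] by (simp add: scalar_mult_eq_scaleR)
  ultimately show ?thesis by simp
qed

lemma has_real_derivative_along_line: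
  assumes "smooth_on S f" "x + s *\<^sub>R p \<in> S"
  shows "((\<lambda>s. f (x + s *\<^sub>R p)) has_real_derivative dir1 f (x + s *\<^sub>R p) p) (at s)"
proof -
  let ?D = "frechet_derivative f (at (x + s *\<^sub>R p))"
  have D: "(f has_derivative ?D) (at (x + s *\<^sub>R p))" using assms by (rule smooth_on_has_derivative)
  have "((\<lambda>s. x + s *\<^sub>R p) has_derivative (\<lambda>h. h *\<^sub>R p)) (at s)"
    by (auto intro!: derivative_eq_intros)
  then have "((\<lambda>s. f (x + s *\<^sub>R p)) has_derivative (\<lambda>h. ?D (h *\<^sub>R p))) (at s)"
    using D by (rule has_derivative_compose)
  moreover have "?D (h *\<^sub>R p) = h * ?D p" for h
    using has_derivative_linear[OF D] by (simp add: linear_scale)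
  moreover have "?D p = dir1 f (x + s *\<^sub>R p) p"
    using D by (intro frechet_derivative_partials) (auto simp: differentiable_def)
  ultimately show ?thesis by (simp add: has_field_derivative_def mult.commute[of _ "dir1 _ _ _"])
qed

lemma has_real_derivative_dir1_along_line:
  assumes "smooth_on S f" "x \<in> S"
  shows "((\<lambda>s. dir1 f (x + s *\<^sub>R p) p) has_real_derivative dir2 f x p) (at 0)"
proof -
  have "((\<lambda>s. partial k f (x + s *\<^sub>R p)) has_real_derivative dir1 (partial k f) x p) (at 0)" for k
    using has_real_derivative_along_line[OF smooth_on_partial[OF assms(1)], of x 0 p] assms(2) by simp
  then have "((\<lambda>s. dir1 f (x + s *\<^sub>R p) p) has_real_derivative (\<Sum>k\<in>UNIV. p $ k * dir1 (partial k f) x p)) (at 0)"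
    unfolding dir1_def[of f] by (intro DERIV_sum DERIV_cmult)
  moreover have "(\<Sum>k\<in>UNIV. p $ k * dir1 (partial k f) x p) = dir2 f x p"
    unfolding dir2_def dir1_def sum_distrib_left by (subst sum.swap) (simp add: mult_ac)
  ultimately show ?thesis by simp
qed

text \<open>Turns the second-order part into second derivatives along the vectors
  \<open>V k\<close>, to which the one-variable test applies. Any factorization of the matrix is
  allowed; \<open>harmonic_equicontinuous\<close> exploits this by using different ones at its two
  points.\<close>

lemma sum_rank_one:
  assumes "\<And>i j. A $ i $ j = (\<Sum>k\<in>UNIV. V k $ i * V k $ j)"
  shows "(\<Sum>i\<in>UNIV. \<Sum>j\<in>UNIV. A $ i $ j * partial i (partial j f) x) = (\<Sum>k\<in>UNIV. dir2 f x (V k))"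
proof -
  have "(\<Sum>i\<in>UNIV. \<Sum>j\<in>UNIV. A $ i $ j * partial i (partial j f) x)
    = (\<Sum>i\<in>UNIV. \<Sum>j\<in>UNIV. \<Sum>k\<in>UNIV. V k $ i * V k $ j * partial i (partial j f) x)"
    by (simp add: assms sum_distrib_right)
  also have "\<dots> = (\<Sum>i\<in>UNIV. \<Sum>k\<in>UNIV. \<Sum>j\<in>UNIV. V k $ i * V k $ j * partial i (partial j f) x)"
    by (intro sum.cong refl sum.swap)
  also have "\<dots> = (\<Sum>k\<in>UNIV. dir2 f x (V k))"
    unfolding dir2_def by (rule sum.swap)
  finally show ?thesis .
qed

lemma diff_op_eq: "diff_op a b f x = (1/2) * (\<Sum>i\<in>UNIV. \<Sum>j\<in>UNIV. a x $ i $ j * partial i (partial j f) x) + dir1 f x (b x)"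
  by (simp add: diff_op_def dir1_def)

lemma eventually_along_line:
  fixes x p :: "'a::real_normed_vector"
  assumes "open S" "x \<in> S"
  shows "\<forall>\<^sub>F s in nhds 0. x + s *\<^sub>R p \<in> S"
proof -
  have "((\<lambda>s. x + s *\<^sub>R p) \<longlongrightarrow> x) (nhds 0)"
    by (auto intro!: tendsto_eq_intros filterlim_ident)
  then show ?thesis using assms by (rule topological_tendstoD)
qed

text \<open>This is \<open>second_derivative_test\<close> on the line through \<open>(x, y)\<close>
  in direction \<open>(p, q)\<close>. The power 1/4 of the squared norm is the square root of the
  norm; \<open>X\<close> is the factor in its first derivative, and the exponent produces the 3/2.
  For \<open>\<tau> (p - q)\<close> parallel to \<open>\<zeta>\<close> the bracket is
  \<open>1 - 3/2 = -1/2\<close> times the squared length: this sign is the whole gain.\<close>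

lemma two_point_maximum:
  fixes f :: "real^'n \<Rightarrow> real" and \<tau> :: "real^'n \<Rightarrow> real^'n"
  assumes f: "open S" "smooth_on S f" "x \<in> S" "y \<in> S"
    and \<tau>: "linear \<tau>" and \<zeta>: "\<zeta> = \<tau> (x - y)" "\<zeta> \<noteq> 0"
    and \<Phi>: "\<And>x y. \<Phi> x y = f x - f y - C1 * (\<tau> (x - y) \<bullet> \<tau> (x - y)) powr (1/4)
          - C2 * ((x - y0) \<bullet> (x - y0) + (y - y0) \<bullet> (y - y0))"
    and max: "\<epsilon> > 0" "\<And>x' y'. dist x' x < \<epsilon> \<Longrightarrow> dist y' y < \<epsilon> \<Longrightarrow> \<Phi> x' y' \<le> \<Phi> x y"
    and X: "X = (1/2) * (\<zeta> \<bullet> \<zeta>) powr (-3/4)"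
  shows "dir1 f x p - dir1 f y q = C1 * X * (\<zeta> \<bullet> \<tau> (p - q)) + 2 * C2 * ((x - y0) \<bullet> p + (y - y0) \<bullet> q)" (is ?A)
    and "dir2 f x p - dir2 f y q \<le> C1 * X * (\<tau> (p - q) \<bullet> \<tau> (p - q) - 3/2 * ((\<zeta> \<bullet> \<tau> (p - q))\<^sup>2 / (\<zeta> \<bullet> \<zeta>)))
           + 2 * C2 * (p \<bullet> p + q \<bullet> q)" (is ?B)
proof -
  define \<pi> where "\<pi> = \<tau> (p - q)"
  define N where "N = \<zeta> \<bullet> \<zeta>"
  define M where "M s = N + 2 * s * (\<zeta> \<bullet> \<pi>) + s\<^sup>2 * (\<pi> \<bullet> \<pi>)" for s
  define M' where "M' s = 2 * (\<zeta> \<bullet> \<pi>) + 2 * s * (\<pi> \<bullet> \<pi>)" for s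
  have N: "N > 0" using \<zeta> by (simp add: N_def)
  define F where "F s = \<Phi> (x + s *\<^sub>R p) (y + s *\<^sub>R q)" for s
  define F1 where "F1 s = dir1 f (x + s *\<^sub>R p) p - dir1 f (y + s *\<^sub>R q) q
     - C1 * (1/4 * M s powr (-3/4) * M' s)
     - C2 * (2 * ((x - y0) \<bullet> p + (y - y0) \<bullet> q) + 2 * s * (p \<bullet> p + q \<bullet> q))" for s
  define F2 where "F2 = dir2 f x p - dir2 f y q
     - C1 * (1/4 * (-3/4 * N powr (-7/4) * (2 * (\<zeta> \<bullet> \<pi>)) * (2 * (\<zeta> \<bullet> \<pi>)) + N powr (-3/4) * (2 * (\<pi> \<bullet> \<pi>))))
     - C2 * (2 * (p \<bullet> p + q \<bullet> q))"
  have F_eq: "F s = f (x + s *\<^sub>R p) - f (y + s *\<^sub>R q) - C1 * M s powr (1/4)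
     - C2 * ((x - y0) \<bullet> (x - y0) + (y - y0) \<bullet> (y - y0) + 2 * s * ((x - y0) \<bullet> p + (y - y0) \<bullet> q)
        + s\<^sup>2 * (p \<bullet> p + q \<bullet> q))" for s
  proof -
    have "x + s *\<^sub>R p - (y + s *\<^sub>R q) = (x - y) + s *\<^sub>R (p - q)" by (simp add: algebra_simps)
    then have t: "\<tau> (x + s *\<^sub>R p - (y + s *\<^sub>R q)) = \<zeta> + s *\<^sub>R \<pi>"
      by (simp only: \<zeta>(1) \<pi>_def linear_add[OF \<tau>] linear_scale[OF \<tau>])
    have M: "(\<zeta> + s *\<^sub>R \<pi>) \<bullet> (\<zeta> + s *\<^sub>R \<pi>) = M s"
      by (simp add: M_def N_def inner_add_left inner_add_right inner_commute[of \<pi> \<zeta>] power2_eq_square algebra_simps)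
    have sq: "(z + s *\<^sub>R p - y0) \<bullet> (z + s *\<^sub>R p - y0)
        = (z - y0) \<bullet> (z - y0) + 2 * s * ((z - y0) \<bullet> p) + s\<^sup>2 * (p \<bullet> p)" for z p
    proof -
      have "z + s *\<^sub>R p - y0 = (z - y0) + s *\<^sub>R p" by simp
      then show ?thesis
        by (simp only: inner_add_left inner_add_right inner_commute[of p "z - y0"] power2_eq_square
            inner_scaleR_left inner_scaleR_right) (simp add: algebra_simps)
    qed
    show ?thesis unfolding F_def \<Phi> t M sq by (simp add: distrib_left)
  qed
  have "(M \<longlongrightarrow> N) (nhds 0)"
    unfolding M_def by (auto intro!: tendsto_eq_intros filterlim_ident)
  \<comment> \<open>\<open>powr\<close> is differentiated away from 0 only;
    \<open>\<zeta> \<noteq> 0\<close> keeps \<open>M\<close> positive near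
    \<open>s = 0\<close>.\<close>
  then have "\<forall>\<^sub>F s in nhds 0. M s > 0" using N by (rule order_tendstoD)
  moreover have "\<forall>\<^sub>F s in nhds 0. x + s *\<^sub>R p \<in> S \<inter> ball x \<epsilon>" "\<forall>\<^sub>F s in nhds 0. y + s *\<^sub>R q \<in> S \<inter> ball y \<epsilon>"
    using f max(1) by (intro eventually_along_line; auto)+
  ultimately have "\<forall>\<^sub>F s in nhds 0. M s > 0 \<and> x + s *\<^sub>R p \<in> S \<inter> ball x \<epsilon> \<and> y + s *\<^sub>R q \<in> S \<inter> ball y \<epsilon>"
    by eventually_elim simp
  then obtain \<delta> where \<delta>: "\<delta> > 0"
    "\<And>s. \<bar>s\<bar> < \<delta> \<Longrightarrow> M s > 0 \<and> x + s *\<^sub>R p \<in> S \<inter> ball x \<epsilon> \<and> y + s *\<^sub>R q \<in> S \<inter> ball y \<epsilon>"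
    by (auto simp: eventually_nhds_metric dist_real_def)
  have dM: "(M has_real_derivative M' s) (at s)" for s
    unfolding M_def M'_def by (auto intro!: derivative_eq_intros)
  have dF: "(F has_real_derivative F1 s) (at s)" if "\<bar>s\<bar> < \<delta>" for s
  proof -
    have Ms: "M s > 0" and S: "x + s *\<^sub>R p \<in> S" "y + s *\<^sub>R q \<in> S" using \<delta>(2)[OF that] by auto
    note d = has_real_derivative_along_line[OF f(2) S(1)] has_real_derivative_along_line[OF f(2) S(2)]
    show ?thesis unfolding F_eq[abs_def] F1_def
      using Ms by (auto intro!: derivative_eq_intros d DERIV_powr[OF dM] dM)
  qed
  have dF1: "(F1 has_real_derivative F2) (at 0)"
  proof -
    have M0: "M 0 = N" by (simp add: M_def)
    note d = has_real_derivative_dir1_along_line[OF f(2,3)] has_real_derivative_dir1_along_line[OF f(2,4)]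
    show ?thesis unfolding F1_def[abs_def] F2_def
      using N M0 by (auto intro!: derivative_eq_intros d dM simp: M'_def)
  qed
  have "F s \<le> F 0" if "\<bar>s\<bar> < \<delta>" for s
    using \<delta>(2)[OF that] max(2) by (auto simp: F_def dist_commute)
  note T = second_derivative_test[OF \<delta>(1) dF dF1 this]
  have M0: "M 0 = N" "M' 0 = 2 * (\<zeta> \<bullet> \<pi>)" by (simp_all add: M_def M'_def)
  have X': "N powr (-3/4) = 2 * X" by (simp add: X N_def)
  have "N powr (-7/4) = N powr (-3/4 - 1)" by simp
  also have "\<dots> = 2 * X / N" using N by (simp only: powr_diff X' powr_one)
  finally have X'': "N powr (-7/4) = 2 * X / N" .
  show ?A using T(1) unfolding F1_def M0 X' \<pi>_def[symmetric] by (simp add: distrib_left mult.assoc)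
  have "F2 = dir2 f x p - dir2 f y q - (C1 * X * (\<pi> \<bullet> \<pi> - 3/2 * ((\<zeta> \<bullet> \<pi>)\<^sup>2 / N)) + 2 * C2 * (p \<bullet> p + q \<bullet> q))"
    unfolding F2_def X' X'' by (simp add: field_simps power2_eq_square)
  with T(2) show ?B by (simp flip: \<pi>_def N_def)
qed

lemma partial_lincomb:
  assumes "smooth_on S f" "smooth_on S g" "y \<in> S"
  shows "partial i (\<lambda>x. c * f x + d * g x) y = c * partial i f y + d * partial i g y"
proof -
  have "((\<lambda>x. c * f x + d * g x) has_derivative
      (\<lambda>v. c * frechet_derivative f (at y) v + d * frechet_derivative g (at y) v)) (at y)"
    by (intro has_derivative_add has_derivative_mult_right smooth_on_has_derivative[OF _ assms(3)] assms(1,2))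
  from frechet_derivative_at[OF this] show ?thesis unfolding partial_def by metis
qed

lemma diff_op_lincomb:
  assumes "open S" "smooth_on S f" "smooth_on S g" "y \<in> S"
  shows "diff_op a b (\<lambda>x. c * f x + d * g x) y = c * diff_op a b f y + d * diff_op a b g y"
proof -
  have "partial i (partial j (\<lambda>x. c * f x + d * g x)) y
      = c * partial i (partial j f) y + d * partial i (partial j g) y" for i j
  proof -
    have "partial i (partial j (\<lambda>x. c * f x + d * g x)) y
      = partial i (\<lambda>x. c * partial j f x + d * partial j g x) y"
      unfolding partial_def[of i]
      by (subst frechet_derivative_cong[OF assms(1,4) partial_lincomb[OF assms(2,3)]]) auto
    then show ?thesis
      using partial_lincomb[OF smooth_on_partial smooth_on_partial, OF assms(2,3,4)] by simp
  qed
  then show ?thesis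
    by (simp add: diff_op_def partial_lincomb[OF assms(2,3,4)] sum.distrib sum_distrib_left algebra_simps)
qed

lemma smooth_on_lincomb:
  fixes f g :: "_ \<Rightarrow> real"
  assumes "open S" "smooth_on S f" "smooth_on S g"
  shows "smooth_on S (\<lambda>x. c * f x + d * g x)"
  using assms by (intro smooth_on_add smooth_on_linear_compose[OF bounded_linear_mult_right])

lemma quadratic_form_bound:
  fixes A :: "real^'n^'n"
  shows "\<bar>w \<bullet> (A *v w)\<bar> \<le> (\<Sum>i\<in>UNIV. \<Sum>j\<in>UNIV. \<bar>A $ i $ j\<bar>) * (w \<bullet> w)"
proof -
  have "\<bar>w \<bullet> (A *v w)\<bar> = \<bar>\<Sum>i\<in>UNIV. \<Sum>j\<in>UNIV. A $ i $ j * (w $ i * w $ j)\<bar>"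
    by (simp add: inner_vec_def matrix_vector_mult_def sum_distrib_left mult_ac)
  also have "\<dots> \<le> (\<Sum>i\<in>UNIV. \<Sum>j\<in>UNIV. \<bar>A $ i $ j * (w $ i * w $ j)\<bar>)"
    by (intro order_trans[OF sum_abs] sum_mono sum_abs)
  also have "\<dots> \<le> (\<Sum>i\<in>UNIV. \<Sum>j\<in>UNIV. \<bar>A $ i $ j\<bar> * (w \<bullet> w))"
  proof (intro sum_mono)
    fix i j
    have "\<bar>w $ i\<bar> * \<bar>w $ j\<bar> \<le> norm w * norm w"
      by (intro mult_mono component_le_norm_cart) auto
    then have "\<bar>A $ i $ j\<bar> * (\<bar>w $ i\<bar> * \<bar>w $ j\<bar>) \<le> \<bar>A $ i $ j\<bar> * (w \<bullet> w)"
      by (intro mult_left_mono) (simp_all add: dot_square_norm power2_eq_square)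
    then show "\<bar>A $ i $ j * (w $ i * w $ j)\<bar> \<le> \<bar>A $ i $ j\<bar> * (w \<bullet> w)"
      by (simp only: abs_mult)
  qed
  finally show ?thesis by (simp add: sum_distrib_right)
qed

lemma posdef_lower_bound:
  fixes A :: "real^'n^'n"
  assumes "\<And>w. w \<noteq> 0 \<Longrightarrow> w \<bullet> (A *v w) > 0"
  obtains \<theta> where "\<theta> > 0" "\<And>w. \<theta> * (w \<bullet> w) \<le> w \<bullet> (A *v w)"
proof -
  have "\<exists>u\<in>sphere 0 1. \<forall>w\<in>sphere 0 1. u \<bullet> (A *v u) \<le> w \<bullet> (A *v w)"
  proof (rule continuous_attains_inf)
    have "axis undefined 1 \<in> sphere (0 :: real^'n) 1" by simp
    then show "sphere (0 :: real^'n) 1 \<noteq> {}" by blast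
    show "continuous_on (sphere 0 1) (\<lambda>w. w \<bullet> (A *v w))"
      by (intro continuous_on_inner continuous_on_id linear_continuous_on matrix_vector_mul_bounded_linear)
  qed simp
  then obtain u where u: "norm u = 1" "\<And>w. norm w = 1 \<Longrightarrow> u \<bullet> (A *v u) \<le> w \<bullet> (A *v w)"
    by auto
  show ?thesis
  proof (rule that)
    show "u \<bullet> (A *v u) > 0" using u(1) by (intro assms) auto
    show "u \<bullet> (A *v u) * (w \<bullet> w) \<le> w \<bullet> (A *v w)" for w
    proof (cases "w = 0")
      case False
      let ?v = "(1 / norm w) *\<^sub>R w"
      have "u \<bullet> (A *v u) \<le> ?v \<bullet> (A *v ?v)" using False by (intro u(2)) simp
      also have "\<dots> = (w \<bullet> (A *v w)) / (w \<bullet> w)"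
        by (simp add: matrix_vector_mult_scaleR dot_square_norm power2_eq_square)
      finally show ?thesis using False by (simp add: field_simps)
    qed simp
  qed
qed

text \<open>Both sides are the trace of \<open>A\<close> transformed by \<open>\<tau>\<close>; so
  the sum does not depend on the factorization and is continuous in the entries of
  \<open>A\<close>.\<close>

lemma sum_inner_rank_one:
  fixes A :: "real^'n^'n"
  assumes "linear \<tau>" "\<And>i j. A $ i $ j = (\<Sum>k\<in>UNIV. V k $ i * V k $ j)"
  shows "(\<Sum>k\<in>UNIV. \<tau> (V k) \<bullet> \<tau> (V k))
    = (\<Sum>i\<in>UNIV. \<Sum>j\<in>UNIV. A $ i $ j * (\<tau> (axis i 1) \<bullet> \<tau> (axis j 1)))"
proof -
  have \<tau>: "\<tau> v = (\<Sum>i\<in>UNIV. v $ i *\<^sub>R \<tau> (axis i 1))" for v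
  proof -
    have "\<tau> (\<Sum>i\<in>UNIV. v $ i *\<^sub>R axis i 1) = (\<Sum>i\<in>UNIV. v $ i *\<^sub>R \<tau> (axis i 1))"
      using assms(1) by (simp add: linear_sum linear_scale)
    then show ?thesis using basis_expansion[of v] by (simp add: scalar_mult_eq_scaleR)
  qed
  have "\<tau> (V k) \<bullet> \<tau> (V k) = (\<Sum>i\<in>UNIV. \<Sum>j\<in>UNIV. V k $ i * V k $ j * (\<tau> (axis i 1) \<bullet> \<tau> (axis j 1)))" for k
    by (subst (1 2) \<tau>) (simp add: inner_sum_left inner_sum_right sum_distrib_left mult_ac inner_commute)
  then have "(\<Sum>k\<in>UNIV. \<tau> (V k) \<bullet> \<tau> (V k))
    = (\<Sum>k\<in>UNIV. \<Sum>i\<in>UNIV. \<Sum>j\<in>UNIV. V k $ i * V k $ j * (\<tau> (axis i 1) \<bullet> \<tau> (axis j 1)))" by simp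
  also have "\<dots> = (\<Sum>i\<in>UNIV. \<Sum>j\<in>UNIV. \<Sum>k\<in>UNIV. V k $ i * V k $ j * (\<tau> (axis i 1) \<bullet> \<tau> (axis j 1)))"
    by (subst sum.swap, intro sum.cong refl sum.swap)
  finally show ?thesis by (simp add: assms(2) sum_distrib_right)
qed

lemma sum_norm_rank_one:
  fixes A :: "real^'n^'n"
  assumes "\<And>i j. A $ i $ j = (\<Sum>k\<in>UNIV. V k $ i * V k $ j)"
  shows "(\<Sum>k\<in>UNIV. V k \<bullet> V k) = trace A"
  unfolding inner_vec_def trace_def assms by (subst sum.swap) simp

section \<open>Equicontinuity of bounded harmonic functions\<close>

definition elliptic_on :: "(real^'n) set \<Rightarrow> (real^'n \<Rightarrow> real^'n^'n) \<Rightarrow> (real^'n \<Rightarrow> real^'n) \<Rightarrow> bool" where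
  "elliptic_on S a b \<longleftrightarrow> open S \<and> continuous_on S a \<and> continuous_on S b \<and>
     (\<forall>y\<in>S. transpose (a y) = a y \<and> (\<forall>w. w \<noteq> 0 \<longrightarrow> w \<bullet> (a y *v w) > 0))"

definition harmonic_on ::
  "(real^'n) set \<Rightarrow> (real^'n \<Rightarrow> real^'n^'n) \<Rightarrow> (real^'n \<Rightarrow> real^'n) \<Rightarrow> (real^'n \<Rightarrow> real) \<Rightarrow> bool" where
  "harmonic_on S a b f \<longleftrightarrow> smooth_on S f \<and> (\<forall>y\<in>S. diff_op a b f y = 0)"

lemma harmonic_on_lincomb:
  "open S \<Longrightarrow> harmonic_on S a b f \<Longrightarrow> harmonic_on S a b g \<Longrightarrow> harmonic_on S a b (\<lambda>x. c * f x + d * g x)"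
  by (simp add: harmonic_on_def smooth_on_lincomb diff_op_lincomb)

text \<open>\<open>\<tau>\<close> inverts the map that sends a coefficient vector to the combination
  of the \<open>V k\<close>. That map times its transpose is \<open>A\<close>, so it is onto because
  \<open>A\<close> is. In the coordinates \<open>\<tau> z\<close> the second-order operator with
  constant coefficients \<open>A\<close> becomes the Laplacian.\<close>

lemma posdef_sqrt:
  fixes A :: "real^'n^'n"
  assumes "transpose A = A" "\<And>w. w \<noteq> 0 \<Longrightarrow> w \<bullet> (A *v w) > 0"
  obtains V :: "'n \<Rightarrow> real^'n" and \<tau> :: "real^'n \<Rightarrow> real^'n"
  where "\<And>i j. A $ i $ j = (\<Sum>k\<in>UNIV. V k $ i * V k $ j)" "linear \<tau>"
    "\<And>w. \<tau> (\<Sum>k\<in>UNIV. w $ k *\<^sub>R V k) = w" "\<And>z. \<tau> z = 0 \<Longrightarrow> z = 0"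
proof -
  have nonneg: "0 \<le> w \<bullet> (A *v w)" for w
    using assms(2)[of w] by (cases "w = 0") auto
  obtain V :: "'n \<Rightarrow> real^'n" where V: "\<And>i j. A $ i $ j = (\<Sum>k\<in>UNIV. V k $ i * V k $ j)"
    using psd_decomposition[OF assms(1) nonneg] by blast
  define \<sigma> where "\<sigma> w = (\<Sum>k\<in>UNIV. w $ k *\<^sub>R V k)" for w :: "real^'n"
  have "linear \<sigma>"
    by (rule linearI) (simp_all add: \<sigma>_def scaleR_add_left sum.distrib scaleR_sum_right)
  have A: "A *v w = \<sigma> (\<chi> k. V k \<bullet> w)" for w
  proof -
    have "(A *v w) $ i = \<sigma> (\<chi> k. V k \<bullet> w) $ i" for i
      unfolding \<sigma>_def matrix_vector_mult_def V sum_component inner_vec_def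
      by (simp add: sum_distrib_left sum_distrib_right, subst sum.swap) (simp add: mult_ac)
    then show ?thesis by (simp add: vec_eq_iff)
  qed
  have "inj ((*v) A)"
  proof (rule injI)
    fix v w assume "A *v v = A *v w"
    then have "A *v (v - w) = 0" by (simp add: matrix_vector_mult_diff_distrib)
    then show "v = w" using assms(2)[of "v - w"] by auto
  qed
  then have "surj ((*v) A)"
    by (metis matrix_left_invertible_injective matrix_right_invertible_surjective matrix_left_right_inverse)
  then have "surj \<sigma>" using A unfolding surj_def by metis
  then obtain \<tau> where \<tau>: "linear \<tau>" "\<And>x. \<tau> (\<sigma> x) = x" "\<And>x. \<sigma> (\<tau> x) = x"
    using linear_surjective_isomorphism[OF \<open>linear \<sigma>\<close>] by blast
  show ?thesis
  proof (rule that[OF V \<tau>(1)])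
    show "z = 0" if "\<tau> z = 0" for z
      using \<tau>(3)[of z] that \<open>linear \<sigma>\<close> by (simp add: linear_0)
  qed (use \<tau> in \<open>simp add: \<sigma>_def\<close>)
qed

lemma dir2_zero [simp]: "dir2 f x 0 = 0"
  by (simp add: dir2_def)

text \<open>The doubling of variables argument. Reflecting one copy of a frozen square root of the
  coefficient matrix in the hyperplane orthogonal to \<open>\<tau> (x - y)\<close> makes the concavity of
  \<open>\<bar>\<tau> (x - y)\<bar>\<^sup>1\<^sup>/\<^sup>2\<close> beat all other terms.\<close>

lemma harmonic_equicontinuous:
  fixes S :: "(real^'n) set"
  assumes ell: "elliptic_on S a b" and y0: "y0 \<in> S" and "\<epsilon> > 0"
  obtains \<delta> where "\<delta> > 0" "ball y0 \<delta> \<subseteq> S"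
    "\<And>f y. harmonic_on S a b f \<Longrightarrow> (\<And>x. x \<in> S \<Longrightarrow> \<bar>f x\<bar> \<le> B) \<Longrightarrow> dist y y0 < \<delta> \<Longrightarrow> \<bar>f y - f y0\<bar> < \<epsilon>"
proof -
  have S: "open S" and cont: "continuous_on S a" "continuous_on S b"
    and sym: "\<And>y. y \<in> S \<Longrightarrow> transpose (a y) = a y"
    and pos: "\<And>y w. y \<in> S \<Longrightarrow> w \<noteq> 0 \<Longrightarrow> w \<bullet> (a y *v w) > 0"
    using ell by (auto simp: elliptic_on_def)
  have ta: "(a \<longlongrightarrow> a y0) (nhds y0)" and tb: "(b \<longlongrightarrow> b y0) (nhds y0)"
    using cont S y0 by (auto simp: continuous_on_eq_continuous_at isCont_def tendsto_at_iff_tendsto_nhds)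
  obtain V :: "'n \<Rightarrow> real^'n" and \<tau> :: "real^'n \<Rightarrow> real^'n" where
    V: "\<And>i j. a y0 $ i $ j = (\<Sum>k\<in>UNIV. V k $ i * V k $ j)" and \<tau>: "linear \<tau>"
    and \<tau>\<sigma>: "\<And>w. \<tau> (\<Sum>k\<in>UNIV. w $ k *\<^sub>R V k) = w" and \<tau>0: "\<And>z. \<tau> z = 0 \<Longrightarrow> z = 0"
    using posdef_sqrt[OF sym[OF y0] pos[OF y0]] by blast
  obtain \<theta> where \<theta>: "\<theta> > 0" "\<And>w. \<theta> * (w \<bullet> w) \<le> w \<bullet> (a y0 *v w)"
    using posdef_lower_bound[OF pos[OF y0]] by blast
  obtain K where K: "K > 0" "\<And>z. norm (\<tau> z) \<le> K * norm z"
    using linear_bounded_pos[OF \<tau>] by blast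
  define n where "n = real CARD('n)"
  have n: "n \<ge> 1" unfolding n_def using zero_less_card_finite[where 'a='n] by linarith
  define e where "e = 1 / (8 * n)"
  have e: "e > 0" "e \<le> 1/8" using n by (auto simp: e_def field_simps)
  define \<kappa> where "\<kappa> = 1 - e"
  define R where "R x = a x - \<kappa> *\<^sub>R a y0" for x
  define T where "T x = (\<Sum>i\<in>UNIV. \<Sum>j\<in>UNIV. R x $ i $ j * (\<tau> (axis i 1) \<bullet> \<tau> (axis j 1)))" for x
  define m where "m x = (\<Sum>i\<in>UNIV. \<Sum>j\<in>UNIV. \<bar>(a x - a y0) $ i $ j\<bar>)" for x
  define Tr where "Tr = trace (a y0) + 1"
  define Bb where "Bb = norm (b y0) + 1"
  have \<tau>V: "\<tau> (V k) = axis k 1" for k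
  proof -
    have "(\<Sum>l\<in>UNIV. axis k 1 $ l *\<^sub>R V l) = (\<Sum>l\<in>UNIV. if l = k then V l else 0)"
      by (intro sum.cong) (auto simp: axis_def)
    then show ?thesis using \<tau>\<sigma>[of "axis k 1"] by simp
  qed
  have T0: "T y0 = 1 / 8"
  proof -
    have "R y0 = e *\<^sub>R a y0" by (simp add: R_def \<kappa>_def algebra_simps)
    then have "T y0 = e * (\<Sum>i\<in>UNIV. \<Sum>j\<in>UNIV. a y0 $ i $ j * (\<tau> (axis i 1) \<bullet> \<tau> (axis j 1)))"
      by (simp add: T_def sum_distrib_left mult_ac)
    also have "\<dots> = e * (\<Sum>k\<in>UNIV. \<tau> (V k) \<bullet> \<tau> (V k))"
      using sum_inner_rank_one[OF \<tau>, of "a y0" V] V by simp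
    also have "\<dots> = e * n" by (simp add: \<tau>V inner_axis_axis n_def)
    finally show ?thesis using n by (simp add: e_def)
  qed
  have tT: "(T \<longlongrightarrow> T y0) (nhds y0)" unfolding T_def R_def by (intro tendsto_intros ta)
  have tm: "(m \<longlongrightarrow> m y0) (nhds y0)" unfolding m_def by (intro tendsto_intros ta)
  have ttr: "((\<lambda>x. trace (a x)) \<longlongrightarrow> trace (a y0)) (nhds y0)"
    unfolding trace_def by (intro tendsto_intros ta)
  have tnb: "((\<lambda>x. norm (b x)) \<longlongrightarrow> norm (b y0)) (nhds y0)" by (intro tendsto_intros tb)
  have "\<forall>\<^sub>F x in nhds y0. x \<in> S" using S y0 by (rule eventually_nhds_in_open)
  moreover have "\<forall>\<^sub>F x in nhds y0. T x < 1/4" using tT by (rule order_tendstoD) (simp add: T0)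
  moreover have "\<forall>\<^sub>F x in nhds y0. m x < e * \<theta>" using tm by (rule order_tendstoD) (use e \<theta> in \<open>simp add: m_def\<close>)
  moreover have "\<forall>\<^sub>F x in nhds y0. trace (a x) < Tr" using ttr by (rule order_tendstoD) (simp add: Tr_def)
  moreover have "\<forall>\<^sub>F x in nhds y0. norm (b x) < Bb" using tnb by (rule order_tendstoD) (simp add: Bb_def)
  ultimately have "\<forall>\<^sub>F x in nhds y0. x \<in> S \<and> T x < 1/4 \<and> m x < e * \<theta> \<and> trace (a x) < Tr \<and> norm (b x) < Bb"
    by eventually_elim simp
  then obtain \<rho>0 where \<rho>0: "\<rho>0 > 0"
    "\<And>x. dist x y0 < \<rho>0 \<Longrightarrow> x \<in> S \<and> T x < 1/4 \<and> m x < e * \<theta> \<and> trace (a x) < Tr \<and> norm (b x) < Bb"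
    by (auto simp: eventually_nhds_metric)
  have Bb: "Bb > 0" by (simp add: Bb_def add_nonneg_pos)
  \<comment> \<open>The three bounds keep the closed ball in the good neighborhood, give
    \<open>norm \<zeta> \<le> 1\<close> and hence \<open>X \<ge> 1/2\<close>, and hold the drift
    difference paired with \<open>\<zeta>\<close> below \<open>1/4\<close>.\<close>
  define \<rho> where "\<rho> = Min {\<rho>0 / 2, 1 / (2 * K), 1 / (16 * K * K * Bb)}"
  have \<rho>: "\<rho> > 0" "\<rho> < \<rho>0" "K * (2 * \<rho>) \<le> 1" "K * (2 * \<rho>) * (K * (2 * Bb)) \<le> 1/4"
  proof -
    have *: "\<rho> \<le> \<rho>0 / 2" "\<rho> \<le> 1 / (2 * K)" "\<rho> \<le> 1 / (16 * K * K * Bb)" by (auto simp: \<rho>_def)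
    show "\<rho> > 0" using \<rho>0 K Bb by (auto simp: \<rho>_def)
    show "\<rho> < \<rho>0" using * \<rho>0 by simp
    show "K * (2 * \<rho>) \<le> 1" using *(2) K by (simp add: field_simps)
    show "K * (2 * \<rho>) * (K * (2 * Bb)) \<le> 1/4" using *(3) K Bb by (simp add: field_simps)
  qed
  have near: "x \<in> S" "T x \<le> 1/4" "m x \<le> e * \<theta>" "trace (a x) \<le> Tr" "norm (b x) \<le> Bb"
    if "dist x y0 \<le> \<rho>" for x
    using \<rho>0(2)[of x] that \<rho>(2) by auto
  \<comment> \<open>Large enough that the localizing penalty exceeds the maximal oscillation
    \<open>2 * B\<close> as soon as one point reaches the sphere of radius
    \<open>\<rho>\<close>.\<close>
  define C2 where "C2 = (2 * \<bar>B\<bar> + 1) / \<rho>\<^sup>2"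
  have C2: "C2 > 0" "C2 * \<rho>\<^sup>2 \<ge> 2 * B" using \<rho>(1) by (auto simp: C2_def add_nonneg_pos)
  \<comment> \<open>The final balance contains \<open>C1 * (1/2) * (-3/8)\<close>. The factor 6
    turns this into \<open>-9/8\<close> times a bracket which is the sum of all positive terms,
    increased by 1.\<close>
  define C1 where "C1 = 6 * (2 * C2 * Tr + 4 * C2 * \<rho> * Bb + 1)"
  have Tr: "Tr > 0"
    unfolding Tr_def sum_norm_rank_one[OF V, symmetric] by (intro add_nonneg_pos sum_nonneg) auto
  have C1: "C1 > 0" using C2(1) Tr \<rho>(1) Bb by (simp add: C1_def add_pos_pos)
  \<comment> \<open>As a form, \<open>R x\<close> is \<open>e\<close> times \<open>a y0\<close>,
    which is at least \<open>e * \<theta>\<close>, plus an error of size at most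
    \<open>m x \<le> e * \<theta>\<close>.\<close>
  have residual: "\<exists>W :: 'n \<Rightarrow> real^'n. \<forall>i j. R x $ i $ j = (\<Sum>k\<in>UNIV. W k $ i * W k $ j)" if x: "dist x y0 \<le> \<rho>" for x
  proof -
    have t: "transpose (R x) = R x"
      using sym[OF near(1)[OF x]] sym[OF y0] by (simp add: R_def transpose_def vec_eq_iff)
    have p: "0 \<le> w \<bullet> (R x *v w)" for w
    proof -
      have "R x *v w = e *\<^sub>R (a y0 *v w) + (a x - a y0) *v w"
      proof -
        have "R x = e *\<^sub>R a y0 + (a x - a y0)" by (simp add: R_def \<kappa>_def scaleR_diff_left)
        then show ?thesis by (simp only: matrix_vector_mult_add_rdistrib scaleR_matrix_vector_assoc)
      qed
      then have "w \<bullet> (R x *v w) = e * (w \<bullet> (a y0 *v w)) + w \<bullet> ((a x - a y0) *v w)"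
        by (simp add: inner_add_right)
      moreover have "e * (w \<bullet> (a y0 *v w)) \<ge> e * \<theta> * (w \<bullet> w)"
        using mult_left_mono[OF \<theta>(2)[of w], of e] e by (simp add: mult.assoc)
      moreover have "\<bar>w \<bullet> ((a x - a y0) *v w)\<bar> \<le> e * \<theta> * (w \<bullet> w)"
        using quadratic_form_bound[of w "a x - a y0"] mult_right_mono[OF near(3)[OF x], of "w \<bullet> w"]
        by (simp add: m_def)
      ultimately show ?thesis by linarith
    qed
    show ?thesis by (rule psd_decomposition[OF t p]) blast
  qed
  have split: "(\<Sum>i\<in>UNIV. \<Sum>j\<in>UNIV. a x $ i $ j * D i j)
     = \<kappa> * (\<Sum>i\<in>UNIV. \<Sum>j\<in>UNIV. a y0 $ i $ j * D i j) + (\<Sum>i\<in>UNIV. \<Sum>j\<in>UNIV. R x $ i $ j * D i j)" for x D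
    unfolding sum_distrib_left sum.distrib[symmetric]
    by (intro sum.cong refl) (simp add: R_def algebra_simps)
  \<comment> \<open>It suffices that \<open>\<Phi>\<close> is nowhere positive on the product of the
    closed balls; evaluation at \<open>(y0, y)\<close> then gives the claim. At a positive maximum,
    positivity forces the two points apart and the quadratic penalty keeps them off the boundary, so
    the conditions of \<open>two_point_maximum\<close> clash with harmonicity.\<close>
  have main: "f y0 - f y \<le> C1 * (\<tau> (y - y0) \<bullet> \<tau> (y - y0)) powr (1/4) + C2 * ((y - y0) \<bullet> (y - y0))"
    if f: "harmonic_on S a b f" "\<And>x. x \<in> S \<Longrightarrow> \<bar>f x\<bar> \<le> B" and y: "dist y y0 \<le> \<rho>" for f y
  proof -
    define \<Phi> where "\<Phi> x y = f x - f y - C1 * (\<tau> (x - y) \<bullet> \<tau> (x - y)) powr (1/4)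
          - C2 * ((x - y0) \<bullet> (x - y0) + (y - y0) \<bullet> (y - y0))" for x y
    have fS: "smooth_on S f" using f(1) by (simp add: harmonic_on_def)
    have cbS: "cball y0 \<rho> \<subseteq> S" using near(1) by (auto simp: dist_commute)
    have contf: "continuous_on (cball y0 \<rho>) f"
      using smooth_on_continuous[OF fS] cbS continuous_on_subset by blast
    have "continuous_on (cball y0 \<rho> \<times> cball y0 \<rho>) (\<lambda>z. \<Phi> (fst z) (snd z))"
      unfolding \<Phi>_def
      by (intro continuous_intros continuous_on_compose2[OF contf] continuous_on_powr'
          linear_continuous_on_compose[OF _ \<tau>]) auto
    then obtain z where z: "z \<in> cball y0 \<rho> \<times> cball y0 \<rho>"
      "\<And>z'. z' \<in> cball y0 \<rho> \<times> cball y0 \<rho> \<Longrightarrow> \<Phi> (fst z') (snd z') \<le> \<Phi> (fst z) (snd z)"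
      using continuous_attains_sup[of "cball y0 \<rho> \<times> cball y0 \<rho>" "\<lambda>z. \<Phi> (fst z) (snd z)"] \<rho>(1)
      by (auto simp: compact_Times)
    obtain x' y' where xy: "z = (x', y')" by (cases z)
    have dx: "dist x' y0 \<le> \<rho>" and dy: "dist y' y0 \<le> \<rho>" using z(1) by (auto simp: xy dist_commute)
    have mx: "\<Phi> u v \<le> \<Phi> x' y'" if "dist u y0 \<le> \<rho>" "dist v y0 \<le> \<rho>" for u v
      using z(2)[of "(u, v)"] that by (simp add: xy dist_commute)
    have "\<Phi> x' y' \<le> 0"
    proof (rule ccontr)
      assume pos': "\<not> \<Phi> x' y' \<le> 0"
      note Nx = near[OF dx] and Ny = near[OF dy]
      have fb: "f x' - f y' \<le> 2 * B" using f(2)[OF Nx(1)] f(2)[OF Ny(1)] by linarith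
      have t: "C1 * (\<tau> (x' - y') \<bullet> \<tau> (x' - y')) powr (1/4) \<ge> 0" using C1 by simp
      have sq: "(u - y0) \<bullet> (u - y0) = (dist u y0)\<^sup>2" for u by (simp add: dot_square_norm dist_norm)
      have "x' \<noteq> y'"
        using pos' C2(1) by (auto simp: \<Phi>_def linear_0[OF \<tau>] zero_le_mult_iff)
      have lt: "dist x' y0 < \<rho> \<and> dist y' y0 < \<rho>"
      proof (rule ccontr)
        assume "\<not> ?thesis"
        then have "(dist x' y0)\<^sup>2 + (dist y' y0)\<^sup>2 \<ge> \<rho>\<^sup>2"
          using dx dy by (smt (verit) zero_le_power2)
        then have "C2 * ((dist x' y0)\<^sup>2 + (dist y' y0)\<^sup>2) \<ge> 2 * B"
          using mult_left_mono[of "\<rho>\<^sup>2" _ C2] C2 by (smt (verit))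
        then show False using pos' fb t by (simp add: \<Phi>_def sq)
      qed
      define \<epsilon>' where "\<epsilon>' = min (\<rho> - dist x' y0) (\<rho> - dist y' y0)"
      have \<epsilon>': "\<epsilon>' > 0" using lt by (simp add: \<epsilon>'_def)
      have locmax: "\<Phi> u v \<le> \<Phi> x' y'" if "dist u x' < \<epsilon>'" "dist v y' < \<epsilon>'" for u v
        using that dist_triangle[of u y0 x'] dist_triangle[of v y0 y']
        by (intro mx) (auto simp: \<epsilon>'_def)
      define \<zeta> where "\<zeta> = \<tau> (x' - y')"
      have \<zeta>: "\<zeta> \<noteq> 0" using \<tau>0[of "x' - y'"] \<open>x' \<noteq> y'\<close> by (auto simp: \<zeta>_def)
      define N where "N = \<zeta> \<bullet> \<zeta>"
      have N: "N > 0" using \<zeta> by (simp add: N_def)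
      define X where "X = (1/2) * N powr (-3/4)"
      have "norm \<zeta> \<le> K * norm (x' - y')" unfolding \<zeta>_def by (rule K)
      also have "\<dots> \<le> K * (2 * \<rho>)"
        using dist_triangle2[of x' y' y0] dx dy K(1) by (intro mult_left_mono) (auto simp: dist_norm)
      finally have n\<zeta>: "norm \<zeta> \<le> K * (2 * \<rho>)" .
      have X: "X \<ge> 1/2"
      proof -
        have "N = (norm \<zeta>)\<^sup>2" by (simp add: N_def dot_square_norm)
        also have "\<dots> \<le> 1" using n\<zeta> \<rho>(3) by (simp add: power_le_one)
        finally have "1 powr (-3/4) \<le> N powr (-3/4)" using N by (intro powr_mono2') auto
        then show ?thesis by (simp add: X_def)
      qed
      note TP = two_point_maximum[OF S fS Nx(1) Ny(1) \<tau> \<zeta>_def \<zeta> \<Phi>_def \<epsilon>' locmax X_def[unfolded N_def]]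
      define eh where "eh = (1 / norm \<zeta>) *\<^sub>R \<zeta>"
      have eh: "eh \<bullet> eh = 1" using \<zeta> by (simp add: eh_def dot_square_norm power2_eq_square)
      define g where "g = (\<Sum>k\<in>UNIV. eh $ k *\<^sub>R V k)"
      have \<tau>g: "\<tau> g = eh" unfolding g_def by (rule \<tau>\<sigma>)
      \<comment> \<open>In the coordinates given by \<open>\<tau>\<close>, \<open>q k\<close> is the
        \<open>k\<close>-th basis vector reflected in the hyperplane orthogonal to
        \<open>eh\<close>. A reflection is orthogonal, so the \<open>q k\<close> factor
        \<open>a y0\<close> as well, while \<open>\<tau> (V k - q k)\<close> is a multiple of
        \<open>eh\<close>.\<close>
      define q where "q k = V k - (2 * eh $ k) *\<^sub>R g" for k
      have q: "a y0 $ i $ j = (\<Sum>k\<in>UNIV. q k $ i * q k $ j)" for i j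
      proof -
        have gi: "(\<Sum>k\<in>UNIV. eh $ k * V k $ i) = g $ i" for i by (simp add: g_def)
        have e2: "(\<Sum>k\<in>UNIV. eh $ k * eh $ k) = 1" using eh by (simp add: inner_vec_def)
        have "(\<Sum>k\<in>UNIV. q k $ i * q k $ j) = (\<Sum>k\<in>UNIV. V k $ i * V k $ j)
          - 2 * g $ j * (\<Sum>k\<in>UNIV. eh $ k * V k $ i) - 2 * g $ i * (\<Sum>k\<in>UNIV. eh $ k * V k $ j)
          + 4 * g $ i * g $ j * (\<Sum>k\<in>UNIV. eh $ k * eh $ k)"
          unfolding sum_distrib_left sum.distrib[symmetric] sum_subtractf[symmetric]
          by (intro sum.cong refl) (simp add: q_def algebra_simps)
        then show ?thesis unfolding gi e2 V by simp
      qed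
      obtain W1 :: "'n \<Rightarrow> real^'n" where W1: "\<And>i j. R x' $ i $ j = (\<Sum>k\<in>UNIV. W1 k $ i * W1 k $ j)"
        using residual[OF dx] by blast
      obtain W2 :: "'n \<Rightarrow> real^'n" where W2: "\<And>i j. R y' $ i $ j = (\<Sum>k\<in>UNIV. W2 k $ i * W2 k $ j)"
        using residual[OF dy] by blast
      \<comment> \<open>The two copies move apart along \<open>\<zeta>\<close> only, where the
        square root is concave. As \<open>eh\<close> is a unit vector, summing over \<open>k\<close>
        produces the factor \<open>-2\<close>.\<close>
      have 1: "dir2 f x' (V k) - dir2 f y' (q k)
          \<le> C1 * X * (- 2 * (eh $ k * eh $ k)) + 2 * C2 * (V k \<bullet> V k + q k \<bullet> q k)" for k
      proof -
        have "V k - q k = (2 * eh $ k) *\<^sub>R g" by (simp add: q_def)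
        then have \<pi>: "\<tau> (V k - q k) = (2 * eh $ k) *\<^sub>R eh" by (simp only: linear_scale[OF \<tau>] \<tau>g)
        have "\<zeta> = norm \<zeta> *\<^sub>R eh" using \<zeta> by (simp add: eh_def)
        then have "\<zeta> \<bullet> eh = norm \<zeta>" using eh by (metis inner_scaleR_left mult.right_neutral)
        then have "(\<zeta> \<bullet> \<tau> (V k - q k))\<^sup>2 / (\<zeta> \<bullet> \<zeta>) = 4 * (eh $ k * eh $ k)"
          using \<zeta> by (simp add: \<pi> dot_square_norm power2_eq_square)
        note sq = this
        have nn: "\<tau> (V k - q k) \<bullet> \<tau> (V k - q k) = 4 * (eh $ k * eh $ k)"
          by (simp add: \<pi> eh)
        show ?thesis using TP(2)[of "V k" "q k"] unfolding sq nn by simp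
      qed
      \<comment> \<open>For the residual only one point moves at a time. The negative square is
        discarded, and the remaining squares add up to \<open>T\<close>.\<close>
      have le: "C1 * X * (u - 3/2 * (v\<^sup>2 / (\<zeta> \<bullet> \<zeta>))) \<le> C1 * X * u" for u v
        using C1 X by (intro mult_left_mono) auto
      have 2: "dir2 f x' (W1 k) \<le> C1 * X * (\<tau> (W1 k) \<bullet> \<tau> (W1 k)) + 2 * C2 * (W1 k \<bullet> W1 k)" for k
        using TP(2)[of "W1 k" 0] le[of "\<tau> (W1 k) \<bullet> \<tau> (W1 k)" "\<zeta> \<bullet> \<tau> (W1 k)"] by simp
      have 3: "- dir2 f y' (W2 k) \<le> C1 * X * (\<tau> (W2 k) \<bullet> \<tau> (W2 k)) + 2 * C2 * (W2 k \<bullet> W2 k)" for k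
        using TP(2)[of 0 "W2 k"] le[of "\<tau> (W2 k) \<bullet> \<tau> (W2 k)" "\<zeta> \<bullet> \<tau> (W2 k)"]
        by (simp add: linear_neg[OF \<tau>])
      have s1: "(\<Sum>k\<in>UNIV. dir2 f x' (V k)) - (\<Sum>k\<in>UNIV. dir2 f y' (q k))
         \<le> C1 * X * (-2) + 2 * C2 * (2 * trace (a y0))"
      proof -
        have "(\<Sum>k\<in>UNIV. dir2 f x' (V k)) - (\<Sum>k\<in>UNIV. dir2 f y' (q k))
          \<le> (\<Sum>k\<in>UNIV. C1 * X * (- 2 * (eh $ k * eh $ k)) + 2 * C2 * (V k \<bullet> V k + q k \<bullet> q k))"
          unfolding sum_subtractf[symmetric] by (intro sum_mono 1)
        also have "\<dots> = C1 * X * (- 2 * (\<Sum>k\<in>UNIV. eh $ k * eh $ k))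
            + 2 * C2 * ((\<Sum>k\<in>UNIV. V k \<bullet> V k) + (\<Sum>k\<in>UNIV. q k \<bullet> q k))"
          by (simp only: sum.distrib distrib_left sum_distrib_left)
        also have "(\<Sum>k\<in>UNIV. eh $ k * eh $ k) = 1" using eh by (simp add: inner_vec_def)
        also have "(\<Sum>k\<in>UNIV. V k \<bullet> V k) = trace (a y0)" by (rule sum_norm_rank_one[OF V])
        also have "(\<Sum>k\<in>UNIV. q k \<bullet> q k) = trace (a y0)" by (rule sum_norm_rank_one[OF q])
        finally show ?thesis by simp
      qed
      have s2: "(\<Sum>k\<in>UNIV. dir2 f x' (W1 k)) \<le> C1 * X * T x' + 2 * C2 * trace (R x')"
        using sum_mono[of UNIV "\<lambda>k. dir2 f x' (W1 k)", OF 2] sum_norm_rank_one[OF W1] sum_inner_rank_one[OF \<tau> W1]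
        by (simp add: T_def sum.distrib sum_distrib_left[symmetric])
      have s3: "- (\<Sum>k\<in>UNIV. dir2 f y' (W2 k)) \<le> C1 * X * T y' + 2 * C2 * trace (R y')"
        using sum_mono[of UNIV "\<lambda>k. - dir2 f y' (W2 k)", OF 3] sum_norm_rank_one[OF W2] sum_inner_rank_one[OF \<tau> W2]
        by (simp add: T_def sum.distrib sum_distrib_left[symmetric] sum_negf)
      have d: "dir1 f x' (b x') - dir1 f y' (b y') \<le> C1 * X * (1/4) + 4 * C2 * \<rho> * Bb"
      proof -
        have "\<zeta> \<bullet> \<tau> (b x' - b y') \<le> norm \<zeta> * norm (\<tau> (b x' - b y'))" by (rule norm_cauchy_schwarz)
        also have "\<dots> \<le> K * (2 * \<rho>) * (K * (2 * Bb))"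
        proof (intro mult_mono n\<zeta>)
          have "norm (\<tau> (b x' - b y')) \<le> K * norm (b x' - b y')" by (rule K)
          also have "\<dots> \<le> K * (2 * Bb)"
            using Nx(5) Ny(5) norm_triangle_ineq4[of "b x'" "b y'"] K(1) by (intro mult_left_mono) auto
          finally show "norm (\<tau> (b x' - b y')) \<le> K * (2 * Bb)" .
        qed (use K \<rho> in auto)
        finally have z1: "\<zeta> \<bullet> \<tau> (b x' - b y') \<le> 1/4" using \<rho>(4) by linarith
        have "(u - y0) \<bullet> v \<le> \<rho> * Bb" if "dist u y0 \<le> \<rho>" "norm v \<le> Bb" for u v
          using that norm_cauchy_schwarz[of "u - y0" v] mult_mono[of "norm (u - y0)" \<rho> "norm v" Bb] \<rho>(1)
          by (simp add: dist_norm)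
        from this[OF dx Nx(5)] this[OF dy Ny(5)]
        have "(x' - y0) \<bullet> b x' + (y' - y0) \<bullet> b y' \<le> 2 * (\<rho> * Bb)" by simp
        then have "2 * C2 * ((x' - y0) \<bullet> b x' + (y' - y0) \<bullet> b y') \<le> 2 * C2 * (2 * (\<rho> * Bb))"
          using C2(1) by (intro mult_left_mono) auto
        moreover have "C1 * X * (\<zeta> \<bullet> \<tau> (b x' - b y')) \<le> C1 * X * (1/4)"
          using z1 C1 X by (intro mult_left_mono) auto
        moreover have "2 * C2 * (2 * (\<rho> * Bb)) = 4 * C2 * \<rho> * Bb" by simp
        ultimately show ?thesis using TP(1)[of "b x'" "b y'"] by linarith
      qed
      have zx: "0 = (1/2) * (\<kappa> * (\<Sum>k\<in>UNIV. dir2 f x' (V k)) + (\<Sum>k\<in>UNIV. dir2 f x' (W1 k))) + dir1 f x' (b x')"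
      proof -
        have "diff_op a b f x' = 0" using f(1) Nx(1) by (simp add: harmonic_on_def)
        then show ?thesis
          unfolding diff_op_eq split[of x'] sum_rank_one[OF V] sum_rank_one[OF W1] by linarith
      qed
      have zy: "0 = (1/2) * (\<kappa> * (\<Sum>k\<in>UNIV. dir2 f y' (q k)) + (\<Sum>k\<in>UNIV. dir2 f y' (W2 k))) + dir1 f y' (b y')"
      proof -
        have "diff_op a b f y' = 0" using f(1) Ny(1) by (simp add: harmonic_on_def)
        then show ?thesis
          unfolding diff_op_eq split[of y'] sum_rank_one[OF q] sum_rank_one[OF W2] by linarith
      qed
      have \<kappa>: "\<kappa> \<ge> 7/8" using e by (simp add: \<kappa>_def)
      have s1': "\<kappa> * ((\<Sum>k\<in>UNIV. dir2 f x' (V k)) - (\<Sum>k\<in>UNIV. dir2 f y' (q k)))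
         \<le> \<kappa> * (C1 * X * (-2) + 2 * C2 * (2 * trace (a y0)))"
        using s1 \<kappa> by (intro mult_left_mono) auto
      have trR: "trace (R u) = trace (a u) - \<kappa> * trace (a y0)" for u
        by (simp add: R_def trace_def sum_subtractf sum_distrib_left)
      have arith: "0 = (1/2) * (A + A') + D \<Longrightarrow> 0 = (1/2) * (B + B') + D' \<Longrightarrow> A - B \<le> P \<Longrightarrow> A' \<le> p \<Longrightarrow> - B' \<le> p'
          \<Longrightarrow> D - D' \<le> d \<Longrightarrow> 0 \<le> (1/2) * (P + p + p') + d" for A A' B B' D D' P p p' d :: real
        by argo
      have "0 \<le> (1/2) * (\<kappa> * (C1 * X * (-2) + 2 * C2 * (2 * trace (a y0))) + (C1 * X * T x' + 2 * C2 * trace (R x'))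
         + (C1 * X * T y' + 2 * C2 * trace (R y'))) + (C1 * X * (1/4) + 4 * C2 * \<rho> * Bb)"
        using s1' by (intro arith[OF zx zy _ s2 s3 d]) (simp only: right_diff_distrib)
      also have "\<dots> = C1 * X * (- \<kappa> + (T x' + T y') / 2 + 1/4) + C2 * (trace (a x') + trace (a y')) + 4 * C2 * \<rho> * Bb"
        unfolding trR by (simp add: field_simps)
      also have "\<dots> \<le> C1 * (1/2) * (-3/8) + C2 * (2 * Tr) + 4 * C2 * \<rho> * Bb"
      proof -
        \<comment> \<open>The coupled part gives at most \<open>-7/8\<close>, the two residuals
          together at most \<open>1/4\<close>, and the drift \<open>1/4\<close>.\<close>
        have "- \<kappa> + (T x' + T y') / 2 + 1/4 \<le> -3/8" using \<kappa> Nx(2) Ny(2) by argo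
        then have "C1 * X * (- \<kappa> + (T x' + T y') / 2 + 1/4) \<le> C1 * X * (-3/8)"
          using C1 X by (intro mult_left_mono) auto
        moreover have "C1 * (1/2) \<le> C1 * X" using C1 X by (intro mult_left_mono) auto
        moreover have "C2 * (trace (a x') + trace (a y')) \<le> C2 * (2 * Tr)"
          using C2(1) Nx(4) Ny(4) by (intro mult_left_mono) auto
        ultimately show ?thesis by argo
      qed
      also have "\<dots> = C2 * (2 * Tr) + 4 * C2 * \<rho> * Bb - 9/8 * (C2 * (2 * Tr) + 4 * C2 * \<rho> * Bb + 1)"
        by (simp add: C1_def)
      also have "\<dots> < 0"
      proof -
        have "C2 * (2 * Tr) + 4 * C2 * \<rho> * Bb \<ge> 0" using C2(1) Tr \<rho>(1) Bb by simp
        then show ?thesis by argo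
      qed
      finally show False by simp
    qed
    moreover have "\<Phi> y0 y \<le> \<Phi> x' y'" using y \<rho>(1) by (intro mx) auto
    moreover have "\<tau> (y0 - y) \<bullet> \<tau> (y0 - y) = \<tau> (y - y0) \<bullet> \<tau> (y - y0)"
      by (simp add: linear_diff[OF \<tau>] inner_diff_left inner_diff_right inner_commute)
    ultimately show ?thesis by (simp add: \<Phi>_def)
  qed
  have "((\<lambda>y. C1 * (\<tau> (y - y0) \<bullet> \<tau> (y - y0)) powr (1/4) + C2 * ((y - y0) \<bullet> (y - y0))) \<longlongrightarrow>
      C1 * (\<tau> (y0 - y0) \<bullet> \<tau> (y0 - y0)) powr (1/4) + C2 * ((y0 - y0) \<bullet> (y0 - y0))) (nhds y0)"
    by (intro tendsto_intros tendsto_powr' bounded_linear.tendsto[OF linear_conv_bounded_linear[THEN iffD1, OF \<tau>]])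
      (auto intro: filterlim_ident)
  then have "\<forall>\<^sub>F y in nhds y0. C1 * (\<tau> (y - y0) \<bullet> \<tau> (y - y0)) powr (1/4) + C2 * ((y - y0) \<bullet> (y - y0)) < \<epsilon>"
    by (rule order_tendstoD) (simp add: linear_0[OF \<tau>] \<open>\<epsilon> > 0\<close>)
  then obtain d where d: "d > 0"
    "\<And>y. dist y y0 < d \<Longrightarrow> C1 * (\<tau> (y - y0) \<bullet> \<tau> (y - y0)) powr (1/4) + C2 * ((y - y0) \<bullet> (y - y0)) < \<epsilon>"
    by (auto simp: eventually_nhds_metric)
  show ?thesis
  proof (rule that[of "min d \<rho>"])
    show "min d \<rho> > 0" using d \<rho> by simp
    show "ball y0 (min d \<rho>) \<subseteq> S" using near(1) by (auto simp: dist_commute)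
    fix f y assume f: "harmonic_on S a b f" "\<And>x. x \<in> S \<Longrightarrow> \<bar>f x\<bar> \<le> B" and y: "dist y y0 < min d \<rho>"
    \<comment> \<open>The estimate \<open>main\<close> is one-sided; applied to \<open>- f\<close>
      it gives the other side with the same constants.\<close>
    have "harmonic_on S a b (\<lambda>x. - f x)" using harmonic_on_lincomb[OF S f(1) f(1), of "-1" 0] by simp
    then have "- f y0 - - f y < \<epsilon>" using main[of "\<lambda>x. - f x" y] f(2) y d(2)[of y] by simp
    moreover have "f y0 - f y < \<epsilon>" using main[OF f, of y] y d(2)[of y] by simp
    ultimately show "\<bar>f y - f y0\<bar> < \<epsilon>" by simp
  qed
qed

section \<open>Propagation of smallness\<close>

text \<open>Again \<open>second_derivative_test\<close> on lines, applied to the negative of the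
  difference; the right-hand sides are the derivatives of the Gaussian barrier.\<close>

lemma barrier_minimum:
  fixes f :: "real^'n \<Rightarrow> real"
  assumes f: "open S" "smooth_on S f" "x \<in> S"
    and min: "\<epsilon> > 0" "\<And>u. dist u x < \<epsilon> \<Longrightarrow>
      f x - c * exp (- \<alpha> * ((x - z) \<bullet> (x - z))) \<le> f u - c * exp (- \<alpha> * ((u - z) \<bullet> (u - z)))"
    and E: "E = exp (- \<alpha> * ((x - z) \<bullet> (x - z)))"
  shows "dir1 f x p = - 2 * c * \<alpha> * E * ((x - z) \<bullet> p)"
    and "dir2 f x p \<ge> c * E * (4 * \<alpha>\<^sup>2 * ((x - z) \<bullet> p)\<^sup>2 - 2 * \<alpha> * (p \<bullet> p))"
proof -
  define M where "M s = (x - z) \<bullet> (x - z) + 2 * s * ((x - z) \<bullet> p) + s\<^sup>2 * (p \<bullet> p)" for s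
  define M' where "M' s = 2 * ((x - z) \<bullet> p) + 2 * s * (p \<bullet> p)" for s
  define F where "F s = - (f (x + s *\<^sub>R p) - c * exp (- \<alpha> * M s))" for s
  define F1 where "F1 s = - (dir1 f (x + s *\<^sub>R p) p - c * (exp (- \<alpha> * M s) * (- \<alpha> * M' s)))" for s
  define F2 where "F2 = - (dir2 f x p - c * (E * (- \<alpha> * (2 * ((x - z) \<bullet> p))) * (- \<alpha> * (2 * ((x - z) \<bullet> p)))
      + E * (- \<alpha> * (2 * (p \<bullet> p)))))"
  have M: "(x + s *\<^sub>R p - z) \<bullet> (x + s *\<^sub>R p - z) = M s" for s
  proof -
    have "x + s *\<^sub>R p - z = (x - z) + s *\<^sub>R p" by simp
    then show ?thesis
      by (simp only: M_def inner_add_left inner_add_right inner_commute[of p "x - z"] power2_eq_square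
          inner_scaleR_left inner_scaleR_right) (simp add: algebra_simps)
  qed
  have M0: "M 0 = (x - z) \<bullet> (x - z)" "M' 0 = 2 * ((x - z) \<bullet> p)" by (simp_all add: M_def M'_def)
  have "\<forall>\<^sub>F s in nhds 0. x + s *\<^sub>R p \<in> S \<inter> ball x \<epsilon>"
    by (rule eventually_along_line) (use f min(1) in auto)
  then obtain \<delta> where \<delta>: "\<delta> > 0" "\<And>s. \<bar>s\<bar> < \<delta> \<Longrightarrow> x + s *\<^sub>R p \<in> S \<inter> ball x \<epsilon>"
    by (auto simp: eventually_nhds_metric dist_real_def)
  have dM: "(M has_real_derivative M' s) (at s)" for s
    unfolding M_def M'_def by (auto intro!: derivative_eq_intros)
  have dF: "(F has_real_derivative F1 s) (at s)" if "\<bar>s\<bar> < \<delta>" for s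
  proof -
    have "x + s *\<^sub>R p \<in> S" using \<delta>(2)[OF that] by auto
    note d = has_real_derivative_along_line[OF f(2) this]
    show ?thesis unfolding F_def[abs_def] F1_def by (auto intro!: derivative_eq_intros d dM)
  qed
  have dF1: "(F1 has_real_derivative F2) (at 0)"
  proof -
    have dM': "(M' has_real_derivative 2 * (p \<bullet> p)) (at 0)"
      unfolding M'_def by (auto intro!: derivative_eq_intros)
    show ?thesis unfolding F1_def[abs_def] F2_def E
      by (auto intro!: derivative_eq_intros has_real_derivative_dir1_along_line[OF f(2,3)] dM dM'
        simp: M0) (simp add: right_diff_distrib left_diff_distrib mult_ac)
  qed
  have "F s \<le> F 0" if "\<bar>s\<bar> < \<delta>" for s
    using \<delta>(2)[OF that] min(2)[of "x + s *\<^sub>R p"] M[of s] M[of 0] by (simp add: F_def dist_commute)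
  note T = second_derivative_test[OF \<delta>(1) dF dF1 this]
  show "dir1 f x p = - 2 * c * \<alpha> * E * ((x - z) \<bullet> p)"
    using T(1) unfolding F1_def M0 E by (simp add: mult_ac)
  have "F2 = - (dir2 f x p - c * E * (4 * \<alpha>\<^sup>2 * ((x - z) \<bullet> p)\<^sup>2 - 2 * \<alpha> * (p \<bullet> p)))"
    unfolding F2_def by (simp add: power2_eq_square right_diff_distrib)
  with T(2) show "dir2 f x p \<ge> c * E * (4 * \<alpha>\<^sup>2 * ((x - z) \<bullet> p)\<^sup>2 - 2 * \<alpha> * (p \<bullet> p))" by simp
qed

lemma elliptic_on_compact_bounds:
  fixes S :: "(real^'n) set"
  assumes ell: "elliptic_on S a b" and C: "compact C" "C \<subseteq> S" "C \<noteq> {}"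
  obtains \<theta> T B where "\<theta> > 0" "\<And>y w. y \<in> C \<Longrightarrow> \<theta> * (w \<bullet> w) \<le> w \<bullet> (a y *v w)"
    "T > 0" "\<And>y. y \<in> C \<Longrightarrow> trace (a y) \<le> T" "B > 0" "\<And>y. y \<in> C \<Longrightarrow> norm (b y) \<le> B"
proof -
  have ca: "continuous_on C a" and cb: "continuous_on C b"
    using ell C(2) by (auto simp: elliptic_on_def intro: continuous_on_subset)
  have "compact ((\<lambda>y. trace (a y)) ` C)"
    unfolding trace_def by (intro compact_continuous_image continuous_intros ca C(1))
  then obtain T where T: "T > 0" "\<And>y. y \<in> C \<Longrightarrow> \<bar>trace (a y)\<bar> \<le> T"
    using bounded_pos[of "(\<lambda>y. trace (a y)) ` C"] compact_imp_bounded by auto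
  have "compact (b ` C)" by (intro compact_continuous_image cb C(1))
  then obtain B where B: "B > 0" "\<And>y. y \<in> C \<Longrightarrow> norm (b y) \<le> B"
    using bounded_pos[of "b ` C"] compact_imp_bounded by auto
  have "\<exists>u\<in>C \<times> sphere 0 1. \<forall>z\<in>C \<times> sphere 0 1. snd u \<bullet> (a (fst u) *v snd u) \<le> snd z \<bullet> (a (fst z) *v snd z)"
  proof (rule continuous_attains_inf)
    show "compact (C \<times> sphere (0 :: real^'n) 1)" using C by (intro compact_Times) auto
    have "axis undefined 1 \<in> sphere (0 :: real^'n) 1" by simp
    then show "C \<times> sphere (0 :: real^'n) 1 \<noteq> {}" using C by blast
    show "continuous_on (C \<times> sphere 0 1) (\<lambda>z. snd z \<bullet> (a (fst z) *v snd z))"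
      unfolding inner_vec_def matrix_vector_mult_def
      by (simp, intro continuous_intros continuous_on_compose2[OF ca]) auto
  qed
  then obtain y0 w0 where y0: "y0 \<in> C" "norm w0 = 1"
    and min: "\<And>y w. y \<in> C \<Longrightarrow> norm w = 1 \<Longrightarrow> w0 \<bullet> (a y0 *v w0) \<le> w \<bullet> (a y *v w)" by force
  define \<theta> where "\<theta> = w0 \<bullet> (a y0 *v w0)"
  have "\<theta> > 0"
  proof -
    have "y0 \<in> S" "w0 \<noteq> 0" using y0 C(2) by auto
    then show ?thesis unfolding \<theta>_def using ell by (simp add: elliptic_on_def)
  qed
  moreover have "\<theta> * (w \<bullet> w) \<le> w \<bullet> (a y *v w)" if "y \<in> C" for y w
  proof (cases "w = 0")
    case False
    let ?v = "(1 / norm w) *\<^sub>R w"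
    have "\<theta> \<le> ?v \<bullet> (a y *v ?v)" unfolding \<theta>_def using False that by (intro min) simp_all
    also have "\<dots> = (w \<bullet> (a y *v w)) / (w \<bullet> w)"
      by (simp add: matrix_vector_mult_scaleR dot_square_norm power2_eq_square)
    finally show ?thesis using False by (simp add: field_simps)
  qed simp
  moreover have "trace (a y) \<le> T" if "y \<in> C" for y using T(2)[OF that] by simp
  ultimately show ?thesis using that T(1) B by blast
qed

text \<open>A qualitative Harnack principle, proved by contraposition. If
  \<open>f y1 \<ge> \<epsilon>\<close>, equicontinuity gives \<open>f \<ge> \<epsilon> / 2\<close>
  on a ball around \<open>y1\<close> whose radius is the same for all \<open>f\<close>, and Hopf's
  exponential barrier on the surrounding annulus carries a lower bound out to
  \<open>y0\<close>.\<close>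

lemma harmonic_smallness_chart:
  fixes S :: "(real^'n) set"
  assumes ell: "elliptic_on S a b" and R: "cball y1 R \<subseteq> S" "dist y0 y1 < R" and "\<epsilon> > 0"
  obtains \<delta> where "\<delta> > 0"
    "\<And>f. harmonic_on S a b f \<Longrightarrow> (\<And>x. x \<in> S \<Longrightarrow> 0 \<le> f x \<and> f x \<le> B) \<Longrightarrow> f y0 < \<delta> \<Longrightarrow> f y1 < \<epsilon>"
proof -
  have "R > 0" using R(2) zero_le_dist[of y0 y1] by linarith
  have S: "open S" and y1: "y1 \<in> S" and sym: "\<And>y. y \<in> S \<Longrightarrow> transpose (a y) = a y"
    and pos: "\<And>y w. y \<in> S \<Longrightarrow> w \<noteq> 0 \<Longrightarrow> w \<bullet> (a y *v w) > 0"
    using ell R(1) \<open>R > 0\<close> by (auto simp: elliptic_on_def)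
  obtain \<eta>0 where \<eta>0: "\<eta>0 > 0"
    "\<And>f y. harmonic_on S a b f \<Longrightarrow> (\<And>x. x \<in> S \<Longrightarrow> \<bar>f x\<bar> \<le> B) \<Longrightarrow> dist y y1 < \<eta>0 \<Longrightarrow> \<bar>f y - f y1\<bar> < \<epsilon> / 2"
    using harmonic_equicontinuous[OF ell y1, of "\<epsilon> / 2" B] \<open>\<epsilon> > 0\<close> by (metis half_gt_zero)
  define \<eta> where "\<eta> = \<eta>0 / 2"
  have \<eta>: "\<eta> > 0" using \<eta>0(1) by (simp add: \<eta>_def)
  obtain \<theta> T Bb where \<theta>: "\<theta> > 0" "\<And>y w. y \<in> cball y1 R \<Longrightarrow> \<theta> * (w \<bullet> w) \<le> w \<bullet> (a y *v w)"
    and T: "T > 0" "\<And>y. y \<in> cball y1 R \<Longrightarrow> trace (a y) \<le> T"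
    and Bb: "Bb > 0" "\<And>y. y \<in> cball y1 R \<Longrightarrow> norm (b y) \<le> Bb"
    using elliptic_on_compact_bounds[OF ell compact_cball R(1)] \<open>R > 0\<close> by (metis cball_eq_empty less_le_not_le)
  \<comment> \<open>Makes the Gaussian strictly subharmonic at distance at least
    \<open>\<eta>\<close> from \<open>y1\<close>: there the operator applied to it is at least
    \<open>\<alpha>\<close> times its value times the expression in the next claim, which this
    choice sets to 1.\<close>
  define \<alpha> where "\<alpha> = (T + 2 * R * Bb + 1) / (2 * \<theta> * \<eta>\<^sup>2)"
  have \<alpha>: "\<alpha> > 0" "2 * \<alpha> * \<theta> * \<eta>\<^sup>2 - T - 2 * R * Bb = 1"
  proof -
    show "\<alpha> > 0" using T(1) \<open>R > 0\<close> Bb(1) \<theta>(1) \<eta> by (auto simp: \<alpha>_def add_pos_pos)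
    have "\<alpha> * (2 * \<theta> * \<eta>\<^sup>2) = T + 2 * R * Bb + 1" using \<theta>(1) \<eta> by (simp add: \<alpha>_def)
    moreover have "2 * \<alpha> * \<theta> * \<eta>\<^sup>2 = \<alpha> * (2 * \<theta> * \<eta>\<^sup>2)" by simp
    ultimately show "2 * \<alpha> * \<theta> * \<eta>\<^sup>2 - T - 2 * R * Bb = 1" by linarith
  qed
  define c where "c = \<epsilon> / 2"
  have c: "c > 0" using \<open>\<epsilon> > 0\<close> by (simp add: c_def)
  define w where "w y = exp (- \<alpha> * ((y - y1) \<bullet> (y - y1))) - exp (- \<alpha> * R\<^sup>2)" for y
  have w1: "w y \<le> 1" for y
  proof -
    have "exp (- \<alpha> * ((y - y1) \<bullet> (y - y1))) \<le> 1" using \<alpha>(1) by simp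
    then show ?thesis unfolding w_def using exp_gt_zero[of "- \<alpha> * R\<^sup>2"] by linarith
  qed
  have wpos: "w y0 > 0"
  proof -
    have "(y0 - y1) \<bullet> (y0 - y1) = (dist y0 y1)\<^sup>2" by (simp add: dot_square_norm dist_norm)
    also have "\<dots> < R\<^sup>2" using R(2) by (intro power_strict_mono) auto
    finally show ?thesis using \<alpha>(1) by (simp add: w_def)
  qed
  \<comment> \<open>The \<open>min\<close> with 1 covers the case that \<open>y0\<close> already
    lies in the inner ball, where the lower bound is \<open>c\<close> itself.\<close>
  have key: "f y0 \<ge> c * min 1 (w y0)" if f: "harmonic_on S a b f" "\<And>x. x \<in> S \<Longrightarrow> 0 \<le> f x \<and> f x \<le> B" "f y1 \<ge> \<epsilon>" for f
  proof -
    have fS: "smooth_on S f" using f(1) by (simp add: harmonic_on_def)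
    have fb: "\<bar>f x\<bar> \<le> B" if "x \<in> S" for x using f(2)[OF that] by simp
    have inner: "f y \<ge> c" if "dist y y1 \<le> \<eta>" for y
    proof -
      have "dist y y1 < \<eta>0" using that \<eta>0(1) by (simp add: \<eta>_def)
      then have "\<bar>f y - f y1\<bar> < \<epsilon> / 2" using \<eta>0(2)[OF f(1) fb] by blast
      then show ?thesis using f(3) unfolding c_def by linarith
    qed
    show ?thesis
    proof (cases "dist y0 y1 \<le> \<eta>")
      case True
      have "c * min 1 (w y0) \<le> c * 1" using c by (intro mult_left_mono) auto
      with inner[OF True] show ?thesis by simp
    next
      case False
      define A where "A = cball y1 R - ball y1 \<eta>"
      have y0A: "y0 \<in> A" using False R(2) by (auto simp: A_def dist_commute)
      have AS: "A \<subseteq> S" using R(1) by (auto simp: A_def)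
      have "compact A" unfolding A_def by (intro compact_diff) auto
      moreover have "continuous_on A (\<lambda>y. f y - c * w y)"
        unfolding w_def
        by (intro continuous_intros continuous_on_subset[OF smooth_on_continuous[OF fS] AS])
      ultimately obtain x where x: "x \<in> A" "\<And>y. y \<in> A \<Longrightarrow> f x - c * w x \<le> f y - c * w y"
        using continuous_attains_inf[of A "\<lambda>y. f y - c * w y"] y0A by auto
      have xS: "x \<in> S" and xR: "x \<in> cball y1 R" using x(1) AS by (auto simp: A_def)
      \<comment> \<open>On the outer sphere \<open>w\<close> vanishes and \<open>f\<close> is
        nonnegative; on the inner sphere \<open>f \<ge> c \<ge> c * w\<close>. A negative minimum
        would thus be interior, where harmonicity of \<open>f\<close> contradicts strict
        subharmonicity of the barrier.\<close>
      have "f x - c * w x \<ge> 0"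
      proof (rule ccontr)
        assume neg: "\<not> f x - c * w x \<ge> 0"
        have sq: "(x - y1) \<bullet> (x - y1) = (dist x y1)\<^sup>2" by (simp add: dot_square_norm dist_norm)
        have "dist x y1 \<noteq> R"
        proof
          assume "dist x y1 = R"
          then have "w x = 0" by (simp add: w_def sq)
          then show False using neg f(2)[OF xS] by simp
        qed
        moreover have "dist x y1 \<noteq> \<eta>"
        proof
          assume "dist x y1 = \<eta>"
          then have "f x \<ge> c" by (intro inner) simp
          moreover have "c * w x \<le> c * 1" using c w1 by (intro mult_left_mono) auto
          ultimately show False using neg by simp
        qed
        ultimately have d: "\<eta> < dist x y1" "dist x y1 < R"
          using x(1) by (auto simp: A_def dist_commute)
        define \<epsilon>' where "\<epsilon>' = min (dist x y1 - \<eta>) (R - dist x y1)"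
        have \<epsilon>': "\<epsilon>' > 0" using d by (simp add: \<epsilon>'_def)
        have "f x - c * w x \<le> f u - c * w u" if "dist u x < \<epsilon>'" for u
          using that dist_triangle[of u y1 x] dist_triangle[of x y1 u]
          by (intro x(2)) (auto simp: A_def \<epsilon>'_def dist_commute)
        then have locmin: "f x - c * exp (- \<alpha> * ((x - y1) \<bullet> (x - y1))) \<le> f u - c * exp (- \<alpha> * ((u - y1) \<bullet> (u - y1)))"
          if "dist u x < \<epsilon>'" for u
          using that by (fastforce simp: w_def right_diff_distrib)
        define E where "E = exp (- \<alpha> * ((x - y1) \<bullet> (x - y1)))"
        note BM = barrier_minimum[OF S fS xS \<epsilon>' locmin E_def]
        have nonneg: "0 \<le> v \<bullet> (a x *v v)" for v
          using pos[OF xS, of v] by (cases "v = 0") auto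
        obtain V :: "'n \<Rightarrow> real^'n" where V: "\<And>i j. a x $ i $ j = (\<Sum>k\<in>UNIV. V k $ i * V k $ j)"
          using psd_decomposition[OF sym[OF xS] nonneg] by blast
        have q: "(\<Sum>k\<in>UNIV. ((x - y1) \<bullet> V k)\<^sup>2) = (x - y1) \<bullet> (a x *v (x - y1))"
        proof -
          define z where "z = x - y1"
          have "z \<bullet> (a x *v z) = (\<Sum>i\<in>UNIV. \<Sum>j\<in>UNIV. \<Sum>k\<in>UNIV. (z $ i * V k $ i) * (z $ j * V k $ j))"
            by (simp add: inner_vec_def matrix_vector_mult_def V sum_distrib_left sum_distrib_right mult_ac)
          also have "\<dots> = (\<Sum>k\<in>UNIV. \<Sum>i\<in>UNIV. \<Sum>j\<in>UNIV. (z $ i * V k $ i) * (z $ j * V k $ j))"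
            by (subst sum.swap[of _ _ "UNIV :: 'n set"], subst (2) sum.swap) (intro sum.cong refl sum.swap)
          also have "\<dots> = (\<Sum>k\<in>UNIV. (z \<bullet> V k)\<^sup>2)"
            by (simp add: inner_vec_def power2_eq_square sum_product)
          finally show ?thesis by (simp add: z_def)
        qed
        have E: "E > 0" by (simp add: E_def)
        have "(\<Sum>k\<in>UNIV. dir2 f x (V k))
           \<ge> (\<Sum>k\<in>UNIV. c * E * (4 * \<alpha>\<^sup>2 * ((x - y1) \<bullet> V k)\<^sup>2 - 2 * \<alpha> * (V k \<bullet> V k)))"
          by (intro sum_mono BM(2))
        also have "(\<Sum>k\<in>UNIV. c * E * (4 * \<alpha>\<^sup>2 * ((x - y1) \<bullet> V k)\<^sup>2 - 2 * \<alpha> * (V k \<bullet> V k)))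
           = c * E * (4 * \<alpha>\<^sup>2 * (\<Sum>k\<in>UNIV. ((x - y1) \<bullet> V k)\<^sup>2) - 2 * \<alpha> * (\<Sum>k\<in>UNIV. V k \<bullet> V k))"
          by (simp only: sum_distrib_left[symmetric] sum_subtractf)
        also have "\<dots> = c * E * (4 * \<alpha>\<^sup>2 * ((x - y1) \<bullet> (a x *v (x - y1))) - 2 * \<alpha> * trace (a x))"
          by (simp only: q sum_norm_rank_one[OF V])
        finally have s: "(\<Sum>k\<in>UNIV. dir2 f x (V k))
          \<ge> c * E * (4 * \<alpha>\<^sup>2 * ((x - y1) \<bullet> (a x *v (x - y1))) - 2 * \<alpha> * trace (a x))" .
        have "\<theta> * \<eta>\<^sup>2 \<le> \<theta> * ((x - y1) \<bullet> (x - y1))"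
          using d(1) \<eta> \<theta>(1) unfolding sq by (intro mult_left_mono power_mono) auto
        also have "\<dots> \<le> (x - y1) \<bullet> (a x *v (x - y1))" by (rule \<theta>(2)[OF xR])
        finally have "4 * \<alpha>\<^sup>2 * (\<theta> * \<eta>\<^sup>2) \<le> 4 * \<alpha>\<^sup>2 * ((x - y1) \<bullet> (a x *v (x - y1)))"
          by (intro mult_left_mono) auto
        moreover have "2 * \<alpha> * trace (a x) \<le> 2 * \<alpha> * T" using T(2)[OF xR] \<alpha>(1) by simp
        ultimately have "c * E * (4 * \<alpha>\<^sup>2 * ((x - y1) \<bullet> (a x *v (x - y1))) - 2 * \<alpha> * trace (a x))
          \<ge> c * E * (4 * \<alpha>\<^sup>2 * (\<theta> * \<eta>\<^sup>2) - 2 * \<alpha> * T)"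
          using c E by (intro mult_left_mono) auto
        with s have s': "(\<Sum>k\<in>UNIV. dir2 f x (V k)) \<ge> c * E * (4 * \<alpha>\<^sup>2 * (\<theta> * \<eta>\<^sup>2) - 2 * \<alpha> * T)" by linarith
        have "(x - y1) \<bullet> b x \<le> norm (x - y1) * norm (b x)" by (rule norm_cauchy_schwarz)
        also have "\<dots> \<le> R * Bb"
          using d(2) Bb(2)[OF xR] \<open>R > 0\<close> by (intro mult_mono) (auto simp: dist_norm)
        finally have "c * E * (2 * \<alpha> * ((x - y1) \<bullet> b x)) \<le> c * E * (2 * \<alpha> * (R * Bb))"
          using c E \<alpha>(1) by (intro mult_left_mono) auto
        then have d1: "dir1 f x (b x) \<ge> - (c * E * (2 * \<alpha> * (R * Bb)))"
          using BM(1)[of "b x"] by (simp add: mult_ac)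
        have "0 = (1/2) * (\<Sum>k\<in>UNIV. dir2 f x (V k)) + dir1 f x (b x)"
        proof -
          have "diff_op a b f x = 0" using f(1) xS by (simp add: harmonic_on_def)
          then show ?thesis unfolding diff_op_eq sum_rank_one[OF V] by linarith
        qed
        with s' d1 have "0 \<ge> (1/2) * (c * E * (4 * \<alpha>\<^sup>2 * (\<theta> * \<eta>\<^sup>2) - 2 * \<alpha> * T)) - c * E * (2 * \<alpha> * (R * Bb))"
          by linarith
        also have "(1/2) * (c * E * (4 * \<alpha>\<^sup>2 * (\<theta> * \<eta>\<^sup>2) - 2 * \<alpha> * T)) - c * E * (2 * \<alpha> * (R * Bb))
          = c * E * \<alpha> * (2 * \<alpha> * \<theta> * \<eta>\<^sup>2 - T - 2 * R * Bb)"
          by (simp add: algebra_simps power2_eq_square)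
        also have "\<dots> = c * E * \<alpha>" by (simp only: \<alpha>(2) mult_1_right)
        finally show False using c E \<alpha>(1) by (simp add: mult_le_0_iff)
      qed
      then have "f y0 \<ge> c * w y0" using x(2)[OF y0A] by simp
      moreover have "c * min 1 (w y0) \<le> c * w y0" using c by (intro mult_left_mono) auto
      ultimately show ?thesis by simp
    qed
  qed
  show ?thesis
  proof (rule that[of "c * min 1 (w y0)"])
    show "c * min 1 (w y0) > 0" using c wpos by simp
    show "f y1 < \<epsilon>" if "harmonic_on S a b f" "\<And>x. x \<in> S \<Longrightarrow> 0 \<le> f x \<and> f x \<le> B" "f y0 < c * min 1 (w y0)" for f
      using key[of f] that by (meson not_le)
  qed
qed

section \<open>Elliptic operators on manifolds\<close>

lemma C_k_on_inverse: "C_k_on k {0<..} (inverse :: real \<Rightarrow> real)"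
proof (induction k)
  case 0
  show ?case by (auto intro!: continuous_intros)
next
  case (Suc k)
  have "C_k_on k {0<..} (\<lambda>x :: real. - (inverse x * inverse x * v))" for v
    by (intro C_k_on_linear_compose[OF bounded_linear_minus[OF bounded_linear_ident]]
        C_k_on_bilinear[OF bounded_bilinear_mult] C_k_on_const Suc) auto
  then show ?case
    by (intro C_k_on_SucI[where D="\<lambda>x v. - (inverse x * inverse x * v)"])
      (auto intro!: derivative_eq_intros simp: mult_ac)
qed

definition smooth_step :: "real \<Rightarrow> real" where
  "smooth_step t = flat 1 t * inverse (flat 1 t + flat 1 (1 - t))"

lemma flat_1: "flat 1 t = (if t > 0 then exp (- (1 / t)) else 0)"
  by (simp add: flat_def)

lemma smooth_step_pos: "flat 1 t + flat 1 (1 - t) > 0"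
  by (auto simp: flat_1 add_pos_nonneg)

lemma smooth_on_smooth_step: "smooth_on UNIV smooth_step"
proof -
  have aff: "smooth_on UNIV (\<lambda>t :: real. 1 - t)"
    by (intro smooth_on_diff smooth_on_const) (auto simp: smooth_on_def intro!: C_k_on_bounded_linear[OF bounded_linear_ident])
  have "smooth_on UNIV (\<lambda>t. flat 1 (1 - t))"
    by (rule smooth_on_compose[OF _ smooth_on_flat aff]) auto
  then have "smooth_on UNIV (\<lambda>t. flat 1 t + flat 1 (1 - t))"
    by (intro smooth_on_add smooth_on_flat) auto
  then have "smooth_on UNIV (\<lambda>t. inverse (flat 1 t + flat 1 (1 - t)))"
    by (rule smooth_on_compose[where T="{0<..}" and F=inverse, rotated 2])
      (auto simp: smooth_on_def C_k_on_inverse smooth_step_pos)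
  then show ?thesis unfolding smooth_step_def[abs_def]
    by (intro smooth_on_bilinear[OF bounded_bilinear_mult] smooth_on_flat) auto
qed

lemma smooth_step_0: "t \<le> 0 \<Longrightarrow> smooth_step t = 0"
  by (simp add: smooth_step_def flat_1)

lemma smooth_step_1: "t \<ge> 1 \<Longrightarrow> smooth_step t = 1"
  by (simp add: smooth_step_def flat_1)

lemma smooth_step_bounds: "0 \<le> smooth_step t" "smooth_step t \<le> 1"
  using smooth_step_pos[of t] by (auto simp: smooth_step_def flat_1 field_simps)

section \<open>Smooth functions and the operator on the manifold\<close>

locale elliptic_manifold =
  fixes A :: "('m::{t2_space, second_countable_topology}, 'n::finite) chart set"
    and L :: "('m \<Rightarrow> real) \<Rightarrow> 'm \<Rightarrow> real"
  assumes atlas: "smooth_atlas A" and elliptic: "elliptic_diffusion_operator A L"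
begin

lemma chart_at: obtains U c where "(U, c) \<in> A" "x \<in> U"
proof -
  have "x \<in> (\<Union>(U, c)\<in>A. U)" using atlas by (simp add: smooth_atlas_def)
  then show ?thesis using that by auto
qed

lemma chart:
  assumes "(U, c) \<in> A"
  shows "open U" "open (c ` U)" "homeomorphism U (c ` U) c (inv_into U c)"
  using assms atlas unfolding smooth_atlas_def by blast+

lemma chart_transition:
  assumes "(U, c) \<in> A" "(V, d) \<in> A"
  shows "smooth_on (c ` (U \<inter> V)) (\<lambda>y. d (inv_into U c y))"
proof -
  have "\<forall>(U, c)\<in>A. \<forall>(V, d)\<in>A. smooth_on (c ` (U \<inter> V)) (d \<circ> inv_into U c)"
    using atlas unfolding smooth_atlas_def by blast
  then show ?thesis using assms unfolding o_def by blast
qed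

lemma chart_inv [simp]:
  assumes "(U, c) \<in> A"
  shows "x \<in> U \<Longrightarrow> inv_into U c (c x) = x" "y \<in> c ` U \<Longrightarrow> c (inv_into U c y) = y"
    "y \<in> c ` U \<Longrightarrow> inv_into U c y \<in> U"
  using chart(3)[OF assms] by (auto simp: homeomorphism_def inv_into_into f_inv_into_f)

lemma chart_image_open:
  assumes "(U, c) \<in> A" "open V"
  shows "open (c ` (U \<inter> V))"
proof -
  have "openin (top_of_set U) (U \<inter> V)" using assms(2) by auto
  then have "openin (top_of_set (c ` U)) (c ` (U \<inter> V))"
    by (rule homeomorphism_imp_open_map[OF chart(3)[OF assms(1)]])
  then show ?thesis using chart(2)[OF assms(1)] openin_open_trans by blast
qed

lemma smooth_fun_chart:
  "smooth_fun A f \<Longrightarrow> (U, c) \<in> A \<Longrightarrow> smooth_on (c ` U) (\<lambda>y. f (inv_into U c y))"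
  unfolding smooth_fun_def o_def by blast

lemma smooth_funI:
  "(\<And>U c. (U, c) \<in> A \<Longrightarrow> smooth_on (c ` U) (\<lambda>y. f (inv_into U c y))) \<Longrightarrow> smooth_fun A f"
  unfolding smooth_fun_def o_def by blast

lemma smooth_fun_const: "smooth_fun A (\<lambda>x. k)"
  using chart(2) by (intro smooth_funI smooth_on_const)

lemma smooth_fun_lincomb:
  "smooth_fun A f \<Longrightarrow> smooth_fun A g \<Longrightarrow> smooth_fun A (\<lambda>x. k * f x + l * g x)"
  by (rule smooth_funI, rule smooth_on_lincomb) (simp_all add: smooth_fun_chart chart(2))

lemma smooth_fun_mult: "smooth_fun A f \<Longrightarrow> smooth_fun A g \<Longrightarrow> smooth_fun A (\<lambda>x. f x * g x)"
  by (rule smooth_funI, rule smooth_on_bilinear[OF bounded_bilinear_mult]) (simp_all add: smooth_fun_chart chart(2))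

lemma smooth_fun_prod: "(\<And>i. i \<in> I \<Longrightarrow> smooth_fun A (f i)) \<Longrightarrow> smooth_fun A (\<lambda>x. \<Prod>i\<in>I. f i x)"
  by (rule smooth_funI, rule smooth_on_prod) (simp_all add: smooth_fun_chart chart(2))

lemma smooth_fun_diff: "smooth_fun A f \<Longrightarrow> smooth_fun A g \<Longrightarrow> smooth_fun A (\<lambda>x. f x - g x)"
  using smooth_fun_lincomb[of f g 1 "-1"] by simp

lemma smooth_fun_continuous:
  assumes "smooth_fun A f" shows "continuous_on UNIV f"
proof -
  have "isCont f x" for x
  proof -
    obtain U c where U: "(U, c) \<in> A" "x \<in> U" by (rule chart_at)
    have "continuous_on (c ` U) (\<lambda>y. f (inv_into U c y))" "continuous_on U c"
      using smooth_on_continuous[OF smooth_fun_chart[OF assms U(1)]] chart(3)[OF U(1)]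
      by (auto simp: homeomorphism_def)
    then have "continuous_on U (\<lambda>x. f (inv_into U c (c x)))"
      by (rule continuous_on_compose2) auto
    then have "continuous_on U f"
      by (rule continuous_on_eq) (use U in simp)
    then show ?thesis using U chart(1)[OF U(1)] continuous_on_eq_continuous_at by blast
  qed
  then show ?thesis by (simp add: continuous_at_imp_continuous_on)
qed

lemma smooth_fun_compose:
  assumes F: "smooth_map A F" and f: "smooth_fun A f"
  shows "smooth_fun A (f \<circ> F)"
proof (rule smooth_funI)
  fix U c assume U: "(U, c) \<in> A"
  show "smooth_on (c ` U) (\<lambda>y. (f \<circ> F) (inv_into U c y))"
  proof (rule smooth_on_local)
    fix y assume "y \<in> c ` U"
    then obtain x where x: "x \<in> U" "y = c x" by blast
    obtain V d where V: "(V, d) \<in> A" "F x \<in> V" by (rule chart_at)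
    let ?T = "c ` (U \<inter> F -` V)"
    have "open (F -` V)"
      using F chart(1)[OF V(1)] by (auto simp: smooth_map_def intro: open_vimage)
    then have T: "open ?T" by (rule chart_image_open[OF U])
    have "\<forall>(U, c)\<in>A. \<forall>(V, d)\<in>A. smooth_on (c ` (U \<inter> F -` V)) (d \<circ> F \<circ> inv_into U c)"
      using F unfolding smooth_map_def by blast
    then have "smooth_on ?T (\<lambda>y. d (F (inv_into U c y)))"
      using U V unfolding o_def by blast
    then have "smooth_on ?T (\<lambda>y. f (inv_into V d (d (F (inv_into U c y)))))"
      by (rule smooth_on_compose[OF T smooth_fun_chart[OF f V(1)]]) (use U in auto)
    then have "smooth_on ?T (\<lambda>y. (f \<circ> F) (inv_into U c y))"
      by (rule smooth_on_cong[OF T, rotated]) (use U V in auto)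
    then show "\<exists>T. open T \<and> y \<in> T \<and> smooth_on T (\<lambda>y. (f \<circ> F) (inv_into U c y))"
      using T x V by blast
  qed
qed

lemma operator_in_chart:
  assumes "(U, c) \<in> A"
  obtains a b where "elliptic_on (c ` U) a b"
    "\<And>f x. smooth_fun A f \<Longrightarrow> x \<in> U \<Longrightarrow> L f x = diff_op a b (\<lambda>y. f (inv_into U c y)) (c x)"
proof -
  obtain a b where "local_coefficients A L (U, c) a b"
    using elliptic assms unfolding elliptic_diffusion_operator_def by blast
  then have lc: "smooth_on (c ` U) a" "smooth_on (c ` U) b"
     "\<forall>y\<in>c ` U. transpose (a y) = a y \<and> (\<forall>w. w \<noteq> 0 \<longrightarrow> w \<bullet> (a y *v w) > 0)"
     "\<And>f x. smooth_fun A f \<Longrightarrow> x \<in> U \<Longrightarrow> L f x = diff_op a b (f \<circ> inv_into U c) (c x)"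
    unfolding local_coefficients_def diff_op_def by auto
  show ?thesis
  proof (rule that)
    show "elliptic_on (c ` U) a b"
      using lc(3) chart(2)[OF assms] smooth_on_continuous[OF lc(1)] smooth_on_continuous[OF lc(2)]
      by (auto simp: elliptic_on_def)
  qed (use lc(4) in \<open>simp add: o_def\<close>)
qed

text \<open>\<open>L\<close> is a priori just a map on functions. Its locality comes from the chart
  formula, whose iterated partial derivatives see only values near the point. Later a function is
  compared with its product with a cutoff, or with 0.\<close>

lemma L_local:
  assumes fg: "smooth_fun A f" "smooth_fun A g" and V: "open V" "x \<in> V" "\<And>y. y \<in> V \<Longrightarrow> f y = g y"
  shows "L f x = L g x"
proof -
  obtain U c where U: "(U, c) \<in> A" "x \<in> U" by (rule chart_at)
  obtain a b where ab: "\<And>f x. smooth_fun A f \<Longrightarrow> x \<in> U \<Longrightarrow> L f x = diff_op a b (\<lambda>y. f (inv_into U c y)) (c x)"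
    by (rule operator_in_chart[OF U(1)]) blast
  define T where "T = c ` (U \<inter> V)"
  have T: "open T" "c x \<in> T" unfolding T_def using chart_image_open[OF U(1) V(1)] U(2) V(2) by auto
  have eq: "f (inv_into U c y) = g (inv_into U c y)" if "y \<in> T" for y
    using that U V(3) by (auto simp: T_def)
  have p: "partial i (\<lambda>y. f (inv_into U c y)) y = partial i (\<lambda>y. g (inv_into U c y)) y" if "y \<in> T" for i y
    unfolding partial_def using frechet_derivative_cong[OF T(1) that eq] by simp
  have "partial i (partial j (\<lambda>y. f (inv_into U c y))) (c x) = partial i (partial j (\<lambda>y. g (inv_into U c y))) (c x)" for i j
    unfolding partial_def[of i] using frechet_derivative_cong[OF T p] by simp
  then show ?thesis using ab fg U(2) p[OF T(2)] by (simp add: diff_op_def)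
qed

lemma L_lincomb:
  assumes "smooth_fun A f" "smooth_fun A g"
  shows "L (\<lambda>x. k * f x + l * g x) x = k * L f x + l * L g x"
proof -
  obtain U c where U: "(U, c) \<in> A" "x \<in> U" by (rule chart_at)
  obtain a b where ab: "\<And>f x. smooth_fun A f \<Longrightarrow> x \<in> U \<Longrightarrow> L f x = diff_op a b (\<lambda>y. f (inv_into U c y)) (c x)"
    by (rule operator_in_chart[OF U(1)]) blast
  show ?thesis using assms U
    by (simp add: ab smooth_fun_lincomb diff_op_lincomb[OF chart(2)[OF U(1)] smooth_fun_chart smooth_fun_chart])
qed

lemma L_diff: "smooth_fun A f \<Longrightarrow> smooth_fun A g \<Longrightarrow> L (\<lambda>x. f x - g x) x = L f x - L g x"
  using L_lincomb[of f g 1 "-1" x] by simp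

lemma L_const: "L (\<lambda>x. k) x = 0"
proof -
  obtain U c where U: "(U, c) \<in> A" "x \<in> U" by (rule chart_at)
  obtain a b where ab: "\<And>f x. smooth_fun A f \<Longrightarrow> x \<in> U \<Longrightarrow> L f x = diff_op a b (\<lambda>y. f (inv_into U c y)) (c x)"
    by (rule operator_in_chart[OF U(1)]) blast
  have "partial i (\<lambda>y. k) = (\<lambda>y. 0)" for i :: 'n and k :: real
    by (simp add: fun_eq_iff partial_def)
  then show ?thesis by (simp add: ab[OF smooth_fun_const U(2)] diff_op_def)
qed

lemma L_continuous:
  assumes "smooth_fun A f" shows "continuous_on UNIV (L f)"
proof -
  have "isCont (L f) x" for x
  proof -
    obtain U c where U: "(U, c) \<in> A" "x \<in> U" by (rule chart_at)
    obtain a b where ell: "elliptic_on (c ` U) a b" and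
      ab: "\<And>f x. smooth_fun A f \<Longrightarrow> x \<in> U \<Longrightarrow> L f x = diff_op a b (\<lambda>y. f (inv_into U c y)) (c x)"
      by (rule operator_in_chart[OF U(1)]) blast
    have s: "smooth_on (c ` U) (\<lambda>y. f (inv_into U c y))" by (rule smooth_fun_chart[OF assms U(1)])
    have "continuous_on (c ` U) a" "continuous_on (c ` U) b" using ell by (auto simp: elliptic_on_def)
    then have "continuous_on (c ` U) (diff_op a b (\<lambda>y. f (inv_into U c y)))"
      unfolding diff_op_def
      by (intro continuous_intros smooth_on_continuous[OF smooth_on_partial] smooth_on_partial s)
    moreover have "continuous_on U c" using chart(3)[OF U(1)] by (simp add: homeomorphism_def)
    ultimately have "continuous_on U (\<lambda>x. diff_op a b (\<lambda>y. f (inv_into U c y)) (c x))"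
      by (rule continuous_on_compose2) auto
    then have "continuous_on U (L f)"
      by (rule continuous_on_eq) (simp add: ab assms)
    then show ?thesis using U chart(1)[OF U(1)] continuous_on_eq_continuous_at by blast
  qed
  then show ?thesis by (simp add: continuous_at_imp_continuous_on)
qed

section \<open>Compactly supported cutoffs\<close>

lemma compact_supportI:
  assumes "compact K" "{x. f x \<noteq> 0} \<subseteq> K" shows "compactly_supported (f :: 'm \<Rightarrow> real)"
proof -
  have "closure {x. f x \<noteq> 0} \<subseteq> K" using assms compact_imp_closed closure_minimal by blast
  then have "closure {x. f x \<noteq> 0} = K \<inter> closure {x. f x \<noteq> 0}" by blast
  then show ?thesis using compact_Int_closed[OF assms(1) closed_closure, of "{x. f x \<noteq> 0}"]
    by (simp only: compactly_supported_def)
qed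

lemma bounded_if_compactly_supported:
  assumes "continuous_on UNIV f" "compact K" "{x. f x \<noteq> 0} \<subseteq> K"
  obtains B where "\<And>x. \<bar>f x :: real\<bar> \<le> B"
proof -
  have "bounded (f ` K)"
    by (intro compact_imp_bounded compact_continuous_image continuous_on_subset[OF assms(1)] assms(2)) auto
  then obtain B where B: "B > 0" "\<And>x. x \<in> K \<Longrightarrow> \<bar>f x\<bar> \<le> B" by (auto simp: bounded_pos)
  have "\<bar>f x\<bar> \<le> B" for x
  proof (cases "x \<in> K")
    case False
    then have "f x = 0" using assms(3) by blast
    then show ?thesis using B(1) by simp
  qed (rule B(2))
  then show ?thesis by (rule that)
qed

lemma L_bounded:
  assumes "smooth_fun A f" "compactly_supported f"
  obtains B where "\<And>x. \<bar>L f x\<bar> \<le> B"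
proof -
  let ?K = "closure {x. f x \<noteq> 0}"
  have K: "compact ?K" using assms(2) by (simp add: compactly_supported_def)
  have "{x. L f x \<noteq> 0} \<subseteq> ?K"
  proof (rule ccontr)
    assume "\<not> ?thesis"
    then obtain x where x: "L f x \<noteq> 0" "x \<in> - ?K" by blast
    have "L f x = L (\<lambda>_. 0) x"
    proof (rule L_local[OF assms(1) smooth_fun_const _ x(2)])
      show "f y = 0" if "y \<in> - ?K" for y using that closure_subset[of "{x. f x \<noteq> 0}"] by blast
    qed auto
    then show False using x L_const by simp
  qed
  then obtain B where "\<And>x. \<bar>L f x\<bar> \<le> B"
    using bounded_if_compactly_supported[OF L_continuous[OF assms(1)] K] by metis
  then show ?thesis by (rule that)
qed

lemma bump_exists:
  obtains \<rho> V where "smooth_fun A \<rho>" "compactly_supported \<rho>" "\<And>y. 0 \<le> \<rho> y \<and> \<rho> y \<le> 1"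
    "open V" "x \<in> V" "\<And>y. y \<in> V \<Longrightarrow> \<rho> y = 1"
proof -
  obtain U c where U: "(U, c) \<in> A" "x \<in> U" by (rule chart_at)
  obtain e where e: "e > 0" "cball (c x) e \<subseteq> c ` U"
    using open_contains_cball chart(2)[OF U(1)] U(2) by (metis image_eqI)
  define r where "r = e / 2"
  have r: "r > 0" "cball (c x) (2 * r) \<subseteq> c ` U" using e by (auto simp: r_def)
  \<comment> \<open>\<open>q \<ge> 1\<close> on the ball of radius \<open>r\<close> and
    \<open>q \<le> 0\<close> from radius \<open>sqrt 2 * r\<close> on, so the bump vanishes outside
    the ball of radius \<open>2 * r\<close>, which the chart contains.\<close>
  define q where "q y = 2 - (1 / r\<^sup>2) * ((y - c x) \<bullet> (y - c x))" for y
  define \<rho> where "\<rho> z = (if z \<in> U then smooth_step (q (c z)) else 0)" for z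
  define K where "K = inv_into U c ` cball (c x) (2 * r)"
  have "compact K"
    unfolding K_def using chart(3)[OF U(1)] r(2)
    by (intro compact_continuous_image) (auto simp: homeomorphism_def intro: continuous_on_subset)
  have q: "(y - c x) \<bullet> (y - c x) = (dist y (c x))\<^sup>2" for y by (simp add: dist_norm dot_square_norm)
  have outside: "\<rho> z = 0" if "z \<notin> K" for z
  proof (cases "z \<in> U")
    case True
    have "c z \<notin> cball (c x) (2 * r)" using that U True unfolding K_def by (metis chart_inv(1) image_eqI)
    then have "(2 * r)\<^sup>2 \<le> (dist (c z) (c x))\<^sup>2" using r(1) by (intro power_mono) (auto simp: dist_commute)
    then have "2 * r\<^sup>2 \<le> (dist (c z) (c x))\<^sup>2" using r(1) by (simp add: power2_eq_square) (smt (verit) zero_le_square)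
    then have "q (c z) \<le> 0" using r(1) by (simp add: q_def q field_simps)
    then show ?thesis using True by (simp add: \<rho>_def smooth_step_0)
  qed (simp add: \<rho>_def)
  have KU: "K \<subseteq> U" using U r(2) by (auto simp: K_def)
  have sq: "smooth_on UNIV q" unfolding q_def
    by (intro smooth_on_diff smooth_on_const smooth_on_linear_compose[OF bounded_linear_mult_right]
        smooth_on_bilinear[OF bounded_bilinear_inner])
      (auto simp: smooth_on_def intro: C_k_on_bounded_linear[OF bounded_linear_ident])
  have "smooth_fun A \<rho>"
  proof (rule smooth_funI)
    fix V d assume V: "(V, d) \<in> A"
    show "smooth_on (d ` V) (\<lambda>y. \<rho> (inv_into V d y))"
    proof (rule smooth_on_local)
      fix y assume "y \<in> d ` V"
      then obtain z where z: "z \<in> V" "y = d z" by blast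
      show "\<exists>T. open T \<and> y \<in> T \<and> smooth_on T (\<lambda>y. \<rho> (inv_into V d y))"
      proof (cases "z \<in> U")
        case True
        let ?T = "d ` (V \<inter> U)"
        have T: "open ?T" using chart_image_open[OF V chart(1)[OF U(1)]] .
        have "smooth_on ?T (\<lambda>y. q (c (inv_into V d y)))"
          by (rule smooth_on_compose[OF T sq chart_transition[OF V U(1)]]) simp
        then have "smooth_on ?T (\<lambda>y. smooth_step (q (c (inv_into V d y))))"
          by (rule smooth_on_compose[OF T smooth_on_smooth_step]) simp
        then have "smooth_on ?T (\<lambda>y. \<rho> (inv_into V d y))"
          by (rule smooth_on_cong[OF T, rotated]) (use V in \<open>auto simp: \<rho>_def\<close>)
        then show ?thesis using T z True by blast
      next
        \<comment> \<open>Outside \<open>U\<close> the bump vanishes near the point, because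
          \<open>K\<close> is compact and hence closed in a Hausdorff space.\<close>
        case False
        let ?T = "d ` (V \<inter> - K)"
        have T: "open ?T"
          using chart_image_open[OF V] compact_imp_closed[OF \<open>compact K\<close>] by (simp add: open_Compl)
        have "smooth_on ?T (\<lambda>y. \<rho> (inv_into V d y))"
          by (rule smooth_on_cong[OF T _ smooth_on_const[OF T, of 0]]) (use V outside in auto)
        then show ?thesis using T z False KU by blast
      qed
    qed
  qed
  moreover have "compactly_supported \<rho>"
    by (rule compact_supportI[OF \<open>compact K\<close>]) (use outside in auto)
  moreover have "0 \<le> \<rho> y \<and> \<rho> y \<le> 1" for y by (simp add: \<rho>_def smooth_step_bounds)
  moreover have "open (U \<inter> c -` ball (c x) r)"
    using chart(1,3)[OF U(1)] by (intro continuous_open_preimage) (auto simp: homeomorphism_def)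
  moreover have "x \<in> U \<inter> c -` ball (c x) r" using U r by simp
  moreover have "\<rho> y = 1" if "y \<in> U \<inter> c -` ball (c x) r" for y
  proof -
    have "(dist (c y) (c x))\<^sup>2 \<le> r\<^sup>2" using that by (intro power_mono) (auto simp: dist_commute)
    then have "q (c y) \<ge> 1" using r(1) by (simp add: q_def q field_simps)
    then show ?thesis using that by (simp add: \<rho>_def smooth_step_1)
  qed
  ultimately show ?thesis by (rule that)
qed

text \<open>Lindelof's theorem extracts countably many bumps whose plateaus cover the manifold. The
  product formula for \<open>\<psi> j\<close> is 1 where one of the first \<open>j\<close> bumps is
  1 and 0 where all of them vanish, so it joins the plateaus and keeps the support compact.\<close>

lemma cutoffs_exist:
  obtains \<psi> :: "nat \<Rightarrow> 'm \<Rightarrow> real" and V where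
    "\<And>j. smooth_fun A (\<psi> j)" "\<And>j. compactly_supported (\<psi> j)" "\<And>j y. 0 \<le> \<psi> j y \<and> \<psi> j y \<le> 1"
    "\<And>j. open (V j)" "incseq V" "(\<Union>j. V j) = UNIV" "\<And>j y. y \<in> V j \<Longrightarrow> \<psi> j y = 1"
proof -
  define P where "P \<rho> V \<longleftrightarrow> smooth_fun A \<rho> \<and> compactly_supported \<rho> \<and> (\<forall>y. 0 \<le> \<rho> y \<and> \<rho> y \<le> 1) \<and> open V \<and> (\<forall>y\<in>V. \<rho> y = 1)"
    for \<rho> V
  have "\<exists>\<rho> V. P \<rho> V \<and> x \<in> V" for x
    using bump_exists[of x] unfolding P_def by metis
  then obtain \<rho> W where W: "\<And>x. P (\<rho> x) (W x)" "\<And>x. x \<in> W x" by metis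
  obtain \<F> where \<F>: "\<F> \<subseteq> range W" "countable \<F>" "\<Union>\<F> = \<Union>(range W)"
    using Lindelof[of "range W"] W(1) unfolding P_def by blast
  have "\<Union>\<F> = UNIV" using \<F>(3) W(2) by blast
  then have ne: "\<F> \<noteq> {}" by auto
  have "\<exists>x. from_nat_into \<F> i = W x" for i using from_nat_into[OF ne, of i] \<F>(1) by blast
  then obtain p where p: "\<And>i. from_nat_into \<F> i = W (p i)" by metis
  have cov: "\<exists>i. x \<in> W (p i)" for x
  proof -
    obtain S where "S \<in> \<F>" "x \<in> S" using \<open>\<Union>\<F> = UNIV\<close> by blast
    then show ?thesis using from_nat_into_surj[OF \<F>(2)] p by metis
  qed
  define \<psi> where "\<psi> j y = 1 - (\<Prod>i<j. 1 - \<rho> (p i) y)" for j y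
  define V where "V j = (\<Union>i<j. W (p i))" for j :: nat
  show ?thesis
  proof (rule that[of \<psi> V])
    have \<rho>: "smooth_fun A (\<rho> x)" "compactly_supported (\<rho> x)" "0 \<le> \<rho> x y" "\<rho> x y \<le> 1"
      "open (W x)" "y \<in> W x \<Longrightarrow> \<rho> x y = 1" for x y
      using W(1)[of x] by (auto simp: P_def)
    show "smooth_fun A (\<psi> j)" for j
      unfolding \<psi>_def by (intro smooth_fun_diff smooth_fun_const smooth_fun_prod \<rho>(1))
    have "{y. \<psi> j y \<noteq> 0} \<subseteq> (\<Union>i<j. closure {y. \<rho> (p i) y \<noteq> 0})" for j
    proof
      fix y assume "y \<in> {y. \<psi> j y \<noteq> 0}"
      then have "(\<Prod>i<j. 1 - \<rho> (p i) y) \<noteq> 1" by (simp add: \<psi>_def)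
      then have "\<not> (\<forall>i\<in>{..<j}. 1 - \<rho> (p i) y = 1)" using prod.neutral[of "{..<j}" "\<lambda>i. 1 - \<rho> (p i) y"] by argo
      then obtain i where "i < j" "\<rho> (p i) y \<noteq> 0" by auto
      then show "y \<in> (\<Union>i<j. closure {y. \<rho> (p i) y \<noteq> 0})"
        using subsetD[OF closure_subset[of "{y. \<rho> (p i) y \<noteq> 0}"], of y] by auto
    qed
    moreover have "compact (\<Union>i<j. closure {y. \<rho> (p i) y \<noteq> 0})" for j
      using \<rho>(2) by (intro compact_UN) (auto simp: compactly_supported_def)
    ultimately show "compactly_supported (\<psi> j)" for j by (rule compact_supportI[rotated])
    show "0 \<le> \<psi> j y \<and> \<psi> j y \<le> 1" for j y
      unfolding \<psi>_def using \<rho>(3,4) by (auto intro!: prod_le_1 prod_nonneg)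
    show "open (V j)" for j unfolding V_def using \<rho>(5) by blast
    show "incseq V" unfolding V_def by (intro monoI UN_mono) auto
    show "(\<Union>j. V j) = UNIV" using cov unfolding V_def by blast
    show "\<psi> j y = 1" if yV: "y \<in> V j" for j y
    proof -
      obtain i where i: "i < j" "y \<in> W (p i)" using yV by (auto simp: V_def)
      have "(\<Prod>i<j. 1 - \<rho> (p i) y) = 0" by (rule prod_zero) (use i \<rho>(6) in auto)
      then show ?thesis by (simp add: \<psi>_def)
    qed
  qed
qed

section \<open>From charts to the manifold: equicontinuity and propagation of smallness\<close>

lemma harmonic_in_chart:
  assumes "(U, c) \<in> A"
  obtains a b where "elliptic_on (c ` U) a b"
    "\<And>h. L_harmonic A L h \<Longrightarrow> harmonic_on (c ` U) a b (\<lambda>y. h (inv_into U c y))"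
proof (rule operator_in_chart[OF assms])
  fix a b assume ab: "elliptic_on (c ` U) a b"
    "\<And>f x. smooth_fun A f \<Longrightarrow> x \<in> U \<Longrightarrow> L f x = diff_op a b (\<lambda>y. f (inv_into U c y)) (c x)"
  show ?thesis
  proof (rule that[OF ab(1)])
    fix h assume h: "L_harmonic A L h"
    have "diff_op a b (\<lambda>y. h (inv_into U c y)) (c x) = 0" if "x \<in> U" for x
      using ab(2)[of h x] h that by (simp add: L_harmonic_def)
    then show "harmonic_on (c ` U) a b (\<lambda>y. h (inv_into U c y))"
      using h assms by (auto simp: harmonic_on_def L_harmonic_def smooth_fun_chart)
  qed
qed

lemma harmonic_diff: "L_harmonic A L f \<Longrightarrow> L_harmonic A L g \<Longrightarrow> L_harmonic A L (\<lambda>x. f x - g x)"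
  by (simp add: L_harmonic_def smooth_fun_diff L_diff)

lemma harmonic_const: "L_harmonic A L (\<lambda>x. k)"
  by (simp add: L_harmonic_def smooth_fun_const L_const)

lemma equicontinuous:
  assumes "\<epsilon> > 0"
  obtains V where "open V" "x \<in> V"
    "\<And>h y. L_harmonic A L h \<Longrightarrow> (\<And>z. \<bar>h z\<bar> \<le> B) \<Longrightarrow> y \<in> V \<Longrightarrow> \<bar>h y - h x\<bar> < \<epsilon>"
proof -
  obtain U c where U: "(U, c) \<in> A" "x \<in> U" by (rule chart_at)
  obtain a b where ab: "elliptic_on (c ` U) a b"
    "\<And>h. L_harmonic A L h \<Longrightarrow> harmonic_on (c ` U) a b (\<lambda>y. h (inv_into U c y))"
    by (rule harmonic_in_chart[OF U(1)]) blast
  obtain \<delta> where \<delta>: "\<delta> > 0" "\<And>f y. harmonic_on (c ` U) a b f \<Longrightarrow> (\<And>x. x \<in> c ` U \<Longrightarrow> \<bar>f x\<bar> \<le> B) \<Longrightarrow>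
      dist y (c x) < \<delta> \<Longrightarrow> \<bar>f y - f (c x)\<bar> < \<epsilon>"
    using harmonic_equicontinuous[OF ab(1) imageI[OF U(2)] assms, of B] by metis
  show ?thesis
  proof (rule that)
    show "open (U \<inter> c -` ball (c x) \<delta>)"
      using chart(1,3)[OF U(1)] by (intro continuous_open_preimage) (auto simp: homeomorphism_def)
    show "x \<in> U \<inter> c -` ball (c x) \<delta>" using U \<delta> by simp
    show "\<bar>h y - h x\<bar> < \<epsilon>" if "L_harmonic A L h" "\<And>z. \<bar>h z\<bar> \<le> B" "y \<in> U \<inter> c -` ball (c x) \<delta>" for h y
      using \<delta>(2)[OF ab(2)[OF that(1)], of "c y"] that(2,3) U by (auto simp: dist_commute)
  qed
qed

text \<open>The relation \<open>P\<close> is transitive and holds in both directions between nearby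
  points, so the points reached from \<open>x\<close> form an open and closed set. That
  \<open>\<delta>\<close> is chosen before \<open>h\<close> is the trace of Harnack's inequality
  that survives.\<close>

lemma smallness_propagates:
  assumes conn: "connected (UNIV :: 'm set)"
  shows "\<forall>\<epsilon>>0. \<exists>\<delta>>0. \<forall>h. L_harmonic A L h \<and> (\<forall>z. 0 \<le> h z \<and> h z \<le> B) \<and> h x < \<delta> \<longrightarrow> h y < \<epsilon>"
proof -
  define P where "P x y \<longleftrightarrow> (\<forall>\<epsilon>>0. \<exists>\<delta>>0. \<forall>h. L_harmonic A L h \<and> (\<forall>z. 0 \<le> h z \<and> h z \<le> B) \<and> h x < \<delta> \<longrightarrow> h y < \<epsilon>)"
    for x y
  have P_trans: "P x z" if xy: "P x y" and yz: "P y z" for x y z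
    unfolding P_def
  proof (intro allI impI)
    fix \<epsilon> :: real assume "\<epsilon> > 0"
    then obtain \<delta> where \<delta>: "\<delta> > 0" "\<forall>h. L_harmonic A L h \<and> (\<forall>z. 0 \<le> h z \<and> h z \<le> B) \<and> h y < \<delta> \<longrightarrow> h z < \<epsilon>"
      using yz unfolding P_def by blast
    then obtain \<delta>' where "\<delta>' > 0" "\<forall>h. L_harmonic A L h \<and> (\<forall>z. 0 \<le> h z \<and> h z \<le> B) \<and> h x < \<delta>' \<longrightarrow> h y < \<delta>"
      using xy unfolding P_def by blast
    then show "\<exists>\<delta>>0. \<forall>h. L_harmonic A L h \<and> (\<forall>z. 0 \<le> h z \<and> h z \<le> B) \<and> h x < \<delta> \<longrightarrow> h z < \<epsilon>"
      using \<delta>(2) by blast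
  qed
  have P_local: "\<exists>V. open V \<and> x \<in> V \<and> (\<forall>y\<in>V. P x y \<and> P y x)" for x
  proof -
    obtain U c where U: "(U, c) \<in> A" "x \<in> U" by (rule chart_at)
    obtain a b where ab: "elliptic_on (c ` U) a b"
      "\<And>h. L_harmonic A L h \<Longrightarrow> harmonic_on (c ` U) a b (\<lambda>y. h (inv_into U c y))"
      by (rule harmonic_in_chart[OF U(1)]) blast
    obtain e where e: "e > 0" "cball (c x) e \<subseteq> c ` U"
      using open_contains_cball chart(2)[OF U(1)] U(2) by (metis image_eqI)
    \<comment> \<open>Halving leaves room to center the comparison ball at \<open>x\<close> or at
      any nearby \<open>y\<close>, which yields both directions of \<open>P\<close>.\<close>
    define r where "r = e / 2"
    have local: "P u v" if uv: "u \<in> U" "v \<in> U" "cball (c v) r \<subseteq> c ` U" "dist (c u) (c v) < r" for u v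
      unfolding P_def
    proof (intro allI impI)
      fix \<epsilon> :: real assume "\<epsilon> > 0"
      then obtain \<delta> where \<delta>: "\<delta> > 0" "\<And>f. harmonic_on (c ` U) a b f \<Longrightarrow> (\<And>x. x \<in> c ` U \<Longrightarrow> 0 \<le> f x \<and> f x \<le> B)
          \<Longrightarrow> f (c u) < \<delta> \<Longrightarrow> f (c v) < \<epsilon>"
        using harmonic_smallness_chart[OF ab(1) uv(3,4), of \<epsilon> B] by blast
      show "\<exists>\<delta>>0. \<forall>h. L_harmonic A L h \<and> (\<forall>z. 0 \<le> h z \<and> h z \<le> B) \<and> h u < \<delta> \<longrightarrow> h v < \<epsilon>"
      proof (intro exI[of _ \<delta>] conjI allI impI \<delta>(1))
        fix h assume h: "L_harmonic A L h \<and> (\<forall>z. 0 \<le> h z \<and> h z \<le> B) \<and> h u < \<delta>"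
        then show "h v < \<epsilon>" using \<delta>(2)[OF ab(2), of h] uv(1,2) U(1) by simp
      qed
    qed
    let ?V = "U \<inter> c -` ball (c x) r"
    have "cball (c x) r \<subseteq> c ` U" using e by (auto simp: r_def)
    moreover have "cball (c y) r \<subseteq> c ` U" if "y \<in> ?V" for y
    proof
      fix w assume "w \<in> cball (c y) r"
      then have "w \<in> cball (c x) e"
        using that dist_triangle[of "c x" w "c y"] by (auto simp: r_def)
      then show "w \<in> c ` U" using e by blast
    qed
    ultimately have PV: "\<forall>y\<in>?V. P x y \<and> P y x"
      using U(2) by (intro ballI conjI local) (auto simp: dist_commute simp del: mem_cball)
    have "open ?V"
      using chart(1,3)[OF U(1)] by (intro continuous_open_preimage) (auto simp: homeomorphism_def)
    moreover have "x \<in> ?V" using U e by (simp add: r_def)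
    ultimately show ?thesis using PV by blast
  qed
  define S where "S = {y. P x y}"
  have "open S"
  proof (subst open_subopen, intro ballI)
    fix y assume "y \<in> S"
    then show "\<exists>T. open T \<and> y \<in> T \<and> T \<subseteq> S" using P_local[of y] P_trans unfolding S_def by blast
  qed
  \<comment> \<open>This uses the backward direction of \<open>P_local\<close>: a reachable point
    near \<open>y\<close> would make \<open>y\<close> reachable.\<close>
  moreover have "open (- S)"
  proof (subst open_subopen, intro ballI)
    fix y assume "y \<in> - S"
    then show "\<exists>T. open T \<and> y \<in> T \<and> T \<subseteq> - S" using P_local[of y] P_trans unfolding S_def by blast
  qed
  moreover have "x \<in> S" using P_local[of x] unfolding S_def by blast
  ultimately have "S = UNIV" using connectedD[OF conn, of S "- S"] by auto
  then show ?thesis unfolding S_def P_def by blast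
qed

end

section \<open>Stopping the diffusion\<close>

lemma space_path_algebra [simp]: "space (path_algebra T) = paths"
  by (simp add: path_algebra_def)

lemma coordinate_measurable [measurable (raw)]:
  assumes "t \<in> T"
  shows "(\<lambda>\<omega>. \<omega> t) \<in> path_algebra T \<rightarrow>\<^sub>M borel"
proof -
  have "(\<lambda>\<omega>. restrict \<omega> T) \<in> path_algebra T \<rightarrow>\<^sub>M (\<Pi>\<^sub>M t\<in>T. borel)"
    unfolding path_algebra_def by (rule measurable_vimage_algebra1) (auto simp: space_PiM)
  then have "(\<lambda>\<omega>. restrict \<omega> T t) \<in> path_algebra T \<rightarrow>\<^sub>M borel"
    using measurable_component_singleton[OF assms] by (rule measurable_compose)
  then show ?thesis using assms by simp
qed

lemma path_algebra_mono:
  assumes "S \<subseteq> T"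
  shows "sets (path_algebra S) \<subseteq> sets (path_algebra T)"
proof
  fix B :: "(real \<Rightarrow> 'a) set" assume B: "B \<in> sets (path_algebra S)"
  have "(\<lambda>\<omega>. \<omega>) \<in> path_algebra T \<rightarrow>\<^sub>M path_algebra S"
    unfolding path_algebra_def[of S]
  proof (rule measurable_vimage_algebra2)
    show "(\<lambda>\<omega>. restrict \<omega> S) \<in> path_algebra T \<rightarrow>\<^sub>M (\<Pi>\<^sub>M t\<in>S. borel)"
      using assms by (intro measurable_restrict coordinate_measurable) auto
  qed simp
  then have "(\<lambda>\<omega>. \<omega>) -` B \<inter> space (path_algebra T) \<in> sets (path_algebra T)"
    using B by (rule measurable_sets)
  then show "B \<in> sets (path_algebra T)" using sets.sets_into_space[OF B] by (simp add: Int_absorb2)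
qed

text \<open>The conditional expectation in \<open>martingale\<close> is tested against a past event.
  Zero mean of such localized increments is the form in which the martingale problem enters.\<close>

lemma martingale_increment:
  assumes P: "prob_space P" "sets P = sets (path_algebra {0..})"
    and M: "martingale P (\<lambda>t. path_algebra {0..t}) X"
    and st: "0 \<le> s" "s \<le> t" and B: "B \<in> sets (path_algebra {0..s})"
  shows "integrable P (\<lambda>\<omega>. indicator B \<omega> * (X t \<omega> - X s \<omega>))"
    "(\<integral>\<omega>. indicator B \<omega> * (X t \<omega> - X s \<omega>) \<partial>P) = 0"
proof -
  interpret prob_space P by (rule P)
  have sp: "space P = paths" using sets_eq_imp_space_eq[OF P(2)] by simp
  have sub: "subalgebra P (path_algebra {0..s})"
    using path_algebra_mono[of "{0..s}" "{0..}"] by (auto simp: subalgebra_def sp P(2))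
  interpret F: finite_measure_subalgebra P "path_algebra {0..s}"
    by unfold_locales (rule sub)
  have int: "integrable P (X t)" "integrable P (X s)"
    and ce: "AE \<omega> in P. real_cond_exp P (path_algebra {0..s}) (X t) \<omega> = X s \<omega>"
    using M st by (auto simp: martingale_def)
  have BP: "B \<in> sets P" using sub B by (auto simp: subalgebra_def)
  have i: "integrable P (\<lambda>\<omega>. indicator B \<omega> * X r \<omega>)" if "integrable P (X r)" for r
    using integrable_mult_indicator[OF BP that] by simp
  show "integrable P (\<lambda>\<omega>. indicator B \<omega> * (X t \<omega> - X s \<omega>))"
    using i int by (simp add: right_diff_distrib)
  have "(\<integral>\<omega>\<in>B. X t \<omega> \<partial>P) = (\<integral>\<omega>\<in>B. real_cond_exp P (path_algebra {0..s}) (X t) \<omega> \<partial>P)"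
    by (rule F.real_cond_exp_intA[OF int(1) B])
  also have "\<dots> = (\<integral>\<omega>\<in>B. X s \<omega> \<partial>P)"
    unfolding set_lebesgue_integral_def
  proof (rule integral_cong_AE)
    show "(\<lambda>\<omega>. indicator B \<omega> *\<^sub>R real_cond_exp P (path_algebra {0..s}) (X t) \<omega>) \<in> borel_measurable P"
      using BP F.real_cond_exp_int(1)[OF int(1)] by measurable
    show "(\<lambda>\<omega>. indicator B \<omega> *\<^sub>R X s \<omega>) \<in> borel_measurable P"
      using BP int by measurable
  qed (use ce in auto)
  finally show "(\<integral>\<omega>. indicator B \<omega> * (X t \<omega> - X s \<omega>) \<partial>P) = 0"
    using i int by (simp add: set_lebesgue_integral_def right_diff_distrib)
qed

text \<open>Telescoping up to \<open>K\<close>, the first index at which \<open>Q\<close> fails, or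
  \<open>N\<close> if there is none before. Together with \<open>martingale_increment\<close> this
  replaces the optional stopping theorem.\<close>

lemma stopped_sum:
  fixes X :: "nat \<Rightarrow> real"
  obtains K where "K \<le> N" "\<And>j. j < K \<Longrightarrow> Q j" "K = N \<or> \<not> Q K"
    "(\<Sum>k<N. of_bool (\<forall>j\<le>k. Q j) * (X (Suc k) - X k)) = X K - X 0"
proof -
  define K where "K = (LEAST k. k = N \<or> \<not> Q k)"
  have K: "K = N \<or> \<not> Q K" unfolding K_def by (rule LeastI[of _ N]) simp
  have le: "K \<le> N" unfolding K_def by (rule Least_le) simp
  have less: "Q j" if "j < K" for j
    using not_less_Least[of j "\<lambda>k. k = N \<or> \<not> Q k"] that unfolding K_def by blast
  have iff: "(\<forall>j\<le>k. Q j) \<longleftrightarrow> k < K" if "k < N" for k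
    using K le less that by (metis le_less_trans not_le order_less_irrefl)
  have "(\<Sum>k<N. of_bool (\<forall>j\<le>k. Q j) * (X (Suc k) - X k)) = (\<Sum>k<N. if k < K then X (Suc k) - X k else 0)"
    by (intro sum.cong) (auto simp: iff)
  also have "\<dots> = (\<Sum>k<K. X (Suc k) - X k)"
    using le by (intro sum.mono_neutral_cong_right) auto
  also have "\<dots> = X K - X 0" by (rule sum_lessThan_telescope)
  finally show ?thesis using that K le less by blast
qed

lemma (in prob_space) events_increasing_approx:
  assumes "range E \<subseteq> events" "incseq E" "AE \<omega> in M. \<omega> \<in> (\<Union>i. E i)" "\<epsilon> > 0"
  obtains i where "prob (E i) > 1 - \<epsilon>"
proof -
  have "(\<lambda>i. prob (E i)) \<longlonglongrightarrow> prob (\<Union>i. E i)"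
    using assms(1,2) by (rule finite_Lim_measure_incseq)
  moreover have "prob (\<Union>i. E i) = 1" using assms(1,3) by (intro prob_eq_1[THEN iffD2]) auto
  ultimately have "\<forall>\<^sub>F i in sequentially. prob (E i) > 1 - \<epsilon>"
    using assms(4) by (intro order_tendstoD(1)) auto
  then show ?thesis using that eventually_happens'[OF sequentially_bot] by blast
qed

context elliptic_manifold
begin

text \<open>The process is stopped at the first grid time at which it is in \<open>V\<close> or in the region where \<open>\<psi> u\<close> is not
  \<open>L\<close>-harmonic. As the mesh tends to 0, the drift accumulated before that time tends to 0, because
  \<open>L (\<psi> u)\<close> vanishes at all earlier grid times.\<close>

lemma harmonic_bound_stopped:
  assumes P: "L_diffusion A L P" and u: "L_harmonic A L u" "\<And>x. \<bar>u x\<bar> \<le> B"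
    and V: "open V" "\<And>x. x \<in> V \<Longrightarrow> u x \<le> \<kappa>"
    and \<psi>: "smooth_fun A \<psi>" "compactly_supported \<psi>" "\<And>x. 0 \<le> \<psi> x \<and> \<psi> x \<le> 1"
    and W: "open W" "\<And>x. x \<in> W \<Longrightarrow> \<psi> x = 1" "y \<in> W"
    and good: "good = {\<omega> \<in> paths. (\<forall>s\<in>\<rat> \<inter> {0..real T}. \<omega> s \<in> W) \<and> (\<exists>s\<in>\<rat> \<inter> {0..real T}. \<omega> s \<in> V)}"
  shows "good \<in> sets (P y)" "0 \<le> (\<kappa> - u y) * measure (P y) good + 2 * B * (1 - measure (P y) good)"
proof -
  \<comment> \<open>The martingale problem admits compactly supported functions only. On the open
    set \<open>W\<close> the cutoff is invisible, so there \<open>f\<close> agrees with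
    \<open>u\<close> and \<open>L f\<close> vanishes.\<close>
  define f where "f x = \<psi> x * u x" for x
  define g where "g = L f"
  have us: "smooth_fun A u" and Lu: "\<And>x. L u x = 0" using u(1) by (auto simp: L_harmonic_def)
  have fs: "smooth_fun A f" unfolding f_def by (rule smooth_fun_mult[OF \<psi>(1) us])
  have fc: "compactly_supported f"
    by (rule compact_supportI[of "closure {x. \<psi> x \<noteq> 0}"])
      (use \<psi>(2) closure_subset[of "{x. \<psi> x \<noteq> 0}"] in \<open>auto simp: compactly_supported_def f_def\<close>)
  obtain Gb where Gb: "\<And>x. \<bar>g x\<bar> \<le> Gb" unfolding g_def by (rule L_bounded[OF fs fc]) blast
  have Gb0: "Gb \<ge> 0" using Gb[of y] by linarith
  have B0: "B \<ge> 0" using u(2)[of y] by linarith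
  have fB: "\<bar>f x\<bar> \<le> B" for x
    using mult_mono[of "\<psi> x" 1 "\<bar>u x\<bar>" B] \<psi>(3)[of x] u(2)[of x] by (simp add: f_def abs_mult)
  have fW: "f x = u x" if "x \<in> W" for x using W(2)[OF that] by (simp add: f_def)
  have gW: "g x = 0" if "x \<in> W" for x
    unfolding g_def using L_local[OF fs us W(1) that fW] Lu by simp
  have cf: "continuous_on UNIV f" by (rule smooth_fun_continuous[OF fs])
  have cg: "continuous_on UNIV g" unfolding g_def by (rule L_continuous[OF fs])
  \<comment> \<open>Stopping where \<open>g\<close> is nonzero controls the drift even for paths
    that leave \<open>W\<close>. Paths in \<open>good\<close> can be stopped only in
    \<open>V\<close>, since \<open>g\<close> vanishes on \<open>W\<close>.\<close>
  define R where "R = V \<union> {x. g x \<noteq> 0}"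
  have R: "open R" unfolding R_def
    using V(1) open_Collect_neq[OF cg continuous_on_const] by (intro open_Un) auto
  have Pm: "P \<in> borel \<rightarrow>\<^sub>M prob_algebra (path_algebra {0..})" and P0: "AE \<omega> in P y. \<omega> 0 = y"
    using P by (auto simp: L_diffusion_def)
  have "P y \<in> space (prob_algebra (path_algebra {0..}))" using measurable_space[OF Pm, of y] by simp
  then have ps: "prob_space (P y)" and sets: "sets (P y) = sets (path_algebra {0..})"
    by (auto simp: space_prob_algebra)
  interpret prob_space "P y" by (rule ps)
  have space: "space (P y) = paths" using sets_eq_imp_space_eq[OF sets] by simp
  define X where "X t \<omega> = f (\<omega> t) - f (\<omega> 0) - integral {0..t} (\<lambda>s. g (\<omega> s))" for t :: real and \<omega>
  have mart: "martingale (P y) (\<lambda>t. path_algebra {0..t}) X"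
    using P fs fc unfolding L_diffusion_def X_def g_def by blast
  have coord: "(\<lambda>\<omega>. \<omega> s) \<in> P y \<rightarrow>\<^sub>M borel" if "s \<ge> 0" for s
    using coordinate_measurable[of s "{0..}"] that by (simp add: measurable_cong_sets[OF sets refl])
  have evt: "{\<omega> \<in> paths. \<omega> s \<in> Z} \<in> sets (P y)" if "s \<ge> 0" "open Z" for s Z
    using measurable_sets[OF coord[OF that(1)], of Z] that(2) by (simp add: space vimage_def Int_def conj_commute)
  \<comment> \<open>Restriction to rational times makes \<open>good\<close> a countable combination
    of coordinate events.\<close>
  show good_ev: "good \<in> sets (P y)"
  proof -
    have Q: "countable (\<rat> \<inter> {0..real T})" using countable_rat by blast
    have "good = (paths \<inter> (\<Inter>s\<in>\<rat> \<inter> {0..real T}. {\<omega> \<in> paths. \<omega> s \<in> W})) \<inter> (\<Union>s\<in>\<rat> \<inter> {0..real T}. {\<omega> \<in> paths. \<omega> s \<in> V})"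
      unfolding good by blast
    also have "\<dots> \<in> sets (P y)"
    proof (rule sets.Int)
      have "0 \<in> \<rat> \<inter> {0..real T}" by simp
      then have "(\<Inter>s\<in>\<rat> \<inter> {0..real T}. {\<omega> \<in> paths. \<omega> s \<in> W}) \<in> sets (P y)"
        using Q W(1) by (intro sets.countable_INT') (auto intro: evt)
      then show "paths \<inter> (\<Inter>s\<in>\<rat> \<inter> {0..real T}. {\<omega> \<in> paths. \<omega> s \<in> W}) \<in> sets (P y)"
        using sets.top[of "P y"] by (simp add: space sets.Int)
      show "(\<Union>s\<in>\<rat> \<inter> {0..real T}. {\<omega> \<in> paths. \<omega> s \<in> V}) \<in> sets (P y)"
        using Q V(1) by (intro sets.countable_UN') (auto intro: evt)
    qed
    finally show ?thesis .
  qed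
  \<comment> \<open>\<open>T\<close> is a natural number, so the grid times up to index
    \<open>Suc m\<close> are rational and the conditions in \<open>good\<close> apply to
    them.\<close>
  define t where "t m k = real T * real k / real (Suc m)" for m k :: nat
  have t: "0 \<le> t m k" "t m k \<le> t m (Suc k)" "t m 0 = 0" for m k
    by (auto simp: t_def intro!: divide_right_mono mult_left_mono)
  have tT: "t m k \<in> \<rat> \<inter> {0..real T}" if "k \<le> Suc m" for m k
    using that by (auto simp: t_def divide_le_eq intro!: mult_left_mono)
  define Ev where "Ev m k = {\<omega> \<in> paths. \<forall>j\<le>k. \<omega> (t m j) \<notin> R}" for m k
  have Ev: "Ev m k \<in> sets (path_algebra {0..t m k})" for m k
  proof -
    have mono: "t m j \<le> t m k" if "j \<le> k" for j
      using that by (auto simp: t_def intro!: divide_right_mono mult_left_mono)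
    have "{\<omega> \<in> space (path_algebra {0..t m k}). \<omega> (t m j) \<notin> R} \<in> sets (path_algebra {0..t m k})" if "j \<le> k" for j
    proof -
      have [measurable]: "(\<lambda>\<omega>. \<omega> (t m j)) \<in> path_algebra {0..t m k} \<rightarrow>\<^sub>M borel"
        using mono[OF that] t(1) by (intro coordinate_measurable) simp
      have [measurable]: "R \<in> sets borel" using R by simp
      show ?thesis by measurable
    qed
    then have "(\<Inter>j\<in>{..k}. {\<omega> \<in> space (path_algebra {0..t m k}). \<omega> (t m j) \<notin> R}) \<in> sets (path_algebra {0..t m k})"
      by (intro sets.finite_INT) auto
    moreover have "(\<Inter>j\<in>{..k}. {\<omega> \<in> space (path_algebra {0..t m k}). \<omega> (t m j) \<notin> R}) = Ev m k"
      by (auto simp: Ev_def)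
    ultimately show ?thesis by simp
  qed
  define Z where "Z m \<omega> = (\<Sum>k<Suc m. indicator (Ev m k) \<omega> * (X (t m (Suc k)) \<omega> - X (t m k) \<omega>))" for m \<omega>
  note inc = martingale_increment[OF ps sets mart t(1) t(2) Ev]
  have Zi: "integrable (P y) (Z m)" for m unfolding Z_def[abs_def] by (intro Bochner_Integration.integrable_sum inc(1))
  have Z0: "(\<integral>\<omega>. Z m \<omega> \<partial>P y) = 0" for m
    unfolding Z_def by (subst Bochner_Integration.integral_sum) (use inc in auto)
  define D where "D m K \<omega> = integral {0..t m K} (\<lambda>s. g (\<omega> s))" for m K \<omega>
  have Zrep: "\<exists>K\<le>Suc m. (\<forall>j<K. \<omega> (t m j) \<notin> R) \<and> (K = Suc m \<or> \<omega> (t m K) \<in> R)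
      \<and> Z m \<omega> = f (\<omega> (t m K)) - f (\<omega> 0) - D m K \<omega>" if "\<omega> \<in> paths" for \<omega> m
  proof -
    obtain K where K: "K \<le> Suc m" "\<And>j. j < K \<Longrightarrow> \<omega> (t m j) \<notin> R" "K = Suc m \<or> \<not> \<omega> (t m K) \<notin> R"
      "(\<Sum>k<Suc m. of_bool (\<forall>j\<le>k. \<omega> (t m j) \<notin> R) * (X (t m (Suc k)) \<omega> - X (t m k) \<omega>)) = X (t m K) \<omega> - X (t m 0) \<omega>"
      by (rule stopped_sum[of "Suc m" "\<lambda>j. \<omega> (t m j) \<notin> R" "\<lambda>k. X (t m k) \<omega>"]) blast
    have ind: "(indicator (Ev m k) \<omega> :: real) = of_bool (\<forall>j\<le>k. \<omega> (t m j) \<notin> R)" for k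
      using that by (simp add: Ev_def indicator_def)
    have "Z m \<omega> = X (t m K) \<omega> - X (t m 0) \<omega>" unfolding Z_def K(4)[symmetric] by (simp only: ind)
    then have "Z m \<omega> = f (\<omega> (t m K)) - f (\<omega> 0) - D m K \<omega>" by (simp add: X_def D_def t(3))
    then show ?thesis using K(1-3) by blast
  qed
  have cgo: "continuous_on {0..} (\<lambda>s. g (\<omega> s))" if "\<omega> \<in> paths" for \<omega>
    using that continuous_on_compose2[OF cg, of "{0..}" \<omega>] by (simp add: paths_def)
  have Dbound: "\<bar>D m K \<omega>\<bar> \<le> c * t m K"
    if "\<omega> \<in> paths" "\<And>s. s \<in> {0..t m K} \<Longrightarrow> \<bar>g (\<omega> s)\<bar> \<le> c" for m K \<omega> c
  proof -
    have "norm (integral {0..t m K} (\<lambda>s. g (\<omega> s))) \<le> c * (t m K - 0)"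
      using t(1) that(2) continuous_on_subset[OF cgo[OF that(1)], of "{0..t m K}"]
      by (intro integral_bound) auto
    then show ?thesis by (simp add: D_def)
  qed
  have Zbound: "\<bar>Z m \<omega>\<bar> \<le> 2 * B + Gb * real T" if \<omega>: "\<omega> \<in> paths" for m \<omega>
  proof -
    obtain K where K: "K \<le> Suc m" "Z m \<omega> = f (\<omega> (t m K)) - f (\<omega> 0) - D m K \<omega>"
      using Zrep[OF \<omega>] by blast
    have "\<bar>D m K \<omega>\<bar> \<le> Gb * t m K" by (rule Dbound[OF \<omega>]) (rule Gb)
    also have "\<dots> \<le> Gb * real T" using tT[OF K(1)] Gb0 by (intro mult_left_mono) auto
    finally show ?thesis using K(2) fB[of "\<omega> (t m K)"] fB[of "\<omega> 0"] by linarith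
  qed
  \<comment> \<open>\<open>Z m\<close> need not converge as the grid is refined; an eventual upper
    bound suffices. Off \<open>good\<close> it rests on \<open>\<bar>f\<bar> \<le> B\<close>
    alone.\<close>
  have Zeventually: "\<forall>\<^sub>F m in sequentially. Z m \<omega> \<le> (if \<omega> \<in> good then \<kappa> - u y else 2 * B) + \<epsilon>"
    if \<omega>: "\<omega> \<in> paths" "\<omega> 0 = y" and "\<epsilon> > 0" for \<omega> \<epsilon>
  proof -
    have co: "continuous_on {0..real T} \<omega>" using \<omega>(1) by (auto simp: paths_def intro: continuous_on_subset)
    define c where "c = \<epsilon> / (real T + 1)"
    have c: "c > 0" "c * real T \<le> \<epsilon>"
    proof -
      show "c > 0" using \<open>\<epsilon> > 0\<close> by (simp add: c_def add_nonneg_pos)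
      then have "c * real T \<le> c * (real T + 1)" by simp
      also have "\<dots> = \<epsilon>" by (simp add: c_def add_nonneg_eq_0_iff)
      finally show "c * real T \<le> \<epsilon>" .
    qed
    have "uniformly_continuous_on {0..real T} (\<lambda>s. g (\<omega> s))"
      using continuous_on_subset[OF cgo[OF \<omega>(1)]] by (intro compact_uniformly_continuous) auto
    then obtain \<delta> where \<delta>: "\<delta> > 0"
      "\<And>s r. s \<in> {0..real T} \<Longrightarrow> r \<in> {0..real T} \<Longrightarrow> dist r s < \<delta> \<Longrightarrow> dist (g (\<omega> r)) (g (\<omega> s)) < c"
      using c(1) unfolding uniformly_continuous_on_def by metis
    \<comment> \<open>Since \<open>V\<close> is open, a visit to it fills a time interval, which a
      fine enough grid cannot miss.\<close>
    have hit: "\<exists>\<delta>'>0. \<exists>s0\<in>{0..real T}. \<forall>s\<in>{0..real T}. \<bar>s - s0\<bar> < \<delta>' \<longrightarrow> \<omega> s \<in> V" if "\<omega> \<in> good"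
    proof -
      obtain s0 where s0: "s0 \<in> {0..real T}" "\<omega> s0 \<in> V" using \<open>\<omega> \<in> good\<close> by (auto simp: good)
      have "\<forall>\<^sub>F s in at s0 within {0..real T}. \<omega> s \<in> V"
        using co s0 V(1) by (auto simp: continuous_on_def intro: topological_tendstoD)
      then show ?thesis using s0 unfolding eventually_at by (metis dist_real_def dist_eq_0_iff)
    qed
    have "\<exists>d>0. \<omega> \<in> good \<longrightarrow> (\<exists>s0\<in>{0..real T}. \<forall>s\<in>{0..real T}. \<bar>s - s0\<bar> < d \<longrightarrow> \<omega> s \<in> V)"
    proof (cases "\<omega> \<in> good")
      case True
      from hit[OF this] show ?thesis by blast
    qed (auto intro: exI[of _ 1])
    then obtain \<delta>' where \<delta>': "\<delta>' > 0"
      "\<omega> \<in> good \<Longrightarrow> \<exists>s0\<in>{0..real T}. \<forall>s\<in>{0..real T}. \<bar>s - s0\<bar> < \<delta>' \<longrightarrow> \<omega> s \<in> V"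
      by blast
    have "(\<lambda>m. real T / real (Suc m)) \<longlonglongrightarrow> 0"
      by (rule LIMSEQ_Suc[OF lim_const_over_n])
    then have "\<forall>\<^sub>F m in sequentially. real T / real (Suc m) < min \<delta> \<delta>'"
      by (rule order_tendstoD) (use \<delta>(1) \<delta>'(1) in simp)
    then show ?thesis
    proof eventually_elim
      case (elim m)
      have near: "\<exists>k\<le>Suc m. t m k \<le> s \<and> s - t m k < min \<delta> \<delta>' \<and> (s < t m K \<longrightarrow> k < K)"
        if s: "s \<in> {0..real T}" for s K
      proof (cases "T = 0")
        case True
        then show ?thesis using s \<delta>(1) \<delta>'(1) by (intro exI[of _ 0]) (auto simp: t_def)
      next
        case False
        define h where "h = real T / real (Suc m)"
        have h: "h > 0" "h * real (Suc m) = real T" using False by (auto simp: h_def)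
        have th: "t m k = h * real k" for k by (simp add: t_def h_def)
        define k where "k = nat \<lfloor>s / h\<rfloor>"
        have "s / h \<ge> 0" using s h by simp
        then have k: "real k \<le> s / h" "s / h < real k + 1" unfolding k_def by linarith+
        then have k1: "t m k \<le> s" "s < t m k + h" using h(1) by (auto simp: th field_simps)
        have "h * real k \<le> h * real (Suc m)" using k1 s h by (simp add: th)
        then have "k \<le> Suc m" using h(1) by (simp del: of_nat_Suc)
        moreover have "k < K" if "s < t m K"
        proof -
          have "h * real k < h * real K" using k1(1) that unfolding th by linarith
          then show ?thesis using h(1) by simp
        qed
        ultimately show ?thesis using k1 elim by (intro exI[of _ k]) (auto simp: h_def)
      qed
      obtain K where K: "K \<le> Suc m" "\<And>j. j < K \<Longrightarrow> \<omega> (t m j) \<notin> R" "K = Suc m \<or> \<omega> (t m K) \<in> R"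
        "Z m \<omega> = f (\<omega> (t m K)) - f (\<omega> 0) - D m K \<omega>" using Zrep[OF \<omega>(1)] by blast
      have small: "\<bar>g (\<omega> s)\<bar> \<le> c" if s: "s \<in> {0..<t m K}" for s
      proof -
        have sT: "s \<in> {0..real T}" using s tT[OF K(1)] by auto
        obtain k where k: "k \<le> Suc m" "t m k \<le> s" "s - t m k < min \<delta> \<delta>'" "k < K"
          using near[OF sT, of K] s by auto
        then have "g (\<omega> (t m k)) = 0" using K(2)[of k] by (simp add: R_def)
        moreover have "dist (g (\<omega> s)) (g (\<omega> (t m k))) < c"
          using tT[OF k(1)] sT k(2,3) by (intro \<delta>(2)) (auto simp: dist_real_def)
        ultimately show ?thesis by (simp add: dist_real_def)
      qed
      have "\<bar>D m K \<omega>\<bar> \<le> c * t m K"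
      proof (cases "K = 0")
        case False
        show ?thesis
        proof (rule Dbound[OF \<omega>(1)])
          fix s assume s: "s \<in> {0..t m K}"
          show "\<bar>g (\<omega> s)\<bar> \<le> c"
          \<comment> \<open>At the stopping time itself \<open>g\<close> may be nonzero; it is
            compared with the previous grid time, one mesh width earlier.\<close>
          proof (cases "s = t m K")
            case True
            have sT: "s \<in> {0..real T}" using s tT[OF K(1)] by auto
            define k where "k = K - 1"
            have k: "Suc k = K" "k < K" "k \<le> Suc m" using \<open>K \<noteq> 0\<close> K(1) by (auto simp: k_def)
            have "t m K - t m k = real T / real (Suc m)"
              by (simp add: k(1)[symmetric] t_def diff_divide_distrib[symmetric] algebra_simps)
            then have "dist (g (\<omega> s)) (g (\<omega> (t m k))) < c"
              using tT[OF k(3)] sT True elim t(2)[of m k] k(1) by (intro \<delta>(2)) (auto simp: dist_real_def)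
            moreover have "g (\<omega> (t m k)) = 0" using K(2)[OF k(2)] by (simp add: R_def)
            ultimately show ?thesis by (simp add: dist_real_def)
          qed (use s small in auto)
        qed
      qed (simp add: D_def t(3))
      also have "\<dots> \<le> c * real T" using tT[OF K(1)] c(1) by (intro mult_left_mono) auto
      finally have Dsmall: "\<bar>D m K \<omega>\<bar> \<le> \<epsilon>" using c(2) by linarith
      show ?case
      proof (cases "\<omega> \<in> good")
        case False
        then show ?thesis using K(4) Dsmall fB[of "\<omega> (t m K)"] fB[of "\<omega> 0"] by simp
      next
        case True
        have inW: "\<omega> s \<in> W" if "s \<in> \<rat> \<inter> {0..real T}" for s using True that by (simp add: good)
        have KW: "\<omega> (t m K) \<in> W" by (rule inW[OF tT[OF K(1)]])
        obtain s0 where s0: "s0 \<in> {0..real T}" "\<And>s. s \<in> {0..real T} \<Longrightarrow> \<bar>s - s0\<bar> < \<delta>' \<Longrightarrow> \<omega> s \<in> V"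
          using \<delta>'(2)[OF True] by blast
        obtain k where k: "k \<le> Suc m" "t m k \<le> s0" "s0 - t m k < min \<delta> \<delta>'" using near[OF s0(1)] by blast
        have kV: "\<omega> (t m k) \<in> V" using tT[OF k(1)] k(2,3) by (intro s0(2)) auto
        have "\<omega> (t m K) \<in> V"
        proof (cases "K = Suc m")
          \<comment> \<open>The grid has run to its last index \<open>Suc m\<close> without an
            earlier stop, so the grid point known to lie in \<open>V\<close> must be that last
            one.\<close>
          case True
          have "\<not> k < K" using kV K(2)[of k] by (auto simp: R_def)
          then have "k = K" using k(1) True by linarith
          then show ?thesis using kV by simp
        next
          case False
          then have "\<omega> (t m K) \<in> R" using K(3) by blast
          then show ?thesis using gW[OF KW] by (auto simp: R_def)
        qed
        then have "f (\<omega> (t m K)) \<le> \<kappa>" using V(2) fW[OF KW] by simp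
        moreover have "f (\<omega> 0) = u y" using fW[OF W(3)] \<omega>(2) by simp
        ultimately show ?thesis using K(4) Dsmall True by simp
      qed
    qed
  qed
  define Gd where "Gd \<omega> = (\<kappa> - u y) * indicator good \<omega> + 2 * B * (1 - indicator good \<omega>)" for \<omega> :: "real \<Rightarrow> 'm"
  have ig: "integrable (P y) (indicator good :: _ \<Rightarrow> real)"
    using good_ev by (simp add: integrable_real_indicator emeasure_eq_measure)
  have Gi: "integrable (P y) Gd" unfolding Gd_def[abs_def] using ig by simp
  \<comment> \<open>The positive part of \<open>Z m - Gd\<close> does converge to 0 and is bounded
    by a constant, so dominated convergence applies although \<open>Z m\<close> may oscillate. Since
    \<open>Z m\<close> has mean 0, the mean of \<open>Gd\<close> is then nonnegative.\<close>
  have "(\<lambda>m. \<integral>\<omega>. max (Z m \<omega> - Gd \<omega>) 0 \<partial>P y) \<longlonglongrightarrow> (\<integral>\<omega>. 0 \<partial>P y)"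
  proof (rule integral_dominated_convergence[where w="\<lambda>_. 4 * B + Gb * real T + \<bar>\<kappa>\<bar> + B"])
    show "(\<lambda>\<omega>. max (Z m \<omega> - Gd \<omega>) 0) \<in> borel_measurable (P y)" for m
      using Zi[of m] Gi by measurable
    show "AE \<omega> in P y. (\<lambda>m. max (Z m \<omega> - Gd \<omega>) 0) \<longlonglongrightarrow> 0"
      using P0 AE_space
    proof eventually_elim
      case (elim \<omega>)
      show ?case
      proof (rule order_tendstoI)
        fix a :: real assume "a < 0"
        then show "\<forall>\<^sub>F m in sequentially. a < max (Z m \<omega> - Gd \<omega>) 0" by (simp add: less_max_iff_disj)
      next
        fix a :: real assume "0 < a"
        then have "\<forall>\<^sub>F m in sequentially. Z m \<omega> \<le> (if \<omega> \<in> good then \<kappa> - u y else 2 * B) + a / 2"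
          using elim space by (intro Zeventually) auto
        then show "\<forall>\<^sub>F m in sequentially. max (Z m \<omega> - Gd \<omega>) 0 < a"
          by eventually_elim (use \<open>0 < a\<close> in \<open>auto simp: Gd_def split: if_splits\<close>)
      qed
    qed
    show "AE \<omega> in P y. norm (max (Z m \<omega> - Gd \<omega>) 0) \<le> 4 * B + Gb * real T + \<bar>\<kappa>\<bar> + B" for m
    proof (rule AE_I2)
      fix \<omega> assume "\<omega> \<in> space (P y)"
      then have "\<bar>Z m \<omega>\<bar> \<le> 2 * B + Gb * real T" using Zbound space by simp
      moreover have "\<bar>Gd \<omega>\<bar> \<le> \<bar>\<kappa>\<bar> + B + 2 * B"
        using u(2)[of y] B0 by (auto simp: Gd_def indicator_def)
      moreover have "0 \<le> Gb * real T" using Gb0 by simp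
      moreover have "norm (max (Z m \<omega> - Gd \<omega>) 0) \<le> \<bar>Z m \<omega>\<bar> + \<bar>Gd \<omega>\<bar>"
        unfolding real_norm_def by linarith
      ultimately show "norm (max (Z m \<omega> - Gd \<omega>) 0) \<le> 4 * B + Gb * real T + \<bar>\<kappa>\<bar> + B"
        using B0 by linarith
    qed
  qed auto
  moreover have "(\<integral>\<omega>. max (Z m \<omega> - Gd \<omega>) 0 \<partial>P y) \<ge> - (\<integral>\<omega>. Gd \<omega> \<partial>P y)" for m
  proof -
    have "(\<integral>\<omega>. Z m \<omega> - Gd \<omega> \<partial>P y) \<le> (\<integral>\<omega>. max (Z m \<omega> - Gd \<omega>) 0 \<partial>P y)"
      using Zi Gi by (intro integral_mono integrable_max Bochner_Integration.integrable_diff) auto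
    then show ?thesis using Zi Gi Z0 by simp
  qed
  ultimately have "- (\<integral>\<omega>. Gd \<omega> \<partial>P y) \<le> 0"
    by (intro tendsto_lowerbound[where F=sequentially and f="\<lambda>m. \<integral>\<omega>. max (Z m \<omega> - Gd \<omega>) 0 \<partial>P y"]) auto
  moreover have "(\<integral>\<omega>. Gd \<omega> \<partial>P y) = (\<kappa> - u y) * prob good + 2 * B * (1 - prob good)"
    unfolding Gd_def using ig good_ev by (simp add: prob_space)
  ultimately show "0 \<le> (\<kappa> - u y) * prob good + 2 * B * (1 - prob good)" by simp
qed

text \<open>\<open>harmonic_bound_stopped\<close> carries an error proportional to the probability
  of not being \<open>good\<close>. Almost every path hits \<open>V\<close> by some time
  \<open>T\<close>, and its compact trace up to \<open>T\<close> lies in one \<open>W j\<close>; so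
  this probability can be made arbitrarily small.\<close>

lemma harmonic_bound_if_hitting:
  assumes P: "L_diffusion A L P" and u: "L_harmonic A L u" "\<And>x. \<bar>u x\<bar> \<le> B"
    and V: "open V" "\<And>x. x \<in> V \<Longrightarrow> u x \<le> \<kappa>"
    and hit: "AE \<omega> in P y. \<exists>t\<ge>0. \<omega> t \<in> V"
  shows "u y \<le> \<kappa>"
proof (rule ccontr)
  assume "\<not> u y \<le> \<kappa>"
  then have less: "\<kappa> < u y" by simp
  have Pm: "P \<in> borel \<rightarrow>\<^sub>M prob_algebra (path_algebra {0..})" using P by (auto simp: L_diffusion_def)
  have "P y \<in> space (prob_algebra (path_algebra {0..}))" using measurable_space[OF Pm, of y] by simp
  then have ps: "prob_space (P y)" and sets: "sets (P y) = sets (path_algebra {0..})"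
    by (auto simp: space_prob_algebra)
  interpret prob_space "P y" by (rule ps)
  have space: "space (P y) = paths" using sets_eq_imp_space_eq[OF sets] by simp
  obtain \<psi> W where \<psi>: "\<And>j. smooth_fun A (\<psi> j)" "\<And>j. compactly_supported (\<psi> j)" "\<And>j y. 0 \<le> \<psi> j y \<and> \<psi> j y \<le> 1"
    "\<And>j. open (W j)" "incseq W" "(\<Union>j. W j) = UNIV" "\<And>j y. y \<in> W j \<Longrightarrow> \<psi> j y = 1"
    by (rule cutoffs_exist) blast
  define good where "good T j = {\<omega> \<in> paths. (\<forall>s\<in>\<rat> \<inter> {0..real T}. \<omega> s \<in> W j) \<and> (\<exists>s\<in>\<rat> \<inter> {0..real T}. \<omega> s \<in> V)}"
    for T j :: nat
  obtain j0 where j0: "y \<in> W j0" using \<psi>(6) by blast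
  have key: "good T (j0 + j) \<in> sets (P y)"
    "0 \<le> (\<kappa> - u y) * prob (good T (j0 + j)) + 2 * B * (1 - prob (good T (j0 + j)))" for T j
  proof -
    have "y \<in> W (j0 + j)" using j0 incseqD[OF \<psi>(5), of j0 "j0 + j"] by auto
    note H = harmonic_bound_stopped[OF P u V \<psi>(1,2,3,4,7) this good_def]
    show "good T (j0 + j) \<in> sets (P y)" by (rule H(1))
    show "0 \<le> (\<kappa> - u y) * prob (good T (j0 + j)) + 2 * B * (1 - prob (good T (j0 + j)))" by (rule H(2))
  qed
  have W_mono: "W j \<subseteq> W k" if "j \<le> k" for j k using incseqD[OF \<psi>(5) that] .
  have good_mono: "good T (j0 + j) \<subseteq> good T (j0 + k)" if "j \<le> k" for T j k
    using W_mono[of "j0 + j" "j0 + k"] that unfolding good_def by auto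
  \<comment> \<open>\<open>good T j\<close> grows with \<open>j\<close> but need not grow with
    \<open>T\<close>, since a longer horizon makes leaving \<open>W j\<close> easier. Taking the
    union over \<open>j\<close> first restores monotonicity in \<open>T\<close>.\<close>
  define hits where "hits T = (\<Union>j. good T (j0 + j))" for T
  have exhaust: "\<omega> \<in> hits T" if \<omega>: "\<omega> \<in> paths" "\<exists>s\<in>\<rat> \<inter> {0..real T}. \<omega> s \<in> V" for \<omega> T
  proof -
    have "compact (\<omega> ` {0..real T})"
      using \<omega>(1) by (intro compact_continuous_image) (auto simp: paths_def intro: continuous_on_subset)
    then obtain F where F: "finite F" "\<omega> ` {0..real T} \<subseteq> (\<Union>j\<in>F. W j)"
      using compactE_image[of "\<omega> ` {0..real T}" UNIV W] \<psi>(4,6) by (metis subset_UNIV)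
    define J where "J = Max (insert 0 F)"
    have "\<omega> s \<in> W (j0 + J)" if s: "s \<in> {0..real T}" for s
    proof -
      obtain j where j: "j \<in> F" "\<omega> s \<in> W j" using F(2) s by blast
      then have "j \<le> j0 + J" using F(1) by (auto simp: J_def intro: trans_le_add2)
      then show ?thesis using j(2) W_mono by blast
    qed
    then have "\<omega> \<in> good T (j0 + J)" using \<omega> by (auto simp: good_def)
    then show ?thesis unfolding hits_def by blast
  qed
  have "AE \<omega> in P y. \<omega> \<in> (\<Union>T. hits T)"
    using hit AE_space
  proof eventually_elim
    case (elim \<omega>)
    then obtain s where s: "s \<ge> 0" "\<omega> s \<in> V" and \<omega>: "\<omega> \<in> paths" by (auto simp: space)
    have "(\<omega> \<longlongrightarrow> \<omega> s) (at s within {0..})" using \<omega> s(1) by (auto simp: paths_def continuous_on_def)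
    then have "\<forall>\<^sub>F r in at s within {0..}. \<omega> r \<in> V" using V(1) s(2) by (rule topological_tendstoD)
    then obtain d where d: "d > 0" "\<And>r. r \<in> {0..} \<Longrightarrow> r \<noteq> s \<Longrightarrow> dist r s < d \<Longrightarrow> \<omega> r \<in> V"
      unfolding eventually_at by blast
    \<comment> \<open>A hit at time \<open>s\<close> persists for a while after \<open>s\<close> and
      is therefore seen at a rational time, as \<open>good\<close> demands.\<close>
    obtain q where q: "q \<in> \<rat>" "s < q" "q < s + d" using Rats_dense_in_real[of s "s + d"] d(1) by auto
    then have "\<omega> q \<in> V" using s(1) by (intro d(2)) (auto simp: dist_real_def)
    moreover obtain T :: nat where "q \<le> real T" using real_arch_simple by blast
    ultimately have "\<omega> \<in> hits T" using q s(1) by (intro exhaust[OF \<omega>]) auto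
    then show ?case by blast
  qed
  moreover have "range hits \<subseteq> events" unfolding hits_def using key(1) by auto
  moreover have "incseq hits"
  proof (rule monoI, rule subsetI)
    fix T T' :: nat and \<omega> assume "T \<le> T'" "\<omega> \<in> hits T"
    then show "\<omega> \<in> hits T'"
      unfolding hits_def good_def by (intro exhaust[unfolded hits_def good_def]) force+
  qed
  ultimately have approx: "\<exists>T. prob (hits T) > 1 - \<epsilon>" if "\<epsilon> > 0" for \<epsilon>
    using events_increasing_approx[of hits \<epsilon>] that by blast
  \<comment> \<open>Makes the error \<open>\<epsilon> * (u y - \<kappa> + 2 * B)\<close> equal to
    half of the supposed gap \<open>u y - \<kappa>\<close>.\<close>
  define \<epsilon> where "\<epsilon> = (u y - \<kappa>) / (2 * (u y - \<kappa> + 2 * B))"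
  have B0: "B \<ge> 0" using u(2)[of y] by linarith
  have \<epsilon>: "\<epsilon> > 0" "\<epsilon> * (u y - \<kappa> + 2 * B) < u y - \<kappa>"
  proof -
    have pos: "u y - \<kappa> > 0" "u y - \<kappa> + 2 * B > 0" using less B0 by auto
    then show "\<epsilon> > 0" by (simp add: \<epsilon>_def)
    have "\<epsilon> * (u y - \<kappa> + 2 * B) = (u y - \<kappa>) / 2" using pos(2) unfolding \<epsilon>_def
      by (simp only: times_divide_eq_left mult_divide_mult_cancel_right[OF less_imp_neq[THEN not_sym]])
    then show "\<epsilon> * (u y - \<kappa> + 2 * B) < u y - \<kappa>" using pos(1) by simp
  qed
  obtain T where T: "prob (hits T) > 1 - \<epsilon> / 2" using approx[of "\<epsilon> / 2"] \<epsilon>(1) by auto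
  have "incseq (\<lambda>j. good T (j0 + j))" by (intro monoI good_mono)
  then have "(\<lambda>j. prob (good T (j0 + j))) \<longlonglongrightarrow> prob (hits T)"
    unfolding hits_def using key(1) by (intro finite_Lim_measure_incseq) auto
  then have "\<forall>\<^sub>F j in sequentially. prob (good T (j0 + j)) > 1 - \<epsilon> / 2"
    using T by (rule order_tendstoD)
  then obtain j where j: "prob (good T (j0 + j)) > 1 - \<epsilon> / 2"
    using eventually_happens'[OF sequentially_bot] by blast
  define p where "p = prob (good T (j0 + j))"
  have "0 \<le> (\<kappa> - u y) * p + 2 * B * (1 - p)" unfolding p_def by (rule key)
  also have "\<dots> = (1 - p) * (u y - \<kappa> + 2 * B) - (u y - \<kappa>)" by (simp add: algebra_simps)
  also have "\<dots> \<le> \<epsilon> * (u y - \<kappa> + 2 * B) - (u y - \<kappa>)"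
    using j \<epsilon>(1) less B0 by (intro diff_right_mono mult_right_mono) (auto simp: p_def)
  also have "\<dots> < 0" using \<epsilon>(2) by simp
  finally show False by simp
qed

end

section \<open>The upper FC-central series\<close>

text \<open>A conjugacy class of \<open>G Mod H\<close> is the image of one of \<open>G\<close>.
  This moves the finiteness condition from the quotient into \<open>G\<close>, where it can be
  combined with the action.\<close>

lemma (in normal) FC_step_iff:
  "x \<in> FC_step G H \<longleftrightarrow> x \<in> carrier G \<and> finite ((\<lambda>h. H #> (h \<otimes> x \<otimes> inv h)) ` carrier G)"
proof (cases "x \<in> carrier G")
  case True
  interpret Q: group "G Mod H" by (rule factorgroup_is_group)
  interpret q: group_hom G "G Mod H" "(#>) H"
    by unfold_locales (rule r_coset_hom_Mod)
  have "{k \<otimes>\<^bsub>G Mod H\<^esub> (H #> x) \<otimes>\<^bsub>G Mod H\<^esub> inv\<^bsub>G Mod H\<^esub> k |k. k \<in> carrier (G Mod H)}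
    = (\<lambda>h. (H #> h) \<otimes>\<^bsub>G Mod H\<^esub> (H #> x) \<otimes>\<^bsub>G Mod H\<^esub> inv\<^bsub>G Mod H\<^esub> (H #> h)) ` carrier G"
    by (auto simp: carrier_FactGroup)
  also have "\<dots> = (\<lambda>h. H #> (h \<otimes> x \<otimes> inv h)) ` carrier G"
    using True by (intro image_cong) simp_all
  finally show ?thesis
    using True q.hom_closed[OF True] by (simp add: FC_step_def FC_center_def)
qed (simp add: FC_step_def)

text \<open>Conjugation is a homomorphism, so each coset of a conjugate of
  \<open>x \<otimes> y\<close> is the product of one of finitely many cosets for \<open>x\<close>
  with one of finitely many for \<open>y\<close>.\<close>

lemma (in normal) FC_step_mult:
  assumes "x \<in> FC_step G H" "y \<in> FC_step G H"
  shows "x \<otimes> y \<in> FC_step G H"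
proof -
  have xy: "x \<in> carrier G" "y \<in> carrier G" using assms by (auto simp: FC_step_iff)
  let ?c = "\<lambda>x h. H #> (h \<otimes> x \<otimes> inv h)"
  have "?c (x \<otimes> y) h = ?c x h <#> ?c y h" if "h \<in> carrier G" for h
    using that xy by (simp add: rcos_sum m_assoc inv_solve_left)
      (metis inv_closed l_inv l_one m_assoc m_closed)
  then have "?c (x \<otimes> y) ` carrier G \<subseteq> (\<lambda>(X, Y). X <#> Y) ` (?c x ` carrier G \<times> ?c y ` carrier G)"
    by auto
  moreover have "finite (?c x ` carrier G \<times> ?c y ` carrier G)"
    using assms by (auto simp: FC_step_iff)
  ultimately have "finite (?c (x \<otimes> y) ` carrier G)" by (meson finite_imageI finite_subset)
  then show ?thesis using xy by (auto simp: FC_step_iff)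
qed

lemma (in normal) FC_step_inv:
  assumes "x \<in> FC_step G H"
  shows "inv x \<in> FC_step G H"
proof -
  have x: "x \<in> carrier G" using assms by (auto simp: FC_step_iff)
  let ?c = "\<lambda>x h. H #> (h \<otimes> x \<otimes> inv h)"
  have "?c (inv x) h = set_inv (?c x h)" if "h \<in> carrier G" for h
    using that x by (simp add: rcos_inv inv_mult_group m_assoc)
  then have "?c (inv x) ` carrier G \<subseteq> (\<lambda>X. set_inv X) ` (?c x ` carrier G)" by auto
  moreover have "finite (?c x ` carrier G)" using assms by (auto simp: FC_step_iff)
  ultimately have "finite (?c (inv x) ` carrier G)" by (meson finite_imageI finite_subset)
  then show ?thesis using x by (auto simp: FC_step_iff)
qed

lemma (in normal) FC_step_conj:
  assumes "x \<in> FC_step G H" "g \<in> carrier G"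
  shows "g \<otimes> x \<otimes> inv g \<in> FC_step G H"
proof -
  have x: "x \<in> carrier G" using assms by (auto simp: FC_step_iff)
  let ?c = "\<lambda>x h. H #> (h \<otimes> x \<otimes> inv h)"
  have "?c (g \<otimes> x \<otimes> inv g) h = ?c x (h \<otimes> g)" if "h \<in> carrier G" for h
    using that x assms(2) by (simp add: inv_mult_group m_assoc)
  then have "?c (g \<otimes> x \<otimes> inv g) ` carrier G \<subseteq> ?c x ` carrier G" using assms(2) by auto
  moreover have "finite (?c x ` carrier G)" using assms by (auto simp: FC_step_iff)
  ultimately have "finite (?c (g \<otimes> x \<otimes> inv g) ` carrier G)" by (meson finite_subset)
  then show ?thesis using x assms(2) by (auto simp: FC_step_iff)
qed

lemma (in normal) subset_FC_step: "H \<subseteq> FC_step G H"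
proof
  fix x assume x: "x \<in> H"
  have "H #> (h \<otimes> x \<otimes> inv h) = H" if "h \<in> carrier G" for h
    using that x by (intro coset_join2) (auto intro: inv_op_closed2 is_subgroup)
  then have "(\<lambda>h. H #> (h \<otimes> x \<otimes> inv h)) ` carrier G \<subseteq> {H}" by blast
  then have "finite ((\<lambda>h. H #> (h \<otimes> x \<otimes> inv h)) ` carrier G)" by (rule finite_subset) simp
  then show "x \<in> FC_step G H" using mem_carrier[OF x] FC_step_iff by blast
qed

lemma (in normal) FC_step_normal: "FC_step G H \<lhd> G"
proof (rule normal_invI)
  show "subgroup (FC_step G H) G"
  proof (rule subgroupI)
    show "FC_step G H \<subseteq> carrier G" by (auto simp: FC_step_def)
    show "FC_step G H \<noteq> {}" using subset_FC_step subgroup.one_closed[OF is_subgroup] by blast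
  qed (simp_all add: FC_step_mult FC_step_inv)
qed (simp add: FC_step_conj)

text \<open>Transfinite induction along the well-order. Besides containment in \<open>I\<close> it
  carries normality, which gives the next quotient its meaning, and monotonicity, which makes the
  union at a limit a subgroup.\<close>

lemma (in group) FC_hypercenter_subset:
  assumes one: "\<one> \<in> I" and step: "\<And>N. N \<lhd> G \<Longrightarrow> N \<subseteq> I \<Longrightarrow> FC_step G N \<subseteq> I"
  shows "FC_hypercenter G \<subseteq> I"
proof -
  have "S \<alpha> \<subseteq> I" if S: "upper_FC_series G r S" and \<alpha>: "\<alpha> \<in> Field r" for r :: "'a set rel" and S \<alpha>
  proof -
    have wo: "Well_order r" using S by (simp add: upper_FC_series_def)
    then have wo': "wo_rel r" by (simp add: wo_rel_def)
    have "\<alpha> \<in> Field r \<longrightarrow> S \<alpha> \<lhd> G \<and> S \<alpha> \<subseteq> I \<and> (\<forall>\<gamma>\<in>underS r \<alpha>. S \<gamma> \<subseteq> S \<alpha>)"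
    proof (induction \<alpha> rule: wo_rel.well_order_induct[OF wo'])
      case (1 \<alpha>)
      show ?case
      proof
        assume \<alpha>: "\<alpha> \<in> Field r"
        have IH: "S \<beta> \<lhd> G" "S \<beta> \<subseteq> I" "\<And>\<gamma>. \<gamma> \<in> underS r \<beta> \<Longrightarrow> S \<gamma> \<subseteq> S \<beta>" if "\<beta> \<in> underS r \<alpha>" for \<beta>
          using 1 that by (auto simp: underS_def Field_def)
        consider (zero) "underS r \<alpha> = {}"
          | (succ) \<beta> where "\<beta> \<in> Field r" "underS r \<alpha> = under r \<beta>"
          | (lim) "underS r \<alpha> \<noteq> {}" "\<forall>\<beta>\<in>Field r. underS r \<alpha> \<noteq> under r \<beta>" by blast
        then show "S \<alpha> \<lhd> G \<and> S \<alpha> \<subseteq> I \<and> (\<forall>\<gamma>\<in>underS r \<alpha>. S \<gamma> \<subseteq> S \<alpha>)"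
        proof cases
          case zero
          then have "S \<alpha> = {\<one>}" using S \<alpha> by (simp add: upper_FC_series_def)
          then show ?thesis using zero one one_is_normal by simp
        next
          case succ
          have eq: "S \<alpha> = FC_step G (S \<beta>)" using S \<alpha> succ by (simp add: upper_FC_series_def)
          have \<beta>: "\<beta> \<in> underS r \<alpha>"
            using succ wo_rel.REFL[OF wo'] by (auto simp: under_def refl_on_def)
          interpret normal "S \<beta>" G using IH(1)[OF \<beta>] .
          have "S \<gamma> \<subseteq> S \<alpha>" if "\<gamma> \<in> underS r \<alpha>" for \<gamma>
          proof (cases "\<gamma> = \<beta>")
            case False
            then have "\<gamma> \<in> underS r \<beta>" using that succ by (auto simp: under_def underS_def)
            then show ?thesis using IH(3)[OF \<beta>] subset_FC_step eq by blast
          qed (use subset_FC_step eq in blast)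
          then show ?thesis using eq FC_step_normal step[OF IH(1,2)] \<beta> by auto
        next
          case lim
          then have eq: "S \<alpha> = (\<Union>\<beta>\<in>underS r \<alpha>. S \<beta>)" using S \<alpha> unfolding upper_FC_series_def by blast
          \<comment> \<open>Monotonicity makes the terms below a limit comparable, so two elements
            of their union lie in a common term, where they can be multiplied.\<close>
          have common: "\<exists>\<gamma>\<in>underS r \<alpha>. x \<in> S \<gamma> \<and> y \<in> S \<gamma>" if xy: "x \<in> S \<alpha>" "y \<in> S \<alpha>" for x y
          proof -
            obtain \<beta> \<gamma> where b: "\<beta> \<in> underS r \<alpha>" "x \<in> S \<beta>" "\<gamma> \<in> underS r \<alpha>" "y \<in> S \<gamma>"
              using xy(1)[unfolded eq] xy(2)[unfolded eq] by blast
            then have "\<beta> = \<gamma> \<or> (\<beta>, \<gamma>) \<in> r \<or> (\<gamma>, \<beta>) \<in> r"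
              using wo_rel.TOTAL[OF wo'] b by (auto simp: total_on_def underS_def Field_def)
            then have "S \<beta> \<subseteq> S \<gamma> \<or> S \<gamma> \<subseteq> S \<beta>"
              using IH(3)[OF b(1), of \<gamma>] IH(3)[OF b(3), of \<beta>] by (auto simp: underS_def)
            then show ?thesis using b by blast
          qed
          have "S \<alpha> \<lhd> G"
          proof (rule normal_invI)
            show "subgroup (S \<alpha>) G"
            proof (rule subgroupI)
              show "S \<alpha> \<subseteq> carrier G"
                using IH(1) unfolding eq by (auto dest!: normal_imp_subgroup dest: subgroup.mem_carrier)
              show "S \<alpha> \<noteq> {}"
                using IH(1) lim(1) unfolding eq by (auto dest!: normal_imp_subgroup dest: subgroup.one_closed)
              show "inv x \<in> S \<alpha>" if "x \<in> S \<alpha>" for x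
                using that IH(1) unfolding eq by (auto dest!: normal_imp_subgroup dest: subgroup.m_inv_closed)
              show "x \<otimes> y \<in> S \<alpha>" if "x \<in> S \<alpha>" "y \<in> S \<alpha>" for x y
              proof -
                from common[OF that] obtain \<gamma> where \<gamma>: "\<gamma> \<in> underS r \<alpha>" "x \<in> S \<gamma>" "y \<in> S \<gamma>"
                  by blast
                then have "x \<otimes> y \<in> S \<gamma>"
                  using normal_imp_subgroup[OF IH(1)] by (intro subgroup.m_closed)
                then show ?thesis using \<gamma>(1) unfolding eq by blast
              qed
            qed
            show "g \<otimes> h \<otimes> inv g \<in> S \<alpha>" if "h \<in> S \<alpha>" "g \<in> carrier G" for h g
              using that IH(1) unfolding eq by (auto dest: normal.inv_op_closed2)
          qed
          then show ?thesis using eq IH(2) by blast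
        qed
      qed
    qed
    then show ?thesis using \<alpha> by blast
  qed
  then show ?thesis unfolding FC_hypercenter_def by blast
qed

section \<open>Bounded harmonic functions and recurrent actions\<close>

locale recurrent_action = elliptic_manifold A L + group G
  for A :: "('m::{t2_space, second_countable_topology}, 'n::finite) chart set"
    and L :: "('m \<Rightarrow> real) \<Rightarrow> 'm \<Rightarrow> real"
    and G :: "('g, 'x) monoid_scheme" (structure) +
  fixes act :: "'g \<Rightarrow> 'm \<Rightarrow> 'm"
  assumes conn: "connected (UNIV :: 'm set)"
    and action: "group_action G (UNIV :: 'm set) act"
    and smooth: "\<And>g. g \<in> carrier G \<Longrightarrow> smooth_map A (act g)"
    and L_act: "\<And>g f x. g \<in> carrier G \<Longrightarrow> smooth_fun A f \<Longrightarrow> L (f \<circ> act g) x = L f (act g x)"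
    and recurrent: "L_recurrent_mod A L G act"
begin

lemma act_mult: "g \<in> carrier G \<Longrightarrow> h \<in> carrier G \<Longrightarrow> act (g \<otimes> h) x = act g (act h x)"
  using group_action.composition_rule[OF action] by simp

lemma act_one [simp]: "act \<one> x = x"
  using group_action.id_eq_one[OF action] by (metis UNIV_I restrict_apply')

lemma act_inv [simp]: "g \<in> carrier G \<Longrightarrow> act (inv g) (act g x) = x" "g \<in> carrier G \<Longrightarrow> act g (act (inv g) x) = x"
  by (simp_all flip: act_mult)

lemma harmonic_act:
  assumes "L_harmonic A L h" "g \<in> carrier G" shows "L_harmonic A L (\<lambda>x. h (act g x))"
proof -
  have "smooth_fun A (h \<circ> act g)"
    using assms by (intro smooth_fun_compose smooth) (auto simp: L_harmonic_def)
  moreover have "L (h \<circ> act g) x = 0" for x using assms L_act by (simp add: L_harmonic_def)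
  ultimately show ?thesis by (simp add: L_harmonic_def o_def)
qed

lemma open_act:
  assumes "open V" "g \<in> carrier G" shows "open (act g ` V)"
proof -
  have "act g ` V = act (inv g) -` V"
  proof
    show "act (inv g) -` V \<subseteq> act g ` V" using act_inv(2)[OF assms(2)] by (metis image_eqI subsetI vimageE)
  qed (use assms(2) in auto)
  moreover have "continuous_on UNIV (act (inv g))"
    using smooth[of "inv g"] assms(2) by (simp add: smooth_map_def)
  ultimately show ?thesis using assms(1) by (simp add: open_vimage)
qed

text \<open>The translates of \<open>V\<close> form an invariant open set containing the orbit of
  \<open>x\<close>, which the diffusion from \<open>y\<close> hits almost surely. The bound is
  assumed on all translates because \<open>u\<close> itself need not be invariant.\<close>

lemma recurrence_bound:
  assumes u: "L_harmonic A L u" "\<And>x. \<bar>u x\<bar> \<le> B"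
    and V: "open V" "x \<in> V" "\<And>g z. g \<in> carrier G \<Longrightarrow> z \<in> V \<Longrightarrow> u (act g z) \<le> \<kappa>"
  shows "u y \<le> \<kappa>"
proof -
  obtain P where P: "L_diffusion A L P" and hit: "\<And>x U y. orbit G act x \<subseteq> interior U \<Longrightarrow>
      (\<forall>g\<in>carrier G. act g ` U = U) \<Longrightarrow> AE \<omega> in P y. \<exists>t\<ge>0. \<omega> t \<in> U"
  proof -
    from recurrent obtain P where P: "L_diffusion A L P" and hit: "\<forall>x U. orbit G act x \<subseteq> interior U \<and> (\<forall>g\<in>carrier G. act g ` U = U) \<longrightarrow>
        (\<forall>y. AE \<omega> in P y. \<exists>t\<ge>0. \<omega> t \<in> U)"
      unfolding L_recurrent_mod_def by (elim exE conjE)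
    show ?thesis by (rule that[OF P]) (use hit in simp)
  qed
  define U where "U = (\<Union>g\<in>carrier G. act g ` V)"
  have U: "open U" unfolding U_def using open_act V(1) by blast
  have sub: "act g ` U \<subseteq> U" if g: "g \<in> carrier G" for g
  proof
    fix z assume "z \<in> act g ` U"
    then obtain k v where k: "k \<in> carrier G" "v \<in> V" "z = act g (act k v)" by (auto simp: U_def)
    then have "z = act (g \<otimes> k) v" using g by (simp add: act_mult)
    then show "z \<in> U" using k g unfolding U_def by blast
  qed
  have inv: "act g ` U = U" if g: "g \<in> carrier G" for g
  proof
    show "U \<subseteq> act g ` U"
    proof
      fix z assume "z \<in> U"
      then have "act (inv g) z \<in> U" using sub[of "inv g"] g by auto
      then show "z \<in> act g ` U" using act_inv(2)[OF g, of z] by (metis image_eqI)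
    qed
  qed (rule sub[OF g])
  have "orbit G act x \<subseteq> interior U"
    unfolding interior_open[OF U] using V(2) by (auto simp: orbit_def U_def)
  then have "AE \<omega> in P y. \<exists>t\<ge>0. \<omega> t \<in> U" by (rule hit) (simp add: inv)
  moreover have "u z \<le> \<kappa>" if "z \<in> U" for z using that V(3) by (auto simp: U_def)
  ultimately show ?thesis by (rule harmonic_bound_if_hitting[OF P u U, rotated])
qed

definition period_group :: "'g set" where
  "period_group = {g \<in> carrier G. \<forall>h. L_harmonic A L h \<and> bounded (range h) \<longrightarrow> (\<forall>x. h (act g x) = h x)}"

text \<open>The supremum argument bounds displacements from above only. The class of bounded
  harmonic functions is stable under change of sign, so equality follows afterwards.\<close>

lemma FC_step_displacement_le:
  assumes N: "N \<lhd> G" "N \<subseteq> period_group" and z: "z \<in> FC_step G N"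
    and h: "L_harmonic A L h" "\<And>x. \<bar>h x\<bar> \<le> B"
  shows "h (act z x) \<le> h x"
proof -
  interpret N: normal N G by (rule N)
  have zG: "z \<in> carrier G" and fin: "finite ((\<lambda>g. N #> (g \<otimes> z \<otimes> inv g)) ` carrier G)"
    using z by (auto simp: N.FC_step_iff)
  \<comment> \<open>The whole conjugacy class is taken, since transporting a displacement by
    \<open>g\<close> conjugates the displacing element. \<open>C\<close> may be infinite; its image
    in the cosets of \<open>N\<close> is finite.\<close>
  define C where "C = (\<lambda>g. g \<otimes> z \<otimes> inv g) ` carrier G"
  have CG: "C \<subseteq> carrier G" using zG by (auto simp: C_def)
  have zC: "z \<in> C" unfolding C_def using zG by (intro image_eqI[of _ _ \<one>]) auto
  have C_conj: "inv g \<otimes> c \<otimes> g \<in> C" if c: "c \<in> C" and g: "g \<in> carrier G" for c g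
  proof -
    obtain k where k: "k \<in> carrier G" "c = k \<otimes> z \<otimes> inv k" using c by (auto simp: C_def)
    have "inv g \<otimes> c \<otimes> g = (inv g \<otimes> k) \<otimes> z \<otimes> inv (inv g \<otimes> k)"
      using k g zG by (simp add: inv_mult_group m_assoc)
    then show ?thesis unfolding C_def using k g by blast
  qed
  have finC: "finite ((\<lambda>c. N #> c) ` C)" using fin by (simp add: C_def image_image)
  define H where "H = {h. L_harmonic A L h \<and> (\<forall>x. \<bar>h x\<bar> \<le> B)}"
  have H_act: "(\<lambda>x. h (act g x)) \<in> H" if "h \<in> H" "g \<in> carrier G" for h g
    using that harmonic_act by (auto simp: H_def)
  \<comment> \<open>\<open>N\<close> acts trivially on bounded harmonic functions, so a displacement
    by \<open>c\<close> depends only on the coset of \<open>c\<close>.\<close>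
  have H_coset: "h (act c x) = h (act c' x)" if "h \<in> H" "c \<in> C" "c' \<in> C" "N #> c = N #> c'" for h c c' x
  proof -
    have "c \<in> N #> c'" using that rcos_self[OF _ N.is_subgroup] CG by blast
    then obtain n where n: "n \<in> N" "c = n \<otimes> c'" by (auto simp: r_coset_def)
    have "bounded (range h)" using that(1) by (auto simp: H_def bounded_iff)
    then have "h (act n (act c' x)) = h (act c' x)"
      using n(1) N(2) that(1) by (auto simp: period_group_def H_def)
    then show ?thesis using n that(3) CG by (simp add: act_mult N.mem_carrier subsetD)
  qed
  define D where "D = {h (act c x) - h x | h c x. h \<in> H \<and> c \<in> C}"
  have D_le: "d \<le> 2 * B" if d: "d \<in> D" for d
  proof -
    obtain k c x where "d = k (act c x) - k x" "k \<in> H" using d by (auto simp: D_def)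
    then have "\<bar>k (act c x)\<bar> \<le> B" "\<bar>k x\<bar> \<le> B" "d = k (act c x) - k x" by (auto simp: H_def)
    then show ?thesis by linarith
  qed
  then have bdd: "bdd_above D" by (meson bdd_aboveI)
  have hH: "h \<in> H" using h by (simp add: H_def)
  have ne: "D \<noteq> {}" using hH zC by (auto simp: D_def)
  define K where "K = Sup D"
  have le_K: "h (act c x) - h x \<le> K" if "h \<in> H" "c \<in> C" for h c x
    unfolding K_def by (rule cSup_upper[OF _ bdd]) (use that in \<open>auto simp: D_def\<close>)
  have dH: "L_harmonic A L (\<lambda>x. h (act c x) - h x)" "\<And>x. \<bar>h (act c x) - h x\<bar> \<le> 2 * B"
    if "h \<in> H" "c \<in> C" for h c
  proof -
    show "L_harmonic A L (\<lambda>x. h (act c x) - h x)"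
      using that CG by (intro harmonic_diff harmonic_act) (auto simp: H_def)
    show "\<bar>h (act c x) - h x\<bar> \<le> 2 * B" for x
    proof -
      have "\<bar>h (act c x)\<bar> \<le> B" "\<bar>h x\<bar> \<le> B" using that by (auto simp: H_def)
      then show ?thesis by linarith
    qed
  qed
  have "K \<le> 0"
  proof (rule ccontr)
    assume "\<not> K \<le> 0"
    then have K: "K > 0" by simp
    have near: "\<exists>h\<in>H. \<exists>c\<in>C. h (act c x) - h x > K - \<epsilon>" if \<epsilon>: "\<epsilon> > 0" for \<epsilon>
    proof (rule ccontr)
      assume neg: "\<not> ?thesis"
      obtain V where V: "open V" "x \<in> V"
        "\<And>d y. L_harmonic A L d \<Longrightarrow> (\<And>z. \<bar>d z\<bar> \<le> 2 * B) \<Longrightarrow> y \<in> V \<Longrightarrow> \<bar>d y - d x\<bar> < \<epsilon> / 2"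
        by (rule equicontinuous[of "\<epsilon> / 2" x "2 * B"]) (use \<epsilon> in auto)
      have V_le: "k (act c y) - k y \<le> K - \<epsilon> / 2" if k: "k \<in> H" "c \<in> C" "y \<in> V" for k c y
      proof -
        have "k (act c x) - k x \<le> K - \<epsilon>" using neg k(1,2) by (meson not_le)
        then show ?thesis using V(3)[OF dH[OF k(1,2)] k(3)] by argo
      qed
      have "d \<le> K - \<epsilon> / 2" if "d \<in> D" for d
      proof -
        obtain k c y where d: "d = k (act c y) - k y" "k \<in> H" "c \<in> C" using \<open>d \<in> D\<close> by (auto simp: D_def)
        have cG: "c \<in> carrier G" using d CG by blast
        have "k (act c y) - k y \<le> K - \<epsilon> / 2"
        proof (rule recurrence_bound[OF dH[OF d(2,3)] V(1,2)])
          fix g w assume g: "g \<in> carrier G" and w: "w \<in> V"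
          \<comment> \<open>The displacement of \<open>k\<close> by \<open>c\<close> at
            \<open>act g w\<close> is the displacement at \<open>w\<close> of \<open>k\<close>
            composed with \<open>act g\<close>, by a conjugate of \<open>c\<close>. Both stay in the
            families over which the bound on \<open>V\<close> is uniform.\<close>
          have "act g (act (inv g \<otimes> c \<otimes> g) w) = act c (act g w)"
            using g cG by (simp add: act_mult)
          then show "k (act c (act g w)) - k (act g w) \<le> K - \<epsilon> / 2"
            using V_le[OF H_act[OF d(2) g] C_conj[OF d(3) g] w] by simp
        qed
        then show ?thesis using d(1) by simp
      qed
      then have "K \<le> K - \<epsilon> / 2" unfolding K_def by (rule cSup_least[OF ne])
      then show False using \<open>\<epsilon> > 0\<close> by simp
    qed
    \<comment> \<open>Exchange of quantifiers by pigeonhole: if every \<open>c\<close> failed with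
      its own gap, the smallest of finitely many gaps, one per coset of \<open>N\<close>, would
      contradict \<open>near\<close>.\<close>
    have "\<exists>c\<in>C. \<forall>\<epsilon>>0. \<exists>h\<in>H. h (act c x) - h x > K - \<epsilon>"
    proof (rule ccontr)
      assume "\<not> ?thesis"
      then have "\<forall>c\<in>C. \<exists>\<epsilon>>0. \<forall>h\<in>H. h (act c x) - h x \<le> K - \<epsilon>" by (simp add: not_less)
      then obtain e where e: "\<And>c. c \<in> C \<Longrightarrow> e c > 0" "\<And>c h. c \<in> C \<Longrightarrow> h \<in> H \<Longrightarrow> h (act c x) - h x \<le> K - e c"
        by metis
      obtain r where r: "\<And>Q. Q \<in> (\<lambda>c. N #> c) ` C \<Longrightarrow> r Q \<in> C \<and> N #> r Q = Q"
      proof -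
        have "\<forall>Q\<in>(\<lambda>c. N #> c) ` C. \<exists>c. c \<in> C \<and> N #> c = Q" by blast
        from bchoice[OF this] show ?thesis using that by blast
      qed
      define \<epsilon> where "\<epsilon> = Min ((\<lambda>Q. e (r Q)) ` (\<lambda>c. N #> c) ` C)"
      have "\<epsilon> > 0" unfolding \<epsilon>_def using finC zC e(1) r by (subst Min_gr_iff) auto
      then obtain k c where k: "k \<in> H" "c \<in> C" "k (act c x) - k x > K - \<epsilon>" using near by blast
      define c' where "c' = r (N #> c)"
      have c': "c' \<in> C" "N #> c' = N #> c" using r k(2) by (auto simp: c'_def)
      have "k (act c x) = k (act c' x)" using H_coset[OF k(1,2) c'(1)] c'(2) by simp
      moreover have "\<epsilon> \<le> e c'" unfolding \<epsilon>_def c'_def using finC k(2) by (intro Min_le) auto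
      ultimately show False using k(3) e(2)[OF c'(1) k(1)] by linarith
    qed
    then obtain c where c: "c \<in> C" "\<And>\<epsilon>. \<epsilon> > 0 \<Longrightarrow> \<exists>h\<in>H. h (act c x) - h x > K - \<epsilon>" by blast
    define p where "p i = (act c ^^ i) x" for i
    \<comment> \<open>After \<open>J\<close> steps of size at least \<open>K / 2\<close> the total
      increase exceeds \<open>2 * B\<close>, a bound for the oscillation of every function in
      \<open>H\<close>.\<close>
    obtain J :: nat where J: "4 * B / K < real J" using reals_Archimedean2 by blast
    \<comment> \<open>\<open>K + 2 * B\<close> bounds \<open>K\<close> minus a displacement, as
      displacements have size at most \<open>2 * B\<close>. The thresholds depend on the points
      \<open>p i\<close> but not on the harmonic function, so they are available before
      \<open>k\<close> is chosen.\<close>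
    have "\<exists>\<delta>>0. \<forall>h. L_harmonic A L h \<and> (\<forall>z. 0 \<le> h z \<and> h z \<le> K + 2 * B) \<and> h x < \<delta> \<longrightarrow> h (p i) < K / 2" for i
      using smallness_propagates[OF conn, of "K + 2 * B" x "p i"] K by (meson half_gt_zero)
    then obtain \<delta> where \<delta>: "\<And>i. \<delta> i > 0"
      "\<And>i h. L_harmonic A L h \<Longrightarrow> (\<And>z. 0 \<le> h z \<and> h z \<le> K + 2 * B) \<Longrightarrow> h x < \<delta> i \<Longrightarrow> h (p i) < K / 2" by metis
    define \<delta>0 where "\<delta>0 = Min (insert 1 (\<delta> ` {..<J}))"
    have \<delta>0: "\<delta>0 > 0" "\<And>i. i < J \<Longrightarrow> \<delta>0 \<le> \<delta> i" using \<delta>(1) by (auto simp: \<delta>0_def)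
    obtain k where k: "k \<in> H" "k (act c x) - k x > K - \<delta>0" using c(2)[OF \<delta>0(1)] by blast
    have step: "k (p (Suc i)) - k (p i) \<ge> K / 2" if "i < J" for i
    proof -
      let ?v = "\<lambda>x. K - (k (act c x) - k x)"
      have "?v (p i) < K / 2"
      proof (rule \<delta>(2))
        show "L_harmonic A L ?v" by (intro harmonic_diff harmonic_const dH k(1) c(1))
        show "0 \<le> ?v z \<and> ?v z \<le> K + 2 * B" for z
          using le_K[OF k(1) c(1), of z] dH(2)[OF k(1) c(1), of z] by argo
        show "?v x < \<delta> i" using k(2) \<delta>0(2)[OF that] by simp
      qed
      then show ?thesis by (simp add: p_def)
    qed
    have "real J * (K / 2) \<le> (\<Sum>i<J. k (p (Suc i)) - k (p i))"
      using sum_bounded_below[of "{..<J}" "K / 2" "\<lambda>i. k (p (Suc i)) - k (p i)"] step by simp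
    also have "\<dots> = k (p J) - k (p 0)" by (rule sum_lessThan_telescope)
    also have "\<dots> \<le> 2 * B"
    proof -
      have "\<bar>k (p J)\<bar> \<le> B" "\<bar>k (p 0)\<bar> \<le> B" using k(1) by (auto simp: H_def)
      then show ?thesis by linarith
    qed
    finally show False using J K by (simp add: field_simps)
  qed
  then show ?thesis using le_K[OF hH zC, of x] by simp
qed

lemma FC_step_period_group:
  assumes N: "N \<lhd> G" "N \<subseteq> period_group"
  shows "FC_step G N \<subseteq> period_group"
proof
  fix z assume z: "z \<in> FC_step G N"
  have "h (act z x) = h x" if h: "L_harmonic A L h" "bounded (range h)" for h x
  proof -
    obtain B where B: "\<And>x. \<bar>h x\<bar> \<le> B" using h(2) by (auto simp: bounded_iff)
    have "L_harmonic A L (\<lambda>x. 0 - h x)" by (intro harmonic_diff harmonic_const h(1))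
    then have "0 - h (act z x) \<le> 0 - h x" using B by (intro FC_step_displacement_le[OF N z, of _ B]) auto
    moreover have "h (act z x) \<le> h x" using FC_step_displacement_le[OF N z h(1) B] .
    ultimately show ?thesis by simp
  qed
  then show "z \<in> period_group" using z by (auto simp: period_group_def FC_step_def)
qed

lemma FC_hypercenter_period_group: "FC_hypercenter G \<subseteq> period_group"
proof (rule FC_hypercenter_subset)
  show "\<one> \<in> period_group" by (simp add: period_group_def)
qed (rule FC_step_period_group)

text \<open>An invariant \<open>h\<close> stays below \<open>h x + \<epsilon>\<close> on all
  translates of a neighborhood of \<open>x\<close>, so \<open>recurrence_bound\<close> spreads this
  bound to every \<open>y\<close>; exchanging the two points gives equality.\<close>

lemma invariant_harmonic_constant:
  assumes h: "L_harmonic A L h" "bounded (range h)" and inv: "\<And>g x. g \<in> carrier G \<Longrightarrow> h (act g x) = h x"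
  shows "h constant_on UNIV"
proof -
  obtain B where B: "\<And>x. \<bar>h x\<bar> \<le> B" using h(2) by (auto simp: bounded_iff)
  have "h y \<le> h x" for x y
  proof (rule field_le_epsilon)
    fix \<epsilon> :: real assume "\<epsilon> > 0"
    have "continuous_on UNIV h" using h(1) by (intro smooth_fun_continuous) (simp add: L_harmonic_def)
    then have "open {z. h z < h x + \<epsilon>}" by (intro open_Collect_less continuous_on_const)
    then show "h y \<le> h x + \<epsilon>"
    proof (rule recurrence_bound[OF h(1) B])
      show "x \<in> {z. h z < h x + \<epsilon>}" using \<open>\<epsilon> > 0\<close> by simp
    qed (use inv in simp)
  qed
  then show ?thesis unfolding constant_on_def by (metis UNIV_I antisym)
qed

end

theorem theoremF:
  fixes A :: "('m::{t2_space, second_countable_topology}, 'n::finite) chart set"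
    and G :: "('g, 'x) monoid_scheme"
    and act :: "'g \<Rightarrow> 'm \<Rightarrow> 'm"
    and L :: "('m \<Rightarrow> real) \<Rightarrow> 'm \<Rightarrow> real"
    and v :: "'m measure"
    and \<phi> :: "'m \<Rightarrow> real"
  assumes manifold: "smooth_atlas A" "connected (UNIV :: 'm set)"
    and action: "group G" "countable (carrier G)" "faithful_action G (UNIV :: 'm set) act"
      "\<And>g. g \<in> carrier G \<Longrightarrow> smooth_map A (act g)" "properly_discontinuous G act"
    and operator: "elliptic_diffusion_operator A L"
    and volume: "riemannian_volume A L v"
    and density: "smooth_fun A \<phi>" "\<And>x. \<phi> x > 0"
    and symmetric: "symmetric_wrt A L \<phi> v"
    and L_invariant: "\<And>g f x. g \<in> carrier G \<Longrightarrow> smooth_fun A f \<Longrightarrow> L (f \<circ> act g) x = L f (act g x)"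
    and \<phi>_invariant: "\<And>g x. g \<in> carrier G \<Longrightarrow> \<phi> (act g x) = \<phi> x"
    and recurrent: "L_recurrent_mod A L G act"
  shows "(\<forall>h. L_harmonic A L h \<and> bounded (range h) \<longrightarrow>
            (\<forall>g\<in>FC_hypercenter G. \<forall>x. h (act g x) = h x)) \<and>
         (FC_hypercentral G \<longrightarrow>
            (\<forall>h. L_harmonic A L h \<and> bounded (range h) \<longrightarrow> h constant_on UNIV))"
proof -
  have "group_action G (UNIV :: 'm set) act" using action(3) by (simp add: faithful_action_def)
  then interpret recurrent_action A L G act
    using manifold action(1,4) operator L_invariant recurrent
    by (intro recurrent_action.intro elliptic_manifold.intro recurrent_action_axioms.intro)
  have inv: "h (act g x) = h x"
    if "L_harmonic A L h" "bounded (range h)" "g \<in> FC_hypercenter G" for h g x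
    using that FC_hypercenter_period_group by (auto simp: period_group_def)
  moreover have "h constant_on UNIV"
    if "FC_hypercentral G" "L_harmonic A L h" "bounded (range h)" for h
    using that inv by (intro invariant_harmonic_constant) (auto simp: FC_hypercentral_def)
  ultimately show ?thesis by blast
qed

end
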